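(* Let $n\ge 1$ and let $\mathcal{B}\subseteq \mathfrak{S}_n$ be a fine set for a complex $\mathfrak{S}_n$-representation $\rho$. Then for every $J=\{j_1<\dots<j_t\}\subseteq [n-1]$: (1) the multiset $\mathcal{B} R_{n,J}^{-1}$ is a fine multiset of $\mathfrak{S}_n$ for the representation $(\rho\downarrow_{\mathfrak{S}_{\bar J}})\uparrow^{\mathfrak{S}_n}$; (2) the multiset $\mathcal{B} D_{n,J}^{-1}$ is a fine multiset of $\mathfrak{S}_n$ for the representation $\rho\otimes S^{Z_{n,J}}$.
   Context: For $\pi\in\mathfrak{S}_n$, $\mathrm{Des}(\pi)=\{i\in[n-1]:\pi(i)>\pi(i+1)\}$. For $D\subseteq[n-1]$, Gessel's fundamental quasisymmetric function is $F_{n,D}=\sum x_{i_1}\cdots x_{i_n}$, summed over $i_1\le\dots\le i_n$ with $i_j<i_{j+1}$ whenever $j\in D$. For a multiset $\mathcal{B}$ of permutations in $\mathfrak{S}_n$, $\mathcal{Q}(\mathcal{B})=\sum_{b\in\mathcal{B}} m(b,\mathcal{B})F_{n,\mathrm{Des}(b)}$, where $m(b,\mathcal{B})$ is the multiplicity. $\mathcal{B}$ is called fine if $\mathcal{Q}(\mathcal{B})$ is symmetric and Schur-positive, and fine for a complex $\mathfrak{S}_n$-representation $\rho$ if $\mathrm{ch}(\chi^\rho)=\mathcal{Q}(\mathcal{B})$, where $\mathrm{ch}$ is the Frobenius characteristic map ($\chi^\lambda\mapsto s_\lambda$). Permutations are multiplied as functions: $(\pi\sigma)(i)=\pi(\sigma(i))$;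 for $A,B\subseteq\mathfrak{S}_n$, $AB$ denotes the multiset $\{\{\pi\sigma:\pi\in A,\sigma\in B\}\}$. $D_{n,J}=\{\pi\in\mathfrak{S}_n:\mathrm{Des}(\pi)=J\}$, $R_{n,J}=\{\pi\in\mathfrak{S}_n:\mathrm{Des}(\pi)\subseteq J\}$, and $X^{-1}=\{\pi^{-1}:\pi\in X\}$. $\mathfrak{S}_{\bar J}$ is the Young subgroup $\mathfrak{S}_{j_1}\times\mathfrak{S}_{j_2-j_1}\times\cdots\times\mathfrak{S}_{n-j_t}$ of $\mathfrak{S}_n$ (the first factor permuting $1,\dots,j_1$, the next permuting $j_1+1,\dots,j_2$, etc.). $Z_{n,J}$ is the ribbon (connected skew shape with no $2\times2$ square) with $n$ cells labeled $1,\dots,n$ increasing in the northeast direction (English notation), where cell $i+1$ is immediately above cell $i$ if $i\in J$ and immediately to the right of cell $i$ otherwise. For a skew shape $\lambda/\mu$ of size $n$, $S^{\lambda/\mu}$ denotes the skew Specht module, the $\mathfrak{S}_n$-representation whose Frobenius image is the skew Schur function $s_{\lambda/\mu}$. *)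

theory Defs
  imports
    "HOL-Algebra.Sym_Groups"
    "HOL-Combinatorics.Orbits"
    "HOL-Library.Multiset"
    "HOL-Library.Poly_Mapping"
    "Jordan_Normal_Form.Matrix"
begin

section \<open>Formal power series in countably many variables\<close>

text \<open>
  A monomial in the variables \<open>x 0, x 1, \<dots>\<close> is its finitely supported exponent vector of type
  \<^typ>\<open>nat \<Rightarrow>\<^sub>0 nat\<close>, and a series is an arbitrary assignment of coefficients to monomials.
  Quasisymmetric and symmetric functions live in this ring.
\<close>

typedef 'a mps = "UNIV :: ((nat \<Rightarrow>\<^sub>0 nat) \<Rightarrow> 'a) set"
  morphisms mps_coeff Abs_mps ..

lemma mps_coeff_Abs [simp]: "mps_coeff (Abs_mps f) = f"
  by (simp add: Abs_mps_inverse)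

lemma mps_eqI: "(\<And>m. mps_coeff f m = mps_coeff g m) \<Longrightarrow> f = g"
  by (metis ext mps_coeff_inject)

definition splits :: "(nat \<Rightarrow>\<^sub>0 nat) \<Rightarrow> ((nat \<Rightarrow>\<^sub>0 nat) \<times> (nat \<Rightarrow>\<^sub>0 nat)) set" where
  "splits m = {(a, b). a + b = m}"

lemma finite_splits [simp]: "finite (splits m)"
proof -
  let ?F = "{f. \<forall>x. (x \<in> Poly_Mapping.keys m \<longrightarrow> f x \<in> {..Max (insert 0 (Poly_Mapping.lookup m ` Poly_Mapping.keys m))}) \<and>
      (x \<notin> Poly_Mapping.keys m \<longrightarrow> f x = (0::nat))}"
  have fin: "finite ?F"
    by (rule finite_set_of_finite_funs) auto
  have le: "Poly_Mapping.lookup a \<in> ?F" if "\<exists>b. a + b = m" for a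
  proof -
    from that have *: "Poly_Mapping.lookup a x \<le> Poly_Mapping.lookup m x" for x
      by (auto simp: lookup_add)
    have "Poly_Mapping.lookup m x \<le> Max (insert 0 (Poly_Mapping.lookup m ` Poly_Mapping.keys m))"
      if "x \<in> Poly_Mapping.keys m" for x
      using that by (intro Max_ge) auto
    then have "Poly_Mapping.lookup a x \<le> Max (insert 0 (Poly_Mapping.lookup m ` Poly_Mapping.keys m))"
      if "x \<in> Poly_Mapping.keys m" for x
      using that * order_trans by blast
    moreover have "Poly_Mapping.lookup a x = 0" if "x \<notin> Poly_Mapping.keys m" for x
      using that *[of x] by (simp add: in_keys_iff)
    ultimately show ?thesis
      by blast
  qed
  have "finite (Poly_Mapping.lookup ` {a. \<exists>b. a + b = m})"
    by (rule finite_subset[OF image_subsetI fin]) (rule le, simp)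
  then have fa: "finite {a. \<exists>b. a + b = m}"
    by (rule finite_imageD) (simp add: inj_on_def poly_mapping_eqI)
  have "splits m \<subseteq> {a. \<exists>b. a + b = m} \<times> {a. \<exists>b. a + b = m}"
    by (auto simp: splits_def) (metis add.commute)
  then show ?thesis
    using fa by (meson finite_SigmaI finite_subset)
qed

instantiation mps :: (comm_ring_1) comm_ring_1
begin

definition zero_mps :: "'a mps" where "0 = Abs_mps (\<lambda>_. 0)"
definition one_mps :: "'a mps" where "1 = Abs_mps (\<lambda>m. if m = 0 then 1 else 0)"
definition plus_mps :: "'a mps \<Rightarrow> 'a mps \<Rightarrow> 'a mps"
  where "f + g = Abs_mps (\<lambda>m. mps_coeff f m + mps_coeff g m)"
definition uminus_mps :: "'a mps \<Rightarrow> 'a mps"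
  where "- f = Abs_mps (\<lambda>m. - mps_coeff f m)"
definition minus_mps :: "'a mps \<Rightarrow> 'a mps \<Rightarrow> 'a mps"
  where "f - g = Abs_mps (\<lambda>m. mps_coeff f m - mps_coeff g m)"
definition times_mps :: "'a mps \<Rightarrow> 'a mps \<Rightarrow> 'a mps"
  where "f * g = Abs_mps (\<lambda>m. \<Sum>(a, b)\<in>splits m. mps_coeff f a * mps_coeff g b)"

instance
proof
  fix f g h :: "'a mps"
  show "f * g * h = f * (g * h)"
  proof (rule mps_eqI)
    fix m
    have "mps_coeff (f * g * h) m =
        (\<Sum>(p, c)\<in>splits m. \<Sum>(a, b)\<in>splits p. mps_coeff f a * mps_coeff g b * mps_coeff h c)"
      by (simp add: times_mps_def sum_distrib_right case_prod_unfold)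
    also have "\<dots> = (\<Sum>((p, c), (a, b))\<in>(SIGMA x:splits m. splits (fst x)).
        mps_coeff f a * mps_coeff g b * mps_coeff h c)"
      by (simp add: sum.Sigma case_prod_unfold)
    also have "\<dots> = (\<Sum>((a, q), (b, c))\<in>(SIGMA x:splits m. splits (snd x)).
        mps_coeff f a * mps_coeff g b * mps_coeff h c)"
      by (rule sum.reindex_bij_witness
          [of _ "\<lambda>((a, q), (b, c)). ((a + b, c), (a, b))" "\<lambda>((p, c), (a, b)). ((a, b + c), (b, c))"])
        (auto simp: splits_def add.assoc)
    also have "\<dots> = (\<Sum>(a, q)\<in>splits m. \<Sum>(b, c)\<in>splits q.
        mps_coeff f a * mps_coeff g b * mps_coeff h c)"
      by (simp add: sum.Sigma case_prod_unfold)
    also have "\<dots> = mps_coeff (f * (g * h)) m"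
      by (simp add: times_mps_def sum_distrib_left case_prod_unfold mult.assoc)
    finally show "mps_coeff (f * g * h) m = mps_coeff (f * (g * h)) m" .
  qed
  show "f * g = g * f"
  proof (rule mps_eqI)
    fix m
    show "mps_coeff (f * g) m = mps_coeff (g * f) m"
      unfolding times_mps_def mps_coeff_Abs
      by (rule sum.reindex_bij_witness[of _ prod.swap prod.swap])
        (auto simp: splits_def add.commute mult.commute)
  qed
  show "1 * f = f"
  proof (rule mps_eqI)
    fix m
    have "mps_coeff (1 * f) m = (\<Sum>x\<in>splits m. if x = (0, m) then mps_coeff f m else 0)"
      unfolding times_mps_def one_mps_def mps_coeff_Abs
      by (rule sum.cong) (auto simp: splits_def split: if_splits)
    also have "\<dots> = mps_coeff f m"
      by (simp add: sum.delta) (simp add: splits_def)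
    finally show "mps_coeff (1 * f) m = mps_coeff f m" .
  qed
  show "(f + g) * h = f * h + g * h"
    by (rule mps_eqI)
      (simp add: times_mps_def plus_mps_def distrib_right sum.distrib case_prod_unfold)
  show "(0 :: 'a mps) \<noteq> 1"
  proof
    assume "(0 :: 'a mps) = 1"
    then have "mps_coeff (0 :: 'a mps) 0 = mps_coeff 1 0"
      by simp
    then show False
      by (simp add: zero_mps_def one_mps_def)
  qed
qed (auto intro!: mps_eqI simp: plus_mps_def zero_mps_def uminus_mps_def minus_mps_def algebra_simps)

end

definition mps_const :: "'a::comm_ring_1 \<Rightarrow> 'a mps" where
  "mps_const c = Abs_mps (\<lambda>m. if m = 0 then c else 0)"

text \<open>The product of the variables \<open>x (T c)\<close> over \<open>c \<in> A\<close>.\<close>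

definition monomial_of :: "'c set \<Rightarrow> ('c \<Rightarrow> nat) \<Rightarrow> (nat \<Rightarrow>\<^sub>0 nat)" where
  "monomial_of A T = (\<Sum>c\<in>A. Poly_Mapping.single (T c) 1)"

text \<open>
  The sum of \<open>monomial_of A T\<close> over all fillings \<open>T\<close> of the finite set \<open>A\<close> satisfying \<open>P\<close>.
  The set counted is always finite, because all values of \<open>T\<close> are variables occurring in \<open>m\<close>.
\<close>

definition generating_series :: "'c set \<Rightarrow> (('c \<Rightarrow> nat) \<Rightarrow> bool) \<Rightarrow> complex mps" where
  "generating_series A P =
     Abs_mps (\<lambda>m. of_nat (card {T \<in> A \<rightarrow>\<^sub>E UNIV. P T \<and> monomial_of A T = m}))"


section \<open>Quasisymmetric functions of multisets of permutations\<close>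

definition Des :: "nat \<Rightarrow> (nat \<Rightarrow> nat) \<Rightarrow> nat set" where
  "Des n \<pi> = {i \<in> {1..n - 1}. \<pi> i > \<pi> (i + 1)}"

definition fundamental :: "nat \<Rightarrow> nat set \<Rightarrow> complex mps" where
  "fundamental n D = generating_series {1..n}
     (\<lambda>i. \<forall>j\<in>{1..n - 1}. i j \<le> i (j + 1) \<and> (j \<in> D \<longrightarrow> i j < i (j + 1)))"

definition quasi :: "nat \<Rightarrow> (nat \<Rightarrow> nat) multiset \<Rightarrow> complex mps" where
  "quasi n B = (\<Sum>b\<in>set_mset B. of_nat (count B b) * fundamental n (Des n b))"

definition D_class :: "nat \<Rightarrow> nat set \<Rightarrow> (nat \<Rightarrow> nat) set" where
  "D_class n J = {\<pi> \<in> carrier (sym_group n). Des n \<pi> = J}"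

definition R_class :: "nat \<Rightarrow> nat set \<Rightarrow> (nat \<Rightarrow> nat) set" where
  "R_class n J = {\<pi> \<in> carrier (sym_group n). Des n \<pi> \<subseteq> J}"

definition inverses :: "nat \<Rightarrow> (nat \<Rightarrow> nat) set \<Rightarrow> (nat \<Rightarrow> nat) set" where
  "inverses n X = (\<lambda>\<pi>. inv\<^bsub>sym_group n\<^esub> \<pi>) ` X"

definition product_mset ::
    "(nat \<Rightarrow> nat) set \<Rightarrow> (nat \<Rightarrow> nat) set \<Rightarrow> (nat \<Rightarrow> nat) multiset" where
  "product_mset A B = image_mset (\<lambda>(\<pi>, \<sigma>). \<pi> \<circ> \<sigma>) (mset_set (A \<times> B))"


section \<open>Complex representations\<close>

text \<open>
  A finite-dimensional complex representation is given, after choosing a basis, by matrices.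
  Only the values on the carrier of the group matter; degree 0 is allowed.
\<close>

definition representation :: "('g, 'm) monoid_scheme \<Rightarrow> ('g \<Rightarrow> complex mat) \<Rightarrow> bool" where
  "representation G \<rho> \<longleftrightarrow>
     (\<exists>d. (\<forall>g\<in>carrier G. \<rho> g \<in> carrier_mat d d) \<and>
          \<rho> \<one>\<^bsub>G\<^esub> = 1\<^sub>m d \<and>
          (\<forall>g\<in>carrier G. \<forall>h\<in>carrier G. \<rho> (g \<otimes>\<^bsub>G\<^esub> h) = \<rho> g * \<rho> h))"

definition character :: "('g \<Rightarrow> complex mat) \<Rightarrow> 'g \<Rightarrow> complex" where
  "character \<rho> g = (\<Sum>i<dim_row (\<rho> g). \<rho> g $$ (i, i))"

definition tensor_rep ::
    "('g \<Rightarrow> complex mat) \<Rightarrow> ('g \<Rightarrow> complex mat) \<Rightarrow> 'g \<Rightarrow> complex mat" where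
  "tensor_rep \<rho> \<sigma> g =
     (let e = dim_row (\<sigma> g); e' = dim_col (\<sigma> g) in
      mat (dim_row (\<rho> g) * e) (dim_col (\<rho> g) * e')
        (\<lambda>(i, j). \<rho> g $$ (i div e, j div e') * \<sigma> g $$ (i mod e, j mod e')))"

definition restrict_rep :: "'g set \<Rightarrow> ('g \<Rightarrow> complex mat) \<Rightarrow> 'g \<Rightarrow> complex mat" where
  "restrict_rep H \<rho> = restrict \<rho> H"

text \<open>\<open>G\<close> is the disjoint union of the left cosets of \<open>H\<close> by the members of \<open>ts\<close>.\<close>

definition left_transversal :: "('g, 'm) monoid_scheme \<Rightarrow> 'g set \<Rightarrow> 'g list \<Rightarrow> bool" where
  "left_transversal G H ts \<longleftrightarrow>
     distinct ts \<and> set ts \<subseteq> carrier G \<and> (\<forall>g\<in>carrier G. \<exists>!t. t \<in> set ts \<and> g \<in> t <#\<^bsub>G\<^esub> H)"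

text \<open>
  The representation of \<open>G\<close> induced from the representation \<open>\<rho>\<close> of \<open>H\<close>, in block form: with
  \<open>ts = [t\<^sub>0, t\<^sub>1, \<dots>]\<close>, the block of \<open>g\<close> in position \<open>(k, l)\<close> is \<open>\<rho> (t\<^sub>k\<^sup>-\<^sup>1 g t\<^sub>l)\<close>, read as
  zero when the argument is outside \<open>H\<close>. This is the matrix of \<open>g\<close> on \<open>\<complex>[G] \<otimes> V\<close>, the tensor
  product taken over \<open>\<complex>[H]\<close>, in the basis of all \<open>t\<^sub>k \<otimes> e\<^sub>i\<close>; different transversals give
  isomorphic representations.
\<close>

definition induced_rep ::
    "('g, 'm) monoid_scheme \<Rightarrow> 'g set \<Rightarrow> 'g list \<Rightarrow> ('g \<Rightarrow> complex mat) \<Rightarrow> 'g \<Rightarrow> complex mat" where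
  "induced_rep G H ts \<rho> g =
     (let d = dim_row (\<rho> \<one>\<^bsub>G\<^esub>) in
      mat (length ts * d) (length ts * d)
        (\<lambda>(i, j). let h = inv\<^bsub>G\<^esub> (ts ! (i div d)) \<otimes>\<^bsub>G\<^esub> g \<otimes>\<^bsub>G\<^esub> ts ! (j div d)
           in if h \<in> H then \<rho> h $$ (i mod d, j mod d) else 0))"

text \<open>
  The factors of the Young subgroup act on the intervals \<open>{a<..b}\<close> between consecutive elements
  \<open>a < b\<close> of \<open>{0} \<union> J \<union> {n}\<close>.
\<close>

definition young_blocks :: "nat \<Rightarrow> nat set \<Rightarrow> nat set set" where
  "young_blocks n J = {{a<..b} | a b. a \<in> insert 0 (insert n J) \<and> b \<in> insert 0 (insert n J) \<and>
     a < b \<and> {a<..<b} \<inter> insert 0 (insert n J) = {}}"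

definition young_subgroup :: "nat \<Rightarrow> nat set \<Rightarrow> (nat \<Rightarrow> nat) set" where
  "young_subgroup n J =
     {\<pi> \<in> carrier (sym_group n). \<forall>X\<in>young_blocks n J. \<pi> ` X = X}"


section \<open>The Frobenius characteristic map and skew Schur functions\<close>

definition power_sum :: "nat \<Rightarrow> complex mps" where
  "power_sum k = Abs_mps (\<lambda>m. if \<exists>i. m = Poly_Mapping.single i k then 1 else 0)"

text \<open>
  The standard definition \<open>ch f = 1/n! \<Sum>\<^sub>\<pi> f(\<pi>) p\<^bsub>cyc(\<pi>)\<^esub>\<close>, where \<open>cyc(\<pi>)\<close> is the cycle type of
  \<open>\<pi>\<close>, fixed points included. This is the normalization sending the irreducible character
  \<open>\<chi>\<^sup>\<lambda>\<close> to the Schur function \<open>s\<^sub>\<lambda>\<close>.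
\<close>

definition frobenius_ch :: "nat \<Rightarrow> ((nat \<Rightarrow> nat) \<Rightarrow> complex) \<Rightarrow> complex mps" where
  "frobenius_ch n f = mps_const (1 / fact n) *
     (\<Sum>\<pi>\<in>carrier (sym_group n).
        mps_const (f \<pi>) * (\<Prod>C\<in>orbit \<pi> ` {1..n}. power_sum (card C)))"

text \<open>
  Cells of a diagram are pairs (row, column) of integers in English notation: rows are numbered
  downwards. Only the relative position of the cells matters.
\<close>

definition semistandard :: "(int \<times> int) set \<Rightarrow> (int \<times> int \<Rightarrow> nat) \<Rightarrow> bool" where
  "semistandard D T \<longleftrightarrow>
     (\<forall>r c c'. (r, c) \<in> D \<and> (r, c') \<in> D \<and> c < c' \<longrightarrow> T (r, c) \<le> T (r, c')) \<and>
     (\<forall>r r' c. (r, c) \<in> D \<and> (r', c) \<in> D \<and> r < r' \<longrightarrow> T (r, c) < T (r', c))"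

definition skew_schur :: "(int \<times> int) set \<Rightarrow> complex mps" where
  "skew_schur D = generating_series D (semistandard D)"

text \<open>\<open>ribbon_cell J i\<close> is the position of the cell labeled \<open>i + 1\<close>.\<close>

primrec ribbon_cell :: "nat set \<Rightarrow> nat \<Rightarrow> int \<times> int" where
  "ribbon_cell J 0 = (0, 0)"
| "ribbon_cell J (Suc i) =
     (let (r, c) = ribbon_cell J i in if Suc i \<in> J then (r - 1, c) else (r, c + 1))"

definition ribbon :: "nat \<Rightarrow> nat set \<Rightarrow> (int \<times> int) set" where
  "ribbon n J = ribbon_cell J ` {..<n}"

text \<open>
  The skew Specht module of a skew shape is determined up to isomorphism by its Frobenius image;
  the predicate describes its matrix realizations.
\<close>

definition skew_specht :: "nat \<Rightarrow> (int \<times> int) set \<Rightarrow> ((nat \<Rightarrow> nat) \<Rightarrow> complex mat) \<Rightarrow> bool" where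
  "skew_specht n D \<sigma> \<longleftrightarrow>
     representation (sym_group n) \<sigma> \<and> frobenius_ch n (character \<sigma>) = skew_schur D"


section \<open>Fine multisets\<close>

definition fine_for ::
    "nat \<Rightarrow> (nat \<Rightarrow> nat) multiset \<Rightarrow> ((nat \<Rightarrow> nat) \<Rightarrow> complex mat) \<Rightarrow> bool" where
  "fine_for n B \<rho> \<longleftrightarrow>
     set_mset B \<subseteq> carrier (sym_group n) \<and> representation (sym_group n) \<rho> \<and>
     frobenius_ch n (character \<rho>) = quasi n B"

end

theory Submission
  imports Defs
begin

text \<open>
  Everything is read off from coefficients. The coefficient of \<open>ch \<chi>\<close> at a monomial \<open>m\<close> is the
  average over \<open>\<pi>\<close> of \<open>\<chi> \<pi>\<close> times the number of words with content \<open>m\<close> fixed by \<open>\<pi>\<close>, and the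
  coefficient of \<open>\<Q>(B)\<close> counts the weakly increasing words with content \<open>m\<close> that increase strictly at
  the descents of some \<open>b \<in> B\<close>. The character induced from the Young subgroup of \<open>J\<close> by a restricted
  character \<open>\<chi>\<close> is \<open>\<chi>\<close> times a permutation character on words. Its product with the permutation
  character on the words \<open>x\<close> with content \<open>m\<close> is the permutation character on words whose letters are
  pairs, so fineness of \<open>B\<close> for the lexicographic order of pairs shows that the coefficient counts the
  pairs \<open>(b, x)\<close> for which the descents of the word of the \<open>(x p, b p)\<close> lie in \<open>J\<close>. Standardizing that word
  gives the permutations \<open>\<sigma>\<close> with \<open>Des \<sigma> \<subseteq> J\<close> that occur in \<open>B R\<^sup>-\<^sup>1\<close>. Inclusion and exclusion over
  \<open>J\<close> yields a class function that does the same for \<open>Des \<sigma> = J\<close>. For the trivial character and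
  \<open>B = {id}\<close> it has the Frobenius image of the ribbon, so it is the ribbon character.
\<close>

section \<open>Coefficients of power series\<close>

text \<open>Fineness speaks only of words in natural numbers with one prescribed content, whereas
  the induced character calls for words of pairs. Two remarks bridge the gap: the equation is
  additive, so it holds on every finite set of words closed under rearrangement, and pairs can be
  written as numbers \<open>y * c + x\<close> in a large base. The auxiliary letter \<open>y\<close>
  must lead: compatible words are sorted, so the content of \<open>y\<close> leaves a single choice,
  and this choice frees \<open>x\<close> exactly at its jumps, the positions in \<open>J\<close>.
  For the second claim coefficients alone are not enough. The hypothesis \<open>skew_specht\<close>
  fixes \<sigma> only through its Frobenius image, while the character of the tensor product needs
  the values of the character of \<sigma>. They are recovered because means against numbers of fixed
  words separate class functions. The class function \<psi>, built from such numbers, can then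
  replace the character of \<sigma> in products.\<close>

lemma mps_coeff_zero [simp]: "mps_coeff 0 m = 0"
  by (simp add: zero_mps_def)

lemma mps_coeff_add [simp]: "mps_coeff (f + g) m = mps_coeff f m + mps_coeff g m"
  by (simp add: plus_mps_def)

lemma mps_coeff_sum: "mps_coeff (sum f A) m = (\<Sum>a\<in>A. mps_coeff (f a) m)"
  by (induction A rule: infinite_finite_induct) auto

lemma mps_coeff_of_nat_mult: "mps_coeff (of_nat k * f) m = of_nat k * mps_coeff f m"
  by (induction k) (auto simp: algebra_simps)

lemma mps_coeff_const_mult: "mps_coeff (mps_const c * f) m = c * mps_coeff f m"
proof -
  have "mps_coeff (mps_const c * f) m = (\<Sum>x\<in>splits m. if x = (0, m) then c * mps_coeff f m else 0)"
    unfolding times_mps_def mps_const_def mps_coeff_Abs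
    by (rule sum.cong) (auto simp: splits_def split: if_splits)
  also have "\<dots> = c * mps_coeff f m"
    by (simp add: sum.delta) (simp add: splits_def)
  finally show ?thesis .
qed

section \<open>Contents of words\<close>

lemma lookup_sum: "Poly_Mapping.lookup (sum f A) k = (\<Sum>a\<in>A. Poly_Mapping.lookup (f a) k)"
  by (induction A rule: infinite_finite_induct) (auto simp: lookup_add)

lemma lookup_monomial_of:
  "finite A \<Longrightarrow> Poly_Mapping.lookup (monomial_of A T) k = card {c \<in> A. T c = k}"
  by (simp add: monomial_of_def lookup_sum lookup_single when_def sum.If_cases Int_def)

lemma monomial_of_cong: "(\<And>c. c \<in> A \<Longrightarrow> T c = T' c) \<Longrightarrow> monomial_of A T = monomial_of A T'"
  by (simp add: monomial_of_def)

lemma monomial_of_restrict [simp]: "monomial_of A (restrict T A) = monomial_of A T"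
  by (rule monomial_of_cong) simp

lemma monomial_of_Un:
  "finite A \<Longrightarrow> finite B \<Longrightarrow> A \<inter> B = {} \<Longrightarrow>
    monomial_of (A \<union> B) T = monomial_of A T + monomial_of B T"
  by (simp add: monomial_of_def sum.union_disjoint)

text \<open>Multisets of letters give access to library facts on rearrangement and sorting: equal
  multisets yield a permutation in \<open>words_transitive\<close> and equal sorted lists in
  \<open>sorted_words_unique\<close>.\<close>

lemma monomial_of_eq_iff:
  assumes "finite A"
  shows "monomial_of A T = monomial_of A T' \<longleftrightarrow>
    image_mset T (mset_set A) = image_mset T' (mset_set A)"
proof -
  have "count (image_mset T (mset_set A)) k = card {c \<in> A. T c = k}" for T :: "'a \<Rightarrow> nat" and k
    using assms by (simp add: count_image_mset Int_def conj_commute sum.If_cases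
        count_mset_set' vimage_def cong: conj_cong)
  moreover have "monomial_of A T = monomial_of A T' \<longleftrightarrow>
      (\<forall>k. card {c \<in> A. T c = k} = card {c \<in> A. T' c = k})"
    by (simp add: poly_mapping_eq_iff fun_eq_iff lookup_monomial_of[OF assms])
  ultimately show ?thesis
    by (simp add: multiset_eq_iff)
qed

lemma values_subset_keys:
  assumes "finite A" "monomial_of A T = m"
  shows "T ` A \<subseteq> Poly_Mapping.keys m"
proof
  fix k assume "k \<in> T ` A"
  then have "{c \<in> A. T c = k} \<noteq> {}"
    by auto
  then have "card {c \<in> A. T c = k} \<noteq> 0"
    using assms(1) by simp
  then show "k \<in> Poly_Mapping.keys m"
    using lookup_monomial_of[OF assms(1), of T k] assms(2) by (simp add: in_keys_iff)
qed

lemma finite_fillings: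
  assumes "finite A"
  shows "finite {T \<in> A \<rightarrow>\<^sub>E UNIV. P T \<and> monomial_of A T = m}"
proof (rule finite_subset)
  show "{T \<in> A \<rightarrow>\<^sub>E UNIV. P T \<and> monomial_of A T = m} \<subseteq> A \<rightarrow>\<^sub>E Poly_Mapping.keys m"
  proof
    fix T assume T: "T \<in> {T \<in> A \<rightarrow>\<^sub>E UNIV. P T \<and> monomial_of A T = m}"
    then have "T ` A \<subseteq> Poly_Mapping.keys m"
      by (intro values_subset_keys[OF assms]) simp
    then show "T \<in> A \<rightarrow>\<^sub>E Poly_Mapping.keys m"
      using T by (auto simp: PiE_def)
  qed
  show "finite (A \<rightarrow>\<^sub>E Poly_Mapping.keys m)"
    using assms by (intro finite_PiE) auto
qed

section \<open>Products of power sums as series of fillings constant on blocks\<close>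

text \<open>A filling of the union is a pair of fillings, and the contents of its two restrictions
  tell to which splitting of \<open>m\<close> in the product of series it belongs.\<close>

lemma generating_series_mult:
  assumes "finite A" "finite B" "A \<inter> B = {}"
  shows "generating_series A P * generating_series B Q =
    generating_series (A \<union> B) (\<lambda>T. P (restrict T A) \<and> Q (restrict T B))"
proof (rule mps_eqI)
  fix m
  let ?F = "\<lambda>A P m. {T \<in> A \<rightarrow>\<^sub>E UNIV. P T \<and> monomial_of A T = (m :: nat \<Rightarrow>\<^sub>0 nat)}"
  have "mps_coeff (generating_series A P * generating_series B Q) m =
      (\<Sum>x\<in>splits m. of_nat (card (?F A P (fst x) \<times> ?F B Q (snd x))))"
    by (simp add: times_mps_def generating_series_def case_prod_unfold card_cartesian_product)
  also have "\<dots> = of_nat (card (SIGMA x:splits m. ?F A P (fst x) \<times> ?F B Q (snd x)))"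
    using assms by (subst card_SigmaI) (auto simp: finite_fillings)
  also have "card (SIGMA x:splits m. ?F A P (fst x) \<times> ?F B Q (snd x)) =
      card (?F (A \<union> B) (\<lambda>T. P (restrict T A) \<and> Q (restrict T B)) m)"
  proof (rule bij_betw_same_card, rule bij_betw_byWitness)
    let ?f = "\<lambda>(x :: (nat \<Rightarrow>\<^sub>0 nat) \<times> (nat \<Rightarrow>\<^sub>0 nat), T :: 'a \<Rightarrow> nat, U :: 'a \<Rightarrow> nat). \<lambda>c. if c \<in> A then T c else U c"
    let ?g = "\<lambda>T. ((monomial_of A T, monomial_of B T), restrict T A, restrict T B)"
    have mA: "monomial_of A (\<lambda>c. if c \<in> A then T c else U c) = monomial_of A T" for T U
      by (rule monomial_of_cong) simp
    have mB: "monomial_of B (\<lambda>c. if c \<in> A then T c else U c) = monomial_of B U" for T U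
      by (rule monomial_of_cong) (use assms(3) in auto)
    have rA: "restrict (\<lambda>c. if c \<in> A then T c else U c) A = T" if "T \<in> A \<rightarrow>\<^sub>E UNIV" for T U :: "'a \<Rightarrow> nat"
      using that by (auto simp: fun_eq_iff restrict_def PiE_def extensional_def)
    have rB: "restrict (\<lambda>c. if c \<in> A then T c else U c) B = U" if "U \<in> B \<rightarrow>\<^sub>E UNIV" for T U :: "'a \<Rightarrow> nat"
      using that assms(3) by (auto simp: fun_eq_iff restrict_def PiE_def extensional_def)
    show "\<forall>a\<in>SIGMA x:splits m. ?F A P (fst x) \<times> ?F B Q (snd x). ?g (?f a) = a"
      by (auto simp: mA mB rA rB simp del: PiE_UNIV_domain)
    show "\<forall>T\<in>?F (A \<union> B) (\<lambda>T. P (restrict T A) \<and> Q (restrict T B)) m. ?f (?g T) = T"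
      by (auto simp: fun_eq_iff PiE_def extensional_def)
    show "?f ` (SIGMA x:splits m. ?F A P (fst x) \<times> ?F B Q (snd x)) \<subseteq>
        ?F (A \<union> B) (\<lambda>T. P (restrict T A) \<and> Q (restrict T B)) m"
      by (auto simp: monomial_of_Un[OF assms] mA mB rA rB splits_def)
        (auto simp: PiE_def extensional_def split: if_splits)
    show "?g ` ?F (A \<union> B) (\<lambda>T. P (restrict T A) \<and> Q (restrict T B)) m \<subseteq>
        (SIGMA x:splits m. ?F A P (fst x) \<times> ?F B Q (snd x))"
      by (auto simp: monomial_of_Un[OF assms] splits_def)
  qed
  finally show "mps_coeff (generating_series A P * generating_series B Q) m =
    mps_coeff (generating_series (A \<union> B) (\<lambda>T. P (restrict T A) \<and> Q (restrict T B))) m"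
    by (simp add: generating_series_def)
qed

lemma power_sum_conv_generating_series:
  assumes "finite C" "C \<noteq> {}"
  shows "power_sum (card C) = generating_series C (\<lambda>T. \<forall>c\<in>C. \<forall>d\<in>C. T c = T d)"
proof (rule mps_eqI)
  fix m
  obtain c0 where c0: "c0 \<in> C"
    using assms by auto
  let ?F = "{T \<in> C \<rightarrow>\<^sub>E UNIV. (\<forall>c\<in>C. \<forall>d\<in>C. T c = T d) \<and> monomial_of C T = m}"
  have const: "monomial_of C (\<lambda>_. i) = Poly_Mapping.single i (card C)" for i
    using assms by (intro poly_mapping_eqI) (auto simp: lookup_monomial_of lookup_single when_def)
  have sub: "T = (\<lambda>c\<in>C. T c0)" if "T \<in> ?F" for T
  proof
    fix c
    have "T c = T c0" if "c \<in> C"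
      using \<open>T \<in> ?F\<close> c0 that by blast
    moreover have "T c = undefined" if "c \<notin> C"
      using \<open>T \<in> ?F\<close> that by (auto simp only: mem_Collect_eq PiE_def extensional_def Int_iff)
    ultimately show "T c = (\<lambda>c\<in>C. T c0) c"
      by simp
  qed
  show "mps_coeff (power_sum (card C)) m =
    mps_coeff (generating_series C (\<lambda>T. \<forall>c\<in>C. \<forall>d\<in>C. T c = T d)) m"
  proof (cases "\<exists>i. m = Poly_Mapping.single i (card C)")
    case True
    then obtain i where i: "m = Poly_Mapping.single i (card C)"
      by blast
    have "?F = {\<lambda>c\<in>C. i}"
    proof (intro subset_antisym subsetI)
      fix T assume T: "T \<in> ?F"
      have "monomial_of C (\<lambda>c\<in>C. T c0) = m"
        using T sub[OF T] by simp
      then have "Poly_Mapping.single (T c0) (card C) = Poly_Mapping.single i (card C)"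
        by (simp add: const i)
      \<comment> \<open>The letter can be read off from the monomial because its exponent
        \<open>card C\<close> is nonzero.\<close>
      then have "Poly_Mapping.lookup (Poly_Mapping.single (T c0) (card C)) i = card C"
        by simp
      then have "T c0 = i"
        using assms by (auto simp: lookup_single when_def split: if_splits)
      then show "T \<in> {\<lambda>c\<in>C. i}"
        using sub[OF T] by simp
    qed (auto simp: const i)
    then have "card ?F = 1"
      by simp
    then show ?thesis
      using True by (simp only: power_sum_def generating_series_def mps_coeff_Abs if_True of_nat_1)
  next
    case False
    have "?F = {}"
    proof (rule ccontr)
      assume "?F \<noteq> {}"
      then obtain T where T: "T \<in> ?F"
        by blast
      have "monomial_of C (\<lambda>c\<in>C. T c0) = m"
        using T sub[OF T] by simp
      then show False
        using False by (auto simp: const)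
    qed
    then have "card ?F = 0"
      by (simp only: card.empty)
    then show ?thesis
      using False by (simp only: power_sum_def generating_series_def mps_coeff_Abs if_False of_nat_0)
  qed
qed

text \<open>Each block contributes one free letter, repeated over the whole block; disjointness lets
  these choices multiply.\<close>

lemma prod_power_sum:
  assumes "finite \<C>" "\<And>C. C \<in> \<C> \<Longrightarrow> finite C \<and> C \<noteq> {}" "disjoint \<C>"
  shows "(\<Prod>C\<in>\<C>. power_sum (card C)) =
    generating_series (\<Union>\<C>) (\<lambda>T. \<forall>C\<in>\<C>. \<forall>c\<in>C. \<forall>d\<in>C. T c = T d)"
  using assms
proof (induction \<C> rule: finite_induct)
  case empty
  have "generating_series {} (\<lambda>T :: 'a \<Rightarrow> nat. True) = 1"
  proof (rule mps_eqI)
    fix m :: "nat \<Rightarrow>\<^sub>0 nat"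
    have "{T. T = (\<lambda>x :: 'a. undefined :: nat) \<and> 0 = m} = (if m = 0 then {\<lambda>x. undefined} else {})"
      by auto
    then show "mps_coeff (generating_series {} (\<lambda>T :: 'a \<Rightarrow> nat. True)) m = mps_coeff 1 m"
      by (simp add: generating_series_def one_mps_def monomial_of_def)
  qed
  then show ?case
    by simp
next
  case (insert C \<C>)
  have disj: "C \<inter> \<Union>\<C> = {}"
    using insert.prems(2) insert.hyps(2) disjointD[of "insert C \<C>" C] by blast
  have "(\<Prod>C\<in>insert C \<C>. power_sum (card C)) =
      generating_series C (\<lambda>T. \<forall>c\<in>C. \<forall>d\<in>C. T c = T d) *
      generating_series (\<Union>\<C>) (\<lambda>T. \<forall>C\<in>\<C>. \<forall>c\<in>C. \<forall>d\<in>C. T c = T d)"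
    using insert by (simp add: power_sum_conv_generating_series disjoint_def)
  also have "\<dots> = generating_series (C \<union> \<Union>\<C>) (\<lambda>T. (\<forall>c\<in>C. \<forall>d\<in>C. restrict T C c = restrict T C d) \<and>
      (\<forall>C\<in>\<C>. \<forall>c\<in>C. \<forall>d\<in>C. restrict T (\<Union>\<C>) c = restrict T (\<Union>\<C>) d))"
    by (rule generating_series_mult) (use insert disj in auto)
  also have "(\<lambda>T. (\<forall>c\<in>C. \<forall>d\<in>C. restrict T C c = restrict T C d) \<and>
      (\<forall>C\<in>\<C>. \<forall>c\<in>C. \<forall>d\<in>C. restrict T (\<Union>\<C>) c = restrict T (\<Union>\<C>) d)) =
      (\<lambda>T :: 'a \<Rightarrow> nat. \<forall>C\<in>insert C \<C>. \<forall>c\<in>C. \<forall>d\<in>C. T c = T d)"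
  proof -
    have "restrict T (\<Union>\<C>) c = T c" if "D \<in> \<C>" "c \<in> D" for T :: "'a \<Rightarrow> nat" and c D
      using that by auto
    then show ?thesis
      by (intro ext) auto
  qed
  finally show ?case
    by simp
qed

section \<open>Words\<close>

text \<open>Words are extensional, so that they coincide with the fillings counted by
  \<open>generating_series\<close> and invariance under \<pi> is an equation of functions.\<close>

definition words :: "nat \<Rightarrow> (nat \<Rightarrow>\<^sub>0 nat) \<Rightarrow> (nat \<Rightarrow> nat) set" where
  "words n m = {x \<in> {1..n} \<rightarrow>\<^sub>E UNIV. monomial_of {1..n} x = m}"

definition fixed_words :: "nat \<Rightarrow> (nat \<Rightarrow>\<^sub>0 nat) \<Rightarrow> (nat \<Rightarrow> nat) \<Rightarrow> (nat \<Rightarrow> nat) set" where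
  "fixed_words n m \<pi> = {x \<in> words n m. x \<circ> \<pi> = x}"

lemma finite_words [simp]: "finite (words n m)"
  using finite_fillings[of "{1..n}" "\<lambda>_. True" m] by (simp add: words_def)

lemma comp_permutes_extensional:
  assumes "x \<in> A \<rightarrow>\<^sub>E UNIV" "g permutes A"
  shows "x \<circ> g \<in> A \<rightarrow>\<^sub>E UNIV"
  using assms by (auto simp: PiE_def extensional_def permutes_def)

lemma monomial_of_comp_permutes:
  assumes "g permutes A"
  shows "monomial_of A (x \<circ> g) = monomial_of A x"
  unfolding monomial_of_def
  using sum.permute[OF assms, of "\<lambda>c. Poly_Mapping.single (x c) (1 :: nat)"]
  by (simp add: comp_def)

lemma words_comp_permutes:
  assumes "x \<in> words n m" "g permutes {1..n}"
  shows "x \<circ> g \<in> words n m"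
  using assms comp_permutes_extensional[of x "{1..n}" g] monomial_of_comp_permutes[of g "{1..n}" x]
  unfolding words_def by blast

text \<open>Equal contents mean equal multisets of letters, hence a rearrangement of positions.
  Outside \<open>{1..n}\<close> both words are \<open>undefined\<close> and \<open>g\<close> is the
  identity, which turns agreement on positions into an equation of functions.\<close>

lemma words_transitive:
  assumes "x \<in> words n m" "y \<in> words n m"
  obtains g where "g permutes {1..n}" "y = x \<circ> g"
proof -
  have "image_mset y (mset_set {1..n}) = image_mset x (mset_set {1..n})"
    using assms monomial_of_eq_iff[of "{1..n}" y x] by (simp add: words_def)
  then obtain g where g: "g permutes {1..n}" "\<forall>p\<in>{1..n}. y p = x (g p)"
    by (rule image_mset_eq_implies_permutes[OF finite_atLeastAtMost])
  have "y p = x (g p)" for p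
  proof (cases "p \<in> {1..n}")
    case False
    then have "g p \<notin> {1..n}"
      using g(1) by (metis permutes_not_in)
    then show ?thesis
      using False assms by (auto simp: words_def PiE_def extensional_def)
  qed (use g in auto)
  then have "y = x \<circ> g"
    by (simp add: fun_eq_iff)
  then show thesis
    using that g(1) by simp
qed

lemma fixed_iff_constant_on_orbits:
  fixes n :: nat
  assumes "\<pi> permutes {1..n}" "x \<in> {1..n} \<rightarrow>\<^sub>E UNIV"
  shows "x \<circ> \<pi> = x \<longleftrightarrow> (\<forall>C\<in>orbit \<pi> ` {1..n}. \<forall>c\<in>C. \<forall>d\<in>C. x c = x d)"
proof
  assume *: "x \<circ> \<pi> = x"
  have step: "x (\<pi> c) = x c" for c
    using fun_cong[OF *, of c] by simp
  have const: "x c = x p" if "c \<in> orbit \<pi> p" for c p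
    using that by induction (simp_all add: step)
  show "\<forall>C\<in>orbit \<pi> ` {1..n}. \<forall>c\<in>C. \<forall>d\<in>C. x c = x d"
  proof (intro ballI)
    fix C c d assume "C \<in> orbit \<pi> ` {1..n}" and cd: "c \<in> C" "d \<in> C"
    then obtain p where "C = orbit \<pi> p"
      by blast
    then show "x c = x d"
      using cd const[of c p] const[of d p] by simp
  qed
next
  assume *: "\<forall>C\<in>orbit \<pi> ` {1..n}. \<forall>c\<in>C. \<forall>d\<in>C. x c = x d"
  have "permutation \<pi>"
    using assms(1) by (intro sym_group_carrier'[of _ n]) (simp only: sym_group_carrier)
  have "x (\<pi> p) = x p" for p
  proof (cases "p \<in> {1..n}")
    case True
    \<comment> \<open>An orbit is generated from \<open>\<pi> p\<close>; that it contains
      \<open>p\<close> as well holds because \<pi> is a permutation of finite support.\<close>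
    then have "\<forall>c\<in>orbit \<pi> p. \<forall>d\<in>orbit \<pi> p. x c = x d"
      using * by blast
    then show ?thesis
      using orbit.base[of \<pi> p] permutation_self_in_orbit[OF \<open>permutation \<pi>\<close>, of p] by blast
  next
    case False
    then show ?thesis
      using permutes_not_in[OF assms(1)] by simp
  qed
  then show "x \<circ> \<pi> = x"
    by (simp add: fun_eq_iff)
qed

text \<open>The power sums of the cycles of \<pi> multiply to the series of all fillings constant on
  each cycle, and these fillings are the words fixed by \<pi>.\<close>

lemma coeff_frobenius_ch:
  "mps_coeff (frobenius_ch n f) m =
    (\<Sum>\<pi>\<in>carrier (sym_group n). f \<pi> * of_nat (card (fixed_words n m \<pi>))) / fact n"
proof -
  have "mps_coeff (\<Prod>C\<in>orbit \<pi> ` {1..n}. power_sum (card C)) m =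
      of_nat (card (fixed_words n m \<pi>))" if \<pi>: "\<pi> \<in> carrier (sym_group n)" for \<pi>
  proof -
    have perm: "\<pi> permutes {1..n}" "permutation \<pi>"
      using sym_group_carrier[of \<pi> n] sym_group_carrier'[OF \<pi>] \<pi> by simp_all
    have sub: "orbit \<pi> p \<subseteq> {1..n}" if "p \<in> {1..n}" for p
      using permutes_orbit_subset[OF perm(1) that] .
    have self: "p \<in> orbit \<pi> p" for p
      using perm(2) by (rule permutation_self_in_orbit)
    have Un: "\<Union>(orbit \<pi> ` {1..n}) = {1..n}"
      using sub self by (intro equalityI UN_least UN_I) auto
    have disj: "disjoint (orbit \<pi> ` {1..n})"
    proof (rule disjointI)
      fix C D assume CD: "C \<in> orbit \<pi> ` {1..n}" "D \<in> orbit \<pi> ` {1..n}" "C \<noteq> D"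
      have "orbit \<pi> y = E" if "y \<in> E" "E \<in> orbit \<pi> ` {1..n}" for y E
        using that orbit_cyclic_eq3[OF cyclic_on_orbit'[OF perm(2)]] by auto
      then show "C \<inter> D = {}"
        using CD by blast
    qed
    have fin: "finite C \<and> C \<noteq> {}" if "C \<in> orbit \<pi> ` {1..n}" for C
      using that sub self finite_subset[OF sub] by force
    define Q where "Q T \<longleftrightarrow> (\<forall>C\<in>orbit \<pi> ` {1..n}. \<forall>c\<in>C. \<forall>d\<in>C. T c = T d)" for T :: "nat \<Rightarrow> nat"
    have "(\<Prod>C\<in>orbit \<pi> ` {1..n}. power_sum (card C)) = generating_series {1..n} Q"
      using prod_power_sum[of "orbit \<pi> ` {1..n}", unfolded Un] fin disj
      by (simp add: Q_def[abs_def])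
    moreover have "Q T \<longleftrightarrow> T \<circ> \<pi> = T" if "T \<in> {1..n} \<rightarrow>\<^sub>E UNIV" for T
      using fixed_iff_constant_on_orbits[OF perm(1) that] by (simp only: Q_def)
    then have "{T \<in> {1..n} \<rightarrow>\<^sub>E UNIV. Q T \<and> monomial_of {1..n} T = m} = fixed_words n m \<pi>"
      unfolding fixed_words_def words_def by blast
    ultimately show ?thesis
      by (simp only: generating_series_def mps_coeff_Abs)
  qed
  then have "(\<Sum>\<pi>\<in>carrier (sym_group n).
      f \<pi> * mps_coeff (\<Prod>C\<in>orbit \<pi> ` {1..n}. power_sum (card C)) m) =
      (\<Sum>\<pi>\<in>carrier (sym_group n). f \<pi> * of_nat (card (fixed_words n m \<pi>)))"
    by (intro sum.cong refl arg_cong[where f = "\<lambda>c. _ * c"])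
  then show ?thesis
    by (simp only: frobenius_ch_def mps_coeff_const_mult mps_coeff_sum times_divide_eq_left mult_1_left)
qed

section \<open>Coefficients of quasisymmetric functions\<close>

definition compatible :: "nat \<Rightarrow> nat set \<Rightarrow> (nat \<Rightarrow> nat) \<Rightarrow> bool" where
  "compatible n D x \<longleftrightarrow> (\<forall>j\<in>{1..n - 1}. x j \<le> x (j + 1) \<and> (j \<in> D \<longrightarrow> x j < x (j + 1)))"

lemma coeff_fundamental:
  "mps_coeff (fundamental n D) m = of_nat (card {x \<in> words n m. compatible n D x})"
proof -
  have "{x \<in> {1..n} \<rightarrow>\<^sub>E UNIV. compatible n D x \<and> monomial_of {1..n} x = m} =
      {x \<in> words n m. compatible n D x}"
    by (auto simp: words_def)
  then show ?thesis
    by (simp add: fundamental_def generating_series_def compatible_def)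
qed

lemma sum_mset_conv_count:
  fixes f :: "'a \<Rightarrow> nat"
  assumes "finite S" "set_mset M \<subseteq> S"
  shows "(\<Sum>b\<in>#M. f b) = (\<Sum>b\<in>S. count M b * f b)"
  using assms(2)
proof (induction M)
  case (add x M)
  have "(\<Sum>b\<in>S. count (add_mset x M) b * f b) =
      (\<Sum>b\<in>S. count M b * f b + (if b = x then f b else 0))"
    by (rule sum.cong) auto
  also have "\<dots> = (\<Sum>b\<in>S. count M b * f b) + f x"
    using add.prems assms(1) by (simp add: sum.distrib)
  finally show ?case
    using add by simp
qed simp

lemma coeff_quasi:
  "mps_coeff (quasi n M) m =
    of_nat (\<Sum>b\<in>#M. card {x \<in> words n m. compatible n (Des n b) x})"
proof -
  have "(\<Sum>b\<in>#M. card {x \<in> words n m. compatible n (Des n b) x}) =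
      (\<Sum>b\<in>set_mset M. count M b * card {x \<in> words n m. compatible n (Des n b) x})"
    by (rule sum_mset_conv_count) auto
  then show ?thesis
    by (simp add: quasi_def mps_coeff_sum mps_coeff_of_nat_mult coeff_fundamental)
qed

section \<open>Averages over the symmetric group\<close>

definition mean :: "nat \<Rightarrow> ((nat \<Rightarrow> nat) \<Rightarrow> complex) \<Rightarrow> complex" where
  "mean n f = (\<Sum>\<pi>\<in>carrier (sym_group n). f \<pi>) / fact n"

text \<open>The coefficientwise form of the equation \<open>ch \<chi> = \<Q>(B)\<close>.\<close>

definition fine_char :: "nat \<Rightarrow> ((nat \<Rightarrow> nat) \<Rightarrow> complex) \<Rightarrow> (nat \<Rightarrow> nat) set \<Rightarrow> bool" where
  "fine_char n \<chi> B \<longleftrightarrow> (\<forall>m. mean n (\<lambda>\<pi>. \<chi> \<pi> * of_nat (card (fixed_words n m \<pi>))) =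
     of_nat (\<Sum>b\<in>B. card {x \<in> words n m. compatible n (Des n b) x}))"

lemma finite_carrier_sym_group: "finite (carrier (sym_group n))"
  by (simp add: sym_group_def finite_permutations)

lemma mean_sum: "mean n (\<lambda>\<pi>. \<Sum>i\<in>I. f i \<pi>) = (\<Sum>i\<in>I. mean n (f i))"
  by (simp add: mean_def sum_divide_distrib) (rule sum.swap)

lemma mean_diff: "mean n (\<lambda>\<pi>. f \<pi> - g \<pi>) = mean n f - mean n g"
  by (simp add: mean_def sum_subtractf diff_divide_distrib)

lemma mean_cong: "(\<And>\<pi>. \<pi> permutes {1..n} \<Longrightarrow> f \<pi> = g \<pi>) \<Longrightarrow> mean n f = mean n g"
  by (simp add: mean_def sym_group_def)

text \<open>By transitivity, a set closed under rearrangement contains all words of every content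
  that it meets, so it is a disjoint union of sets \<open>words n m\<close>.\<close>

lemma card_partition_by_content:
  assumes "finite S" "S \<subseteq> {1..n} \<rightarrow>\<^sub>E UNIV" "\<And>x g. x \<in> S \<Longrightarrow> g permutes {1..n} \<Longrightarrow> x \<circ> g \<in> S"
  shows "card {x \<in> S. P x} = (\<Sum>m\<in>monomial_of {1..n} ` S. card {x \<in> words n m. P x})"
proof -
  have eq: "{x \<in> {x \<in> S. P x}. monomial_of {1..n} x = m} = {x \<in> words n m. P x}"
    if "m \<in> monomial_of {1..n} ` S" for m
  proof -
    obtain y where y: "y \<in> S" "m = monomial_of {1..n} y"
      using \<open>m \<in> monomial_of {1..n} ` S\<close> by blast
    have "y \<in> words n m"
      using y assms(2) unfolding words_def by blast
    have "x \<in> S" if x: "x \<in> words n m" for x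
    proof -
      obtain g where "g permutes {1..n}" "x = y \<circ> g"
        by (rule words_transitive[OF \<open>y \<in> words n m\<close> x])
      then show ?thesis
        using assms(3) y(1) by simp
    qed
    then show ?thesis
      using assms(2) unfolding words_def by blast
  qed
  have "card {x \<in> S. P x} = (\<Sum>m\<in>monomial_of {1..n} ` S. card {x \<in> {x \<in> S. P x}. monomial_of {1..n} x = m})"
    unfolding card_eq_sum using assms(1) by (intro sum.group[symmetric]) auto
  also have "\<dots> = (\<Sum>m\<in>monomial_of {1..n} ` S. card {x \<in> words n m. P x})"
    by (rule sum.cong[OF refl]) (simp only: eq)
  finally show ?thesis .
qed

text \<open>Both sides of \<open>fine_char\<close> are additive over contents. In this form fineness
  can be applied to words that encode words over another alphabet.\<close>

lemma fine_char_closed_set: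
  assumes "fine_char n \<chi> B"
    and "finite S" "S \<subseteq> {1..n} \<rightarrow>\<^sub>E UNIV" "\<And>x g. x \<in> S \<Longrightarrow> g permutes {1..n} \<Longrightarrow> x \<circ> g \<in> S"
  shows "mean n (\<lambda>\<pi>. \<chi> \<pi> * of_nat (card {x \<in> S. x \<circ> \<pi> = x})) =
    of_nat (\<Sum>b\<in>B. card {x \<in> S. compatible n (Des n b) x})"
proof -
  let ?M = "monomial_of {1..n} ` S"
  have card: "card {x \<in> S. P x} = (\<Sum>m\<in>?M. card {x \<in> words n m. P x})" for P
    using assms(2-4) by (rule card_partition_by_content)
  have "mean n (\<lambda>\<pi>. \<chi> \<pi> * of_nat (card {x \<in> S. x \<circ> \<pi> = x})) =
      (\<Sum>m\<in>?M. mean n (\<lambda>\<pi>. \<chi> \<pi> * of_nat (card (fixed_words n m \<pi>))))"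
    unfolding card fixed_words_def by (simp only: of_nat_sum sum_distrib_left mean_sum)
  also have "\<dots> = (\<Sum>m\<in>?M. of_nat (\<Sum>b\<in>B. card {x \<in> words n m. compatible n (Des n b) x}))"
    using assms(1) by (simp only: fine_char_def)
  also have "\<dots> = of_nat (\<Sum>b\<in>B. card {x \<in> S. compatible n (Des n b) x})"
    unfolding card of_nat_sum by (rule sum.swap)
  finally show ?thesis .
qed

section \<open>Pairs of words\<close>

lemma sorted_words_unique:
  assumes "x \<in> words n m" "y \<in> words n m"
    and "\<And>j. j \<in> {1..n - 1} \<Longrightarrow> x j \<le> x (j + 1)" "\<And>j. j \<in> {1..n - 1} \<Longrightarrow> y j \<le> y (j + 1)"
  shows "x = y"
proof -
  have sorted: "sorted (map z [1..<Suc n])" if "\<And>j. j \<in> {1..n - 1} \<Longrightarrow> z j \<le> z (j + 1)" for z :: "nat \<Rightarrow> nat"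
    using that by (auto simp: sorted_iff_nth_Suc simp del: upt_Suc)
  have mset: "mset (map z [1..<Suc n]) = image_mset z (mset_set {1..n})" for z :: "nat \<Rightarrow> nat"
    by (simp add: atLeastLessThanSuc_atLeastAtMost del: upt_Suc)
  have "image_mset x (mset_set {1..n}) = image_mset y (mset_set {1..n})"
    using assms(1,2) monomial_of_eq_iff[of "{1..n}" x y] by (simp add: words_def)
  then have "mset (map x [1..<Suc n]) = mset (map y [1..<Suc n])"
    by (simp only: mset)
  then have "map x [1..<Suc n] = map y [1..<Suc n]"
    using sorted[of x] sorted[of y] assms(3,4) properties_for_sort by metis
  then have eq: "x p = y p" if "p \<in> {1..n}" for p
    using that by (auto simp: map_eq_conv simp del: upt_Suc)
  show ?thesis
  proof
    fix p show "x p = y p"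
      using eq[of p] assms(1,2) by (cases "p \<in> {1..n}") (auto simp: words_def PiE_def extensional_def)
  qed
qed

text \<open>A sorted word that rises by one after each position in \<open>J\<close> and nowhere
  else. For \<open>J\<close> inside \<open>{1..n - 1}\<close> it numbers the blocks of the Young
  subgroup from 0, and that subgroup is its stabilizer.\<close>

definition jump_word :: "nat \<Rightarrow> nat set \<Rightarrow> nat \<Rightarrow> nat" where
  "jump_word n J = (\<lambda>p\<in>{1..n}. card {j \<in> J. j < p})"

definition jump_content :: "nat \<Rightarrow> nat set \<Rightarrow> (nat \<Rightarrow>\<^sub>0 nat)" where
  "jump_content n J = monomial_of {1..n} (jump_word n J)"

lemma jump_word_in_words: "jump_word n J \<in> words n (jump_content n J)"
  by (simp add: words_def jump_content_def jump_word_def)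

lemma jump_word_Suc:
  assumes "p \<in> {1..n - 1}"
  shows "jump_word n J (p + 1) = jump_word n J p + (if p \<in> J then 1 else 0)"
proof -
  define A where "A = {j \<in> J. j < p}"
  have A: "{j \<in> J. j < p + 1} = (if p \<in> J then insert p A else A)" "p \<notin> A"
    by (auto simp: A_def less_Suc_eq)
  have "finite A"
    unfolding A_def by (rule finite_subset[of _ "{..<p}"]) auto
  then have "card {j \<in> J. j < p + 1} = card A + (if p \<in> J then 1 else 0)"
    using A by (cases "p \<in> J") simp_all
  moreover have "jump_word n J (p + 1) = card {j \<in> J. j < p + 1}" "jump_word n J p = card A"
    using assms unfolding jump_word_def A_def by auto
  ultimately show ?thesis
    by simp
qed

text \<open>
  The descents of the word whose letters are the pairs \<open>(x p, b p)\<close>, ordered lexicographically.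
\<close>

definition pair_descents :: "nat \<Rightarrow> (nat \<Rightarrow> nat) \<Rightarrow> (nat \<Rightarrow> nat) \<Rightarrow> nat set" where
  "pair_descents n b x =
     {p \<in> {1..n - 1}. x (p + 1) < x p \<or> x (p + 1) = x p \<and> b (p + 1) < b p}"

text \<open>Two-digit numbers in base \<open>c\<close>: as long as the letters of \<open>x\<close>
  stay below \<open>c\<close>, their order is lexicographic with \<open>y\<close> as leading
  digit.\<close>

definition pair_word :: "nat \<Rightarrow> nat \<Rightarrow> (nat \<Rightarrow> nat) \<Rightarrow> (nat \<Rightarrow> nat) \<Rightarrow> nat \<Rightarrow> nat" where
  "pair_word n c y x = (\<lambda>p\<in>{1..n}. y p * c + x p)"

lemma pair_word_comp:
  assumes "g permutes {1..n}"
  shows "pair_word n c y x \<circ> g = pair_word n c (y \<circ> g) (x \<circ> g)"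
proof
  fix p
  have "g p \<in> {1..n} \<longleftrightarrow> p \<in> {1..n}"
    using assms by (rule permutes_in_image)
  then show "(pair_word n c y x \<circ> g) p = pair_word n c (y \<circ> g) (x \<circ> g) p"
    by (simp add: pair_word_def)
qed

lemma mult_add_less_eq_iff:
  fixes c :: nat
  assumes "a < c" "a' < c"
  shows "y * c + a < y' * c + a' \<longleftrightarrow> y < y' \<or> y = y' \<and> a < a'"
    and "y * c + a = y' * c + a' \<longleftrightarrow> y = y' \<and> a = a'"
proof -
  have *: "y * c + a < y' * c + a'" if "y < y'" "a < c" for y y' a a' :: nat
  proof -
    have "y * c + a < Suc y * c"
      using that by simp
    also have "\<dots> \<le> y' * c"
      using that by (intro mult_le_mono1) simp
    finally show ?thesis
      by simp
  qed
  show "y * c + a < y' * c + a' \<longleftrightarrow> y < y' \<or> y = y' \<and> a < a'"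
    using *[of y y' a a'] *[of y' y a' a] assms by (cases y y' rule: linorder_cases) auto
  show "y * c + a = y' * c + a' \<longleftrightarrow> y = y' \<and> a = a'"
    using *[of y y' a a'] *[of y' y a' a] assms by (cases y y' rule: linorder_cases) auto
qed

lemma inj_on_pair_word:
  assumes "\<And>x p. x \<in> X \<Longrightarrow> p \<in> {1..n} \<Longrightarrow> x p < c" "X \<subseteq> {1..n} \<rightarrow>\<^sub>E UNIV" "Y \<subseteq> {1..n} \<rightarrow>\<^sub>E UNIV"
  shows "inj_on (\<lambda>(y, x). pair_word n c y x) (Y \<times> X)"
proof (rule inj_onI, clarify)
  fix y x y' x' assume *: "y \<in> Y" "x \<in> X" "y' \<in> Y" "x' \<in> X" "pair_word n c y x = pair_word n c y' x'"
  have "y p = y' p \<and> x p = x' p" for p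
  proof (cases "p \<in> {1..n}")
    case True
    then show ?thesis
      using fun_cong[OF *(5), of p] mult_add_less_eq_iff(2)[of "x p" c "x' p" "y p" "y' p"] assms(1) *
      by (simp add: pair_word_def)
  next
    case False
    have "z p = undefined" if "z \<in> {1..n} \<rightarrow>\<^sub>E (UNIV :: nat set)" for z
      using that False by (rule PiE_arb)
    then show ?thesis
      using * assms(2,3) by (metis subsetD)
  qed
  then show "y = y' \<and> x = x'"
    by (simp add: fun_eq_iff)
qed

text \<open>Compatible words increase weakly, so the leading digits are sorted and their content
  leaves only \<open>jump_word n J\<close>. At a position in \<open>J\<close> this word rises and
  nothing is asked of \<open>x\<close>. Elsewhere it is constant, and \<open>x\<close> must increase
  weakly, strictly at a descent of \<open>b\<close>; that is to say, the position is no pair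
  descent.\<close>

lemma pair_word_compatible_iff:
  assumes "y \<in> words n (jump_content n J)" "\<And>p. p \<in> {1..n} \<Longrightarrow> x p < c"
  shows "compatible n (Des n b) (pair_word n c y x) \<longleftrightarrow>
    y = jump_word n J \<and> pair_descents n b x \<subseteq> J"
proof
  assume *: "compatible n (Des n b) (pair_word n c y x)"
  have x: "x p < c" "x (p + 1) < c" if "p \<in> {1..n - 1}" for p
    using assms(2)[of p] assms(2)[of "p + 1"] that by auto
  have step: "y p < y (p + 1) \<or> y p = y (p + 1) \<and> x p \<le> x (p + 1) \<and> (p \<in> Des n b \<longrightarrow> x p < x (p + 1))"
    if "p \<in> {1..n - 1}" for p
  proof -
    have "pair_word n c y x p \<le> pair_word n c y x (p + 1)"
        "p \<in> Des n b \<Longrightarrow> pair_word n c y x p < pair_word n c y x (p + 1)"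
      using * that by (auto simp: compatible_def)
    moreover have "pair_word n c y x p = y p * c + x p" "pair_word n c y x (p + 1) = y (p + 1) * c + x (p + 1)"
      using that by (auto simp: pair_word_def)
    ultimately show ?thesis
      using mult_add_less_eq_iff[OF x[OF that], of "y p" "y (p + 1)"] by (auto simp: le_less)
  qed
  have y: "y = jump_word n J"
  proof (rule sorted_words_unique[OF assms(1) jump_word_in_words])
    show "y j \<le> y (j + 1)" if "j \<in> {1..n - 1}" for j
      using step[OF that] by linarith
    show "jump_word n J j \<le> jump_word n J (j + 1)" if "j \<in> {1..n - 1}" for j
      using jump_word_Suc[OF that, of J] by simp
  qed
  moreover have "pair_descents n b x \<subseteq> J"
  proof
    fix p assume p: "p \<in> pair_descents n b x"
    then have p1: "p \<in> {1..n - 1}"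
      by (simp add: pair_descents_def)
    show "p \<in> J"
      using step[OF p1] p jump_word_Suc[OF p1, of J] y p1
      by (cases "p \<in> J") (auto simp: pair_descents_def Des_def)
  qed
  ultimately show "y = jump_word n J \<and> pair_descents n b x \<subseteq> J" ..
next
  assume *: "y = jump_word n J \<and> pair_descents n b x \<subseteq> J"
  show "compatible n (Des n b) (pair_word n c y x)"
    unfolding compatible_def
  proof
    fix p assume p: "p \<in> {1..n - 1}"
    have x: "x p < c" "x (p + 1) < c"
      using assms(2)[of p] assms(2)[of "p + 1"] p by auto
    have "pair_word n c y x p = y p * c + x p" "pair_word n c y x (p + 1) = y (p + 1) * c + x (p + 1)"
      using p by (auto simp: pair_word_def)
    then show "pair_word n c y x p \<le> pair_word n c y x (p + 1) \<and>
        (p \<in> Des n b \<longrightarrow> pair_word n c y x p < pair_word n c y x (p + 1))"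
      using mult_add_less_eq_iff[OF x, of "y p" "y (p + 1)"] * jump_word_Suc[OF p, of J] p
      by (cases "p \<in> J") (auto simp: pair_descents_def Des_def)
  qed
qed

text \<open>
  The product of two permutation characters on words is the one on words in pairs of letters,
  and such a word is coded by a word in natural numbers such that the lexicographic order is
  preserved.
\<close>

lemma fine_char_times_fixed_words:
  assumes "fine_char n \<chi> B"
  shows "mean n (\<lambda>\<pi>. \<chi> \<pi> * of_nat (card (fixed_words n (jump_content n J) \<pi>)) *
      of_nat (card (fixed_words n m \<pi>))) =
    of_nat (\<Sum>b\<in>B. card {x \<in> words n m. pair_descents n b x \<subseteq> J})"
proof -
  \<comment> \<open>A base above every letter of every word with content \<open>m\<close>; the
    inserted 0 keeps \<open>Max\<close> defined for the empty word.\<close>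
  define c where "c = Suc (Max (insert 0 (Poly_Mapping.keys m)))"
  let ?Y = "words n (jump_content n J)" and ?X = "words n m"
  let ?f = "\<lambda>(y, x). pair_word n c y x"
  define S where "S = ?f ` (?Y \<times> ?X)"
  have c: "x p < c" if "x \<in> ?X" "p \<in> {1..n}" for x p
  proof -
    have "x p \<in> Poly_Mapping.keys m"
      using values_subset_keys[of "{1..n}" x m] that by (auto simp: words_def)
    then show ?thesis
      unfolding c_def by (intro le_imp_less_Suc Max_ge) auto
  qed
  have inj: "inj_on ?f (?Y \<times> ?X)"
    by (rule inj_on_pair_word) (use c in \<open>auto simp: words_def\<close>)
  have card: "card {z \<in> S. P z} = card {(y, x) \<in> ?Y \<times> ?X. P (pair_word n c y x)}" for P
  proof -
    have "{z \<in> S. P z} = ?f ` {(y, x) \<in> ?Y \<times> ?X. P (pair_word n c y x)}"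
      by (auto simp: S_def)
    moreover have "inj_on ?f {(y, x) \<in> ?Y \<times> ?X. P (pair_word n c y x)}"
      by (rule inj_on_subset[OF inj]) auto
    ultimately show ?thesis
      by (simp add: card_image)
  qed
  have fixed: "card {z \<in> S. z \<circ> \<pi> = z} =
      card (fixed_words n (jump_content n J) \<pi>) * card (fixed_words n m \<pi>)"
    if "\<pi> permutes {1..n}" for \<pi>
  proof -
    have "{(y, x) \<in> ?Y \<times> ?X. pair_word n c y x \<circ> \<pi> = pair_word n c y x} =
        fixed_words n (jump_content n J) \<pi> \<times> fixed_words n m \<pi>"
    proof -
      have "pair_word n c y x \<circ> \<pi> = pair_word n c y x \<longleftrightarrow> y \<circ> \<pi> = y \<and> x \<circ> \<pi> = x"
        if "y \<in> ?Y" "x \<in> ?X" for y x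
        using inj_onD[OF inj, of "(y \<circ> \<pi>, x \<circ> \<pi>)" "(y, x)"] that \<open>\<pi> permutes {1..n}\<close>
        by (auto simp: pair_word_comp words_comp_permutes)
      then show ?thesis
        unfolding fixed_words_def by blast
    qed
    then show ?thesis
      by (simp only: card card_cartesian_product)
  qed
  have compat: "card {z \<in> S. compatible n (Des n b) z} =
      card {x \<in> ?X. pair_descents n b x \<subseteq> J}" for b
  proof -
    \<comment> \<open>The single sorted \<open>y\<close> makes this a product with a singleton, so
      only the choices of \<open>x\<close> are counted.\<close>
    have "{(y, x) \<in> ?Y \<times> ?X. compatible n (Des n b) (pair_word n c y x)} =
        {jump_word n J} \<times> {x \<in> ?X. pair_descents n b x \<subseteq> J}"
      using pair_word_compatible_iff[of _ n J _ c b] c jump_word_in_words[of n J] by blast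
    then show ?thesis
      by (simp only: card card_cartesian_product) simp
  qed
  have "mean n (\<lambda>\<pi>. \<chi> \<pi> * of_nat (card {z \<in> S. z \<circ> \<pi> = z})) =
      of_nat (\<Sum>b\<in>B. card {z \<in> S. compatible n (Des n b) z})"
  proof (rule fine_char_closed_set[OF assms])
    show "finite S"
      by (simp add: S_def)
    show "S \<subseteq> {1..n} \<rightarrow>\<^sub>E UNIV"
      by (auto simp: S_def pair_word_def)
    show "z \<circ> g \<in> S" if "z \<in> S" "g permutes {1..n}" for z g
    proof -
      obtain y x where yx: "y \<in> ?Y" "x \<in> ?X" "z = pair_word n c y x"
        using \<open>z \<in> S\<close> by (auto simp: S_def)
      then have "z \<circ> g = ?f (y \<circ> g, x \<circ> g)" "(y \<circ> g, x \<circ> g) \<in> ?Y \<times> ?X"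
        using \<open>g permutes {1..n}\<close> by (simp_all add: pair_word_comp words_comp_permutes)
      then show ?thesis
        unfolding S_def by (rule image_eqI)
    qed
  qed
  moreover have "mean n (\<lambda>\<pi>. \<chi> \<pi> * of_nat (card {z \<in> S. z \<circ> \<pi> = z})) =
      mean n (\<lambda>\<pi>. \<chi> \<pi> * of_nat (card (fixed_words n (jump_content n J) \<pi>)) *
        of_nat (card (fixed_words n m \<pi>)))"
    by (rule mean_cong) (simp add: fixed)
  ultimately show ?thesis
    by (simp add: compat)
qed

section \<open>Standardization\<close>

definition lex_less :: "(nat \<Rightarrow> nat) \<Rightarrow> (nat \<Rightarrow> nat) \<Rightarrow> nat \<Rightarrow> nat \<Rightarrow> bool" where
  "lex_less b x p q \<longleftrightarrow> x p < x q \<or> x p = x q \<and> b p < b q"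

text \<open>The rank of position \<open>p\<close> by the pair \<open>(x p, b p)\<close>, counted
  from 1 as the positions are; the identity outside \<open>{1..n}\<close> is what
  \<open>permutes\<close> demands.\<close>

definition standardize :: "nat \<Rightarrow> (nat \<Rightarrow> nat) \<Rightarrow> (nat \<Rightarrow> nat) \<Rightarrow> nat \<Rightarrow> nat" where
  "standardize n b x p =
     (if p \<in> {1..n} then Suc (card {q \<in> {1..n}. lex_less b x q p}) else p)"

lemma lex_less_trans: "lex_less b x p q \<Longrightarrow> lex_less b x q r \<Longrightarrow> lex_less b x p r"
  unfolding lex_less_def by linarith

lemma lex_less_irrefl: "\<not> lex_less b x p p"
  by (simp add: lex_less_def)

lemma lex_less_total:
  assumes "b permutes A" "p \<noteq> q"
  shows "lex_less b x p q \<or> lex_less b x q p"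
proof -
  have "b p \<noteq> b q"
    using permutes_inj[OF assms(1)] assms(2) by (simp add: inj_eq)
  then show ?thesis
    unfolding lex_less_def by linarith
qed

lemma standardize_less:
  assumes "p \<in> {1..n}" "q \<in> {1..n}" "lex_less b x p q"
  shows "standardize n b x p < standardize n b x q"
proof -
  have "{r \<in> {1..n}. lex_less b x r p} \<subset> {r \<in> {1..n}. lex_less b x r q}"
    using assms lex_less_trans[of b x _ p q] lex_less_irrefl[of b x p] by blast
  then have "card {r \<in> {1..n}. lex_less b x r p} < card {r \<in> {1..n}. lex_less b x r q}"
    by (intro psubset_card_mono) auto
  then show ?thesis
    using assms by (simp add: standardize_def)
qed

lemma standardize_less_iff:
  assumes "b permutes A" "p \<in> {1..n}" "q \<in> {1..n}"
  shows "standardize n b x p < standardize n b x q \<longleftrightarrow> lex_less b x p q"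
  using standardize_less[of p n q b x] standardize_less[of q n p b x] assms(2,3)
    lex_less_total[OF assms(1), of p q x]
  by (cases "p = q") (auto simp: lex_less_irrefl)

lemma standardize_permutes:
  assumes "b permutes A"
  shows "standardize n b x permutes {1..n}"
proof (rule bij_imp_permutes)
  have inj: "inj_on (standardize n b x) {1..n}"
  proof (rule inj_onI, rule ccontr)
    fix p q assume pq: "p \<in> {1..n}" "q \<in> {1..n}" "standardize n b x p = standardize n b x q" "p \<noteq> q"
    then show False
      using lex_less_total[OF assms pq(4), of x] standardize_less[OF pq(1,2), of b x]
        standardize_less[OF pq(2,1), of b x] by auto
  qed
  moreover have "standardize n b x ` {1..n} \<subseteq> {1..n}"
  proof
    fix r assume "r \<in> standardize n b x ` {1..n}"
    then obtain p where p: "p \<in> {1..n}" "r = standardize n b x p"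
      by blast
    have "{q \<in> {1..n}. lex_less b x q p} \<subset> {1..n}"
      using p(1) lex_less_irrefl[of b x p] by blast
    then have "card {q \<in> {1..n}. lex_less b x q p} < card {1..n}"
      by (rule psubset_card_mono[OF finite_atLeastAtMost])
    then show "r \<in> {1..n}"
      using p by (simp add: standardize_def)
  qed
  ultimately show "bij_betw (standardize n b x) {1..n} {1..n}"
    using endo_inj_surj[of "{1..n}" "standardize n b x"] by (simp add: bij_betw_def)
  show "standardize n b x p = p" if "p \<notin> {1..n}" for p
    unfolding standardize_def using that by (rule if_not_P)
qed

text \<open>A permutation is its own rank function: exactly \<open>\<sigma> p - 1\<close> positions
  carry a value below \<open>\<sigma> p\<close>.\<close>

lemma standardize_unique:
  assumes "\<sigma> permutes {1..n}"
    and "\<And>p q. p \<in> {1..n} \<Longrightarrow> q \<in> {1..n} \<Longrightarrow> lex_less b x p q \<longleftrightarrow> \<sigma> p < \<sigma> q"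
  shows "standardize n b x = \<sigma>"
proof
  fix p
  show "standardize n b x p = \<sigma> p"
  proof (cases "p \<in> {1..n}")
    case True
    have \<sigma>p: "\<sigma> p \<in> {1..n}"
      using True permutes_in_image[OF assms(1)] by blast
    have "\<sigma> ` {q \<in> {1..n}. lex_less b x q p} = {1..<\<sigma> p}"
    proof (intro equalityI subsetI)
      fix r assume "r \<in> \<sigma> ` {q \<in> {1..n}. lex_less b x q p}"
      then obtain q where q: "q \<in> {1..n}" "lex_less b x q p" "r = \<sigma> q"
        by blast
      have "\<sigma> q \<in> {1..n}"
        using q permutes_in_image[OF assms(1)] by blast
      then show "r \<in> {1..<\<sigma> p}"
        using assms(2)[OF q(1) True] q by simp
    next
      fix r assume r: "r \<in> {1..<\<sigma> p}"
      then have "r \<in> \<sigma> ` {1..n}"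
        using \<sigma>p permutes_image[OF assms(1)] by auto
      then obtain q where q: "q \<in> {1..n}" "r = \<sigma> q"
        by blast
      then show "r \<in> \<sigma> ` {q \<in> {1..n}. lex_less b x q p}"
        using assms(2)[OF q(1) True] r by auto
    qed
    moreover have "inj_on \<sigma> {q \<in> {1..n}. lex_less b x q p}"
      using permutes_inj[OF assms(1)] by (rule inj_on_subset) auto
    ultimately have "card {q \<in> {1..n}. lex_less b x q p} = card {1..<\<sigma> p}"
      by (metis card_image)
    then show ?thesis
      using True \<sigma>p by (simp add: standardize_def)
  next
    case False
    then show ?thesis
      unfolding standardize_def using permutes_not_in[OF assms(1) False] by (simp only: if_False)
  qed
qed

text \<open>Between neighbours, \<open>i\<close> rises strictly where \<tau> descends, and where
  \<tau> ascends it breaks a possible tie of \<open>i\<close> in the right direction. Transitivity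
  does the rest.\<close>

lemma compatible_imp_lex_less:
  assumes "\<tau> permutes {1..n}" "compatible n (Des n \<tau>) i" "1 \<le> s" "s < t" "t \<le> n"
  shows "lex_less \<tau> i s t"
proof -
  have step: "lex_less \<tau> i r (Suc r)" if "1 \<le> r" "Suc r \<le> n" for r
  proof -
    have "\<tau> r \<noteq> \<tau> (Suc r)"
      using permutes_inj[OF assms(1)] by (simp add: inj_eq)
    moreover have "i r \<le> i (Suc r)" "r \<in> Des n \<tau> \<Longrightarrow> i r < i (Suc r)"
      using assms(2) that by (auto simp: compatible_def)
    moreover have "r \<in> Des n \<tau> \<longleftrightarrow> \<tau> (Suc r) < \<tau> r"
      using that by (auto simp: Des_def)
    ultimately show ?thesis
      unfolding lex_less_def by linarith
  qed
  show ?thesis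
    using assms(4,5)
  proof (induction t)
    case (Suc t)
    then show ?case
      using step[of t] assms(3) lex_less_trans[of \<tau> i s t "Suc t"] by (cases "s = t") auto
  qed simp
qed

text \<open>At \<open>\<sigma> p\<close> the words \<open>i\<close> and
  \<open>b \<circ> inv' \<sigma>\<close> have the letters \<open>(i \<circ> \<sigma>) p\<close> and
  \<open>b p\<close>. The natural order of positions, which compatibility makes the order of the
  pairs, is thus pulled back along \<sigma>.\<close>

lemma standardize_comp:
  assumes "b permutes {1..n}" "\<sigma> permutes {1..n}"
    and "compatible n (Des n (b \<circ> inv' \<sigma>)) i"
  shows "standardize n b (i \<circ> \<sigma>) = \<sigma>"
proof (rule standardize_unique[OF assms(2)])
  fix p q assume pq: "p \<in> {1..n}" "q \<in> {1..n}"
  have \<tau>: "b \<circ> inv' \<sigma> permutes {1..n}"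
    using assms(1,2) permutes_compose permutes_inv by blast
  have less: "lex_less b (i \<circ> \<sigma>) p q" if pq: "p \<in> {1..n}" "q \<in> {1..n}" "\<sigma> p < \<sigma> q" for p q
  proof -
    have "\<sigma> p \<in> {1..n}" "\<sigma> q \<in> {1..n}"
      using pq permutes_in_image[OF assms(2)] by blast+
    then have "lex_less (b \<circ> inv' \<sigma>) i (\<sigma> p) (\<sigma> q)"
      using compatible_imp_lex_less[OF \<tau> assms(3)] pq by auto
    then show ?thesis
      using permutes_inverses(2)[OF assms(2)] by (simp add: lex_less_def)
  qed
  show "lex_less b (i \<circ> \<sigma>) p q \<longleftrightarrow> \<sigma> p < \<sigma> q"
  proof
    assume *: "lex_less b (i \<circ> \<sigma>) p q"
    then have "\<not> \<sigma> q < \<sigma> p"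
      using less[OF pq(2,1)] lex_less_trans[of b "i \<circ> \<sigma>" p q p] lex_less_irrefl by blast
    moreover have "\<sigma> p \<noteq> \<sigma> q"
      using permutes_inj[OF assms(2)] * lex_less_irrefl[of b "i \<circ> \<sigma>" p] by (auto simp: inj_eq)
    ultimately show "\<sigma> p < \<sigma> q"
      by simp
  qed (rule less[OF pq])
qed

text \<open>Consecutive ranks belong to positions that are consecutive in the order of pairs: the
  letters of \<open>x\<close> do not decrease, and a tie forces \<open>b\<close> to increase, so
  there is no descent of \<open>b \<circ> inv' \<sigma>\<close> at a tie.\<close>

lemma compatible_standardize:
  fixes x :: "nat \<Rightarrow> nat"
  assumes "b permutes {1..n}"
  defines "\<sigma> \<equiv> standardize n b x"
  shows "compatible n (Des n (b \<circ> inv' \<sigma>)) (x \<circ> inv' \<sigma>)"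
  unfolding compatible_def
proof
  have \<sigma>: "\<sigma> permutes {1..n}"
    unfolding \<sigma>_def using assms(1) by (rule standardize_permutes)
  fix s assume s: "s \<in> {1..n - 1}"
  define p where "p = inv' \<sigma> s"
  define q where "q = inv' \<sigma> (s + 1)"
  have "\<sigma> p = s" "\<sigma> q = s + 1"
    using permutes_inverses(1)[OF \<sigma>] by (simp_all add: p_def q_def)
  moreover have "p \<in> {1..n}" "q \<in> {1..n}"
    unfolding p_def q_def permutes_in_image[OF permutes_inv[OF \<sigma>]] using s by auto
  ultimately have "lex_less b x p q"
    using standardize_less_iff[OF assms(1), of p n q x] by (simp add: \<sigma>_def)
  then show "(x \<circ> inv' \<sigma>) s \<le> (x \<circ> inv' \<sigma>) (s + 1) \<and>
      (s \<in> Des n (b \<circ> inv' \<sigma>) \<longrightarrow> (x \<circ> inv' \<sigma>) s < (x \<circ> inv' \<sigma>) (s + 1))"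
    unfolding lex_less_def by (auto simp: Des_def p_def q_def)
qed

lemma Des_standardize:
  assumes "b permutes A"
  shows "Des n (standardize n b x) = pair_descents n b x"
proof -
  have "standardize n b x (p + 1) < standardize n b x p \<longleftrightarrow> lex_less b x (p + 1) p"
    if "p \<in> {1..n - 1}" for p
    using that by (intro standardize_less_iff[OF assms]) auto
  then show ?thesis
    unfolding Des_def pair_descents_def lex_less_def by auto
qed

section \<open>Coefficients of the quasisymmetric function of a product\<close>

text \<open>The pair \<open>(\<sigma>, i)\<close> corresponds to the word
  \<open>x = i \<circ> \<sigma>\<close>: standardization recovers \<sigma> from \<open>x\<close>,
  and \<open>i\<close> is then \<open>x \<circ> inv' \<sigma>\<close>. Hence every word is counted
  for at most one \<sigma>.\<close>

lemma sum_compatible_inverses: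
  assumes "b permutes {1..n}" "R \<subseteq> carrier (sym_group n)"
  shows "(\<Sum>\<sigma>\<in>R. card {i \<in> words n m. compatible n (Des n (b \<circ> inv' \<sigma>)) i}) =
    card {x \<in> words n m. standardize n b x \<in> R}"
proof -
  let ?W = "\<lambda>\<sigma>. {i \<in> words n m. compatible n (Des n (b \<circ> inv' \<sigma>)) i}"
  have R: "\<sigma> permutes {1..n}" if "\<sigma> \<in> R" for \<sigma>
    using that assms(2) sym_group_carrier by blast
  have "finite R"
    using assms(2) finite_carrier_sym_group finite_subset by blast
  then have "(\<Sum>\<sigma>\<in>R. card (?W \<sigma>)) = card (SIGMA \<sigma>:R. ?W \<sigma>)"
    by (intro card_SigmaI[symmetric]) auto
  also have "\<dots> = card {x \<in> words n m. standardize n b x \<in> R}"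
  proof (rule bij_betw_same_card)
    let ?f = "\<lambda>(\<sigma>, i). i \<circ> \<sigma>" and ?g = "\<lambda>x. (standardize n b x, x \<circ> inv' (standardize n b x))"
    show "bij_betw ?f (SIGMA \<sigma>:R. ?W \<sigma>) {x \<in> words n m. standardize n b x \<in> R}"
    proof (rule bij_betw_byWitness[where f' = ?g])
      have cancel: "(x \<circ> \<sigma>) \<circ> inv' \<sigma> = x" "(x \<circ> inv' \<sigma>) \<circ> \<sigma> = x" if "\<sigma> permutes {1..n}" for x :: "nat \<Rightarrow> nat" and \<sigma>
        using permutes_inverses[OF that] by (simp_all add: fun_eq_iff)
      show "\<forall>a\<in>SIGMA \<sigma>:R. ?W \<sigma>. ?g (?f a) = a"
      proof
        fix a assume "a \<in> (SIGMA \<sigma>:R. ?W \<sigma>)"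
        then obtain \<sigma> i where a: "\<sigma> \<in> R" "i \<in> ?W \<sigma>" "a = (\<sigma>, i)"
          by (rule SigmaE)
        then have "standardize n b (i \<circ> \<sigma>) = \<sigma>"
          by (intro standardize_comp[OF assms(1) R[OF a(1)]]) simp
        then show "?g (?f a) = a"
          using cancel(1)[OF R[OF a(1)]] a by simp
      qed
      show "\<forall>x\<in>{x \<in> words n m. standardize n b x \<in> R}. ?f (?g x) = x"
      proof
        fix x assume "x \<in> {x \<in> words n m. standardize n b x \<in> R}"
        then have "standardize n b x permutes {1..n}"
          by (intro R) simp
        then show "?f (?g x) = x"
          using cancel(2)[of "standardize n b x" x] by simp
      qed
      show "?f ` (SIGMA \<sigma>:R. ?W \<sigma>) \<subseteq> {x \<in> words n m. standardize n b x \<in> R}"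
      proof (rule image_subsetI)
        fix a assume "a \<in> (SIGMA \<sigma>:R. ?W \<sigma>)"
        then obtain \<sigma> i where a: "\<sigma> \<in> R" "i \<in> ?W \<sigma>" "a = (\<sigma>, i)"
          by (rule SigmaE)
        then have "standardize n b (i \<circ> \<sigma>) = \<sigma>"
          by (intro standardize_comp[OF assms(1) R[OF a(1)]]) simp
        moreover have "i \<circ> \<sigma> \<in> words n m"
          using a by (intro words_comp_permutes[OF _ R[OF a(1)]]) simp
        ultimately show "?f a \<in> {x \<in> words n m. standardize n b x \<in> R}"
          using a by simp
      qed
      show "?g ` {x \<in> words n m. standardize n b x \<in> R} \<subseteq> (SIGMA \<sigma>:R. ?W \<sigma>)"
      proof (rule image_subsetI)
        fix x assume x: "x \<in> {x \<in> words n m. standardize n b x \<in> R}"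
        have "x \<circ> inv' (standardize n b x) \<in> words n m"
          using x by (intro words_comp_permutes permutes_inv R) auto
        then show "?g x \<in> (SIGMA \<sigma>:R. ?W \<sigma>)"
          using x compatible_standardize[OF assms(1)] by simp
    qed
  qed
  qed
  finally show ?thesis .
qed

lemma coeff_quasi_product:
  assumes "B \<subseteq> carrier (sym_group n)" "R \<subseteq> carrier (sym_group n)"
  shows "mps_coeff (quasi n (product_mset B (inverses n R))) m =
    of_nat (\<Sum>b\<in>B. card {x \<in> words n m. standardize n b x \<in> R})"
proof -
  let ?h = "\<lambda>b. card {i \<in> words n m. compatible n (Des n b) i}"
  have "finite B" "finite R"
    using assms finite_carrier_sym_group finite_subset by blast+
  have inv: "inv\<^bsub>sym_group n\<^esub> \<sigma> = inv' \<sigma>" if "\<sigma> \<in> R" for \<sigma>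
    using that assms(2) by (intro sym_group_inv_equality) auto
  have inverses: "inverses n R = inv' ` R"
    unfolding inverses_def by (rule image_cong[OF refl inv])
  have "inv' (inv' \<sigma>) = \<sigma>" if "\<sigma> \<in> R" for \<sigma>
    using that assms(2) sym_group_carrier permutes_inv_inv by blast
  \<comment> \<open>Injectivity lets the sum over the set of inverses, in which each inverse occurs
    once, run over \<open>R\<close> itself.\<close>
  then have inj: "inj_on inv' R"
    by (rule inj_on_inverseI[where g = inv'])
  have "(\<Sum>b\<in>#product_mset B (inverses n R). ?h b) = (\<Sum>(b, \<sigma>)\<in>B \<times> inverses n R. ?h (b \<circ> \<sigma>))"
    unfolding product_mset_def sum_unfold_sum_mset image_mset.compositionality
    by (simp add: comp_def case_prod_unfold)
  also have "\<dots> = (\<Sum>b\<in>B. \<Sum>\<sigma>\<in>inverses n R. ?h (b \<circ> \<sigma>))"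
    by (rule sum.cartesian_product[symmetric])
  also have "\<dots> = (\<Sum>b\<in>B. \<Sum>\<sigma>\<in>R. ?h (b \<circ> inv' \<sigma>))"
    by (simp add: inverses sum.reindex[OF inj])
  also have "\<dots> = (\<Sum>b\<in>B. card {x \<in> words n m. standardize n b x \<in> R})"
  proof (rule sum.cong[OF refl])
    fix b assume "b \<in> B"
    then have "b permutes {1..n}"
      using assms(1) sym_group_carrier by blast
    then show "(\<Sum>\<sigma>\<in>R. ?h (b \<circ> inv' \<sigma>)) = card {x \<in> words n m. standardize n b x \<in> R}"
      using assms(2) by (rule sum_compatible_inverses)
  qed
  finally show ?thesis
    by (simp only: coeff_quasi)
qed

lemma coeff_quasi_R_class:
  assumes "B \<subseteq> carrier (sym_group n)"
  shows "mps_coeff (quasi n (product_mset B (inverses n (R_class n J)))) m =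
    of_nat (\<Sum>b\<in>B. card {x \<in> words n m. pair_descents n b x \<subseteq> J})"
proof -
  have "standardize n b x \<in> R_class n J \<longleftrightarrow> pair_descents n b x \<subseteq> J" if "b \<in> B" for b x
  proof -
    have "b permutes {1..n}"
      using that assms sym_group_carrier by blast
    then show ?thesis
      using standardize_permutes[of b _ n x] Des_standardize[of b _ n x]
      unfolding R_class_def mem_Collect_eq sym_group_carrier by metis
  qed
  then show ?thesis
    using coeff_quasi_product[OF assms, of "R_class n J"] by (simp add: R_class_def)
qed

lemma coeff_quasi_D_class:
  assumes "B \<subseteq> carrier (sym_group n)"
  shows "mps_coeff (quasi n (product_mset B (inverses n (D_class n J)))) m =
    of_nat (\<Sum>b\<in>B. card {x \<in> words n m. pair_descents n b x = J})"
proof -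
  have "standardize n b x \<in> D_class n J \<longleftrightarrow> pair_descents n b x = J" if "b \<in> B" for b x
  proof -
    have "b permutes {1..n}"
      using that assms sym_group_carrier by blast
    then show ?thesis
      using standardize_permutes[of b _ n x] Des_standardize[of b _ n x]
      unfolding D_class_def mem_Collect_eq sym_group_carrier by metis
  qed
  then show ?thesis
    using coeff_quasi_product[OF assms, of "D_class n J"] by (simp add: D_class_def)
qed

section \<open>Class functions are determined by their Frobenius characteristic\<close>

definition class_function :: "nat \<Rightarrow> ((nat \<Rightarrow> nat) \<Rightarrow> complex) \<Rightarrow> bool" where
  "class_function n f \<longleftrightarrow>
     (\<forall>\<pi> g. \<pi> permutes {1..n} \<longrightarrow> g permutes {1..n} \<longrightarrow> f (g \<circ> \<pi> \<circ> inv' g) = f \<pi>)"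

lemma permutes_conjugate:
  assumes "\<pi> permutes A" "g permutes A"
  shows "g \<circ> \<pi> \<circ> inv' g permutes A"
  using assms by (intro permutes_compose permutes_inv)

lemma sum_conjugate:
  fixes f :: "('a \<Rightarrow> 'a) \<Rightarrow> 'b::comm_monoid_add"
  assumes "g permutes A"
  shows "(\<Sum>\<pi>\<in>{\<pi>. \<pi> permutes A}. f (g \<circ> \<pi> \<circ> inv' g)) = (\<Sum>\<pi>\<in>{\<pi>. \<pi> permutes A}. f \<pi>)"
proof (rule sum.reindex_bij_witness[of _ "\<lambda>\<pi>. inv' g \<circ> \<pi> \<circ> g" "\<lambda>\<pi>. g \<circ> \<pi> \<circ> inv' g"])
  show "inv' g \<circ> (g \<circ> \<pi> \<circ> inv' g) \<circ> g = \<pi>" "g \<circ> (inv' g \<circ> \<pi> \<circ> g) \<circ> inv' g = \<pi>" for \<pi>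
    using permutes_inverses[OF assms] by (simp_all add: fun_eq_iff)
  show "g \<circ> \<pi> \<circ> inv' g \<in> {\<pi>. \<pi> permutes A}" if "\<pi> \<in> {\<pi>. \<pi> permutes A}" for \<pi>
    using that permutes_conjugate[OF _ assms] by simp
  show "inv' g \<circ> \<pi> \<circ> g \<in> {\<pi>. \<pi> permutes A}" if "\<pi> \<in> {\<pi>. \<pi> permutes A}" for \<pi>
    using that assms by (auto intro!: permutes_compose permutes_inv)
qed simp

text \<open>Exchanging the sums turns the mean into a sum over words of stabilizer sums. All words
  with content \<open>m\<close> are rearrangements of \<open>x\<close>, so their stabilizers are
  conjugate and a class function has the same sum over each; the mean is a positive multiple of the
  sum in question.\<close>

lemma sum_over_stabilizer:
  assumes "class_function n f" "x \<in> words n m"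
    and "mean n (\<lambda>\<pi>. f \<pi> * of_nat (card (fixed_words n m \<pi>))) = 0"
  shows "(\<Sum>\<pi> | \<pi> permutes {1..n} \<and> x \<circ> \<pi> = x. f \<pi>) = 0"
proof -
  let ?S = "{\<pi>. \<pi> permutes {1..n}}"
  define T where "T w = (\<Sum>\<pi>\<in>?S. if w \<circ> \<pi> = w then f \<pi> else 0)" for w :: "nat \<Rightarrow> nat"
  have fin: "finite ?S"
    by (simp add: finite_permutations)
  have T: "T w = T x" if w: "w \<in> words n m" for w
  proof -
    obtain g where g: "g permutes {1..n}" "w = x \<circ> g"
      by (rule words_transitive[OF assms(2) w])
    have iff: "w \<circ> \<pi> = w \<longleftrightarrow> x \<circ> (g \<circ> \<pi> \<circ> inv' g) = x" for \<pi>
    proof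
      assume "w \<circ> \<pi> = w"
      then have "(w \<circ> \<pi>) \<circ> inv' g = w \<circ> inv' g"
        by simp
      then show "x \<circ> (g \<circ> \<pi> \<circ> inv' g) = x"
        using permutes_inverses(1)[OF g(1)] by (simp add: fun_eq_iff g(2))
    next
      assume "x \<circ> (g \<circ> \<pi> \<circ> inv' g) = x"
      then have "x \<circ> (g \<circ> \<pi> \<circ> inv' g) \<circ> g = x \<circ> g"
        by simp
      then show "w \<circ> \<pi> = w"
        using permutes_inverses(2)[OF g(1)] by (simp add: fun_eq_iff g(2))
    qed
    have "T w = (\<Sum>\<pi>\<in>?S. if x \<circ> (g \<circ> \<pi> \<circ> inv' g) = x then f (g \<circ> \<pi> \<circ> inv' g) else 0)"
      unfolding T_def iff using assms(1) g(1) by (intro sum.cong refl) (simp add: class_function_def)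
    also have "\<dots> = T x"
      unfolding T_def by (rule sum_conjugate[OF g(1), of "\<lambda>\<pi>. if x \<circ> \<pi> = x then f \<pi> else 0"])
    finally show ?thesis .
  qed
  have "(\<Sum>\<pi>\<in>?S. f \<pi> * of_nat (card (fixed_words n m \<pi>))) = 0"
    using assms(3) by (simp add: mean_def sym_group_def)
  also have "(\<Sum>\<pi>\<in>?S. f \<pi> * of_nat (card (fixed_words n m \<pi>))) =
      (\<Sum>\<pi>\<in>?S. \<Sum>w\<in>words n m. if w \<circ> \<pi> = w then f \<pi> else 0)"
    by (rule sum.cong[OF refl])
      (simp add: fixed_words_def sum.If_cases Int_def mult.commute)
  also have "\<dots> = (\<Sum>w\<in>words n m. T w)"
    unfolding T_def by (rule sum.swap)
  also have "\<dots> = of_nat (card (words n m)) * T x"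
    using T by simp
  finally have "T x = 0"
    using assms(2) by auto
  then show ?thesis
    unfolding T_def using fin by (simp add: sum.If_cases Int_def)
qed

section \<open>Conjugacy of permutations with the same orbits\<close>

lemma card_orbit_eq_least_power:
  assumes "permutation p"
  shows "card (orbit p a) = least_power p a"
proof -
  have "set (support p a) = orbit p a"
    unfolding support_set[OF assms] orbit_altdef_permutation[OF assms] by auto
  then show ?thesis
    using distinct_card[OF cycle_of_permutation[OF assms, of a]] by simp
qed

lemma funpow_eq_iff_dvd:
  assumes "permutation p" "i \<le> j"
  shows "(p ^^ i) a = (p ^^ j) a \<longleftrightarrow> least_power p a dvd (j - i)"
proof -
  have "(p ^^ j) a = (p ^^ i) ((p ^^ (j - i)) a)"
    using assms(2) by (metis add.commute comp_apply funpow_add le_add_diff_inverse)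
  moreover have "inj (p ^^ i)"
    using permutation_bijective[OF permutation_funpow[OF assms(1)]] by (rule bij_is_inj)
  ultimately show ?thesis
    using least_power_dvd[OF assms(1)] by (metis injD)
qed

text \<open>The period of a point is the size of its orbit, so a common orbit means a common period
  and the same coincidences between iterates. This makes the map from \<open>(p ^^ k) a\<close> to
  \<open>(q ^^ k) a\<close> well defined.\<close>

lemma funpow_eq_transfer:
  assumes "permutation p" "permutation q" "orbit p a = orbit q a" "(p ^^ i) a = (p ^^ j) a"
  shows "(q ^^ i) a = (q ^^ j) a"
proof -
  have lp: "least_power p a = least_power q a"
    using card_orbit_eq_least_power[OF assms(1), of a] card_orbit_eq_least_power[OF assms(2), of a] assms(3)
    by simp
  show ?thesis
  proof (cases "i \<le> j")
    case True
    then show ?thesis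
      using assms(4) by (simp add: funpow_eq_iff_dvd assms(1,2) lp)
  next
    case False
    then have "(q ^^ j) a = (q ^^ i) a"
      using assms(4)[symmetric] by (simp add: funpow_eq_iff_dvd assms(1,2) lp)
    then show ?thesis
      by simp
  qed
qed

lemma orbit_eq_if_mem:
  assumes "permutation p" "q \<in> orbit p a"
  shows "orbit p q = orbit p a"
  by (rule orbit_cyclic_eq3[OF cyclic_on_orbit'[OF assms(1)] assms(2)])

text \<open>On each common orbit, \<open>h\<close> walks along the two cycles in step: starting at
  the minimum \<open>r\<close>, it sends \<open>(\<pi> ^^ k) r\<close> to
  \<open>(g ^^ k) r\<close>.\<close>

lemma conjugate_if_same_orbits:
  fixes \<pi> g :: "nat \<Rightarrow> nat"
  assumes "\<pi> permutes {1..n}" "g permutes {1..n}"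
    and "\<And>p. p \<in> {1..n} \<Longrightarrow> orbit \<pi> p = orbit g p"
  obtains h where "h permutes {1..n}" "g = h \<circ> \<pi> \<circ> inv' h"
proof -
  have perm: "permutation \<pi>" "permutation g"
    using assms(1,2) sym_group_carrier' sym_group_carrier by blast+
  define r where "r p = Min (orbit \<pi> p)" for p
  \<comment> \<open>Any number of steps from the base point to \<open>p\<close> will do: by
    \<open>transfer\<close>, the choice does not affect \<open>h\<close>.\<close>
  define d where "d p = (SOME k. (\<pi> ^^ k) (r p) = p)" for p
  define h where "h p = (if p \<in> {1..n} then (g ^^ d p) (r p) else p)" for p
  have sub: "orbit \<pi> p \<subseteq> {1..n}" if "p \<in> {1..n}" for p
    by (rule permutes_orbit_subset[OF assms(1) that])
  have self: "p \<in> orbit \<pi> p" for p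
    by (rule permutation_self_in_orbit[OF perm(1)])
  have r_mem: "r p \<in> orbit \<pi> p" if "p \<in> {1..n}" for p
    unfolding r_def using finite_subset[OF sub[OF that]] self[of p] by (intro Min_in) auto
  have r_in: "r p \<in> {1..n}" if "p \<in> {1..n}" for p
    using r_mem[OF that] sub[OF that] by blast
  have orbit_r: "orbit \<pi> (r p) = orbit \<pi> p" if "p \<in> {1..n}" for p
    by (rule orbit_eq_if_mem[OF perm(1) r_mem[OF that]])
  have r_cong: "r q = r p" if "q \<in> orbit \<pi> p" for p q
    unfolding r_def using orbit_eq_if_mem[OF perm(1) that] by simp
  have d: "(\<pi> ^^ d p) (r p) = p" if p: "p \<in> {1..n}" for p
  proof -
    have "p \<in> orbit \<pi> (r p)"
      using orbit_r[OF p] self[of p] by simp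
    then obtain k where "p = (\<pi> ^^ k) (r p)"
      unfolding orbit_altdef_permutation[OF perm(1)] by blast
    then have "\<exists>k. (\<pi> ^^ k) (r p) = p"
      by (intro exI[of _ k]) (rule sym)
    then show ?thesis
      unfolding d_def by (rule someI_ex)
  qed
  have transfer: "(g ^^ i) (r p) = (g ^^ j) (r p)" if "p \<in> {1..n}" "(\<pi> ^^ i) (r p) = (\<pi> ^^ j) (r p)" for p i j
    using funpow_eq_transfer[OF perm assms(3)[OF r_in[OF that(1)]] that(2)] .
  have surj: "q \<in> h ` {1..n}" if q: "q \<in> {1..n}" for q
  proof -
    have "q \<in> orbit g (r q)"
      using orbit_r[OF q] self[of q] assms(3)[OF r_in[OF q]] by simp
    then obtain k where k: "q = (g ^^ k) (r q)"
      unfolding orbit_altdef_permutation[OF perm(2)] by blast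
    define p where "p = (\<pi> ^^ k) (r q)"
    have "p \<in> orbit \<pi> (r q)"
      unfolding p_def orbit_altdef_permutation[OF perm(1)] by blast
    then have p: "p \<in> orbit \<pi> q"
      using orbit_r[OF q] by simp
    then have "p \<in> {1..n}" "r p = r q"
      using sub[OF q] r_cong by auto
    then have "(\<pi> ^^ d p) (r q) = (\<pi> ^^ k) (r q)"
      using d[of p] p_def by simp
    then have "(g ^^ d p) (r q) = q"
      using transfer[OF q, of "d p" k] k[symmetric] by simp
    then have "h p = q"
      using \<open>p \<in> {1..n}\<close> \<open>r p = r q\<close> by (simp add: h_def)
    then show ?thesis
      using \<open>p \<in> {1..n}\<close> by blast
  qed
  have "h ` {1..n} \<subseteq> {1..n}"
  proof (rule image_subsetI)
    fix p assume p: "p \<in> {1..n}"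
    have "(g ^^ d p) (r p) \<in> {1..n}"
      using permutes_in_image[OF permutes_funpow[OF assms(2)]] r_in[OF p] by blast
    then show "h p \<in> {1..n}"
      using p by (simp add: h_def)
  qed
  then have img: "h ` {1..n} = {1..n}"
    using surj by blast
  then have "inj_on h {1..n}"
    by (intro eq_card_imp_inj_on) simp_all
  then have h: "h permutes {1..n}"
    using img by (intro bij_imp_permutes) (auto simp: bij_betw_def h_def)
  have comm: "h (\<pi> p) = g (h p)" for p
  proof (cases "p \<in> {1..n}")
    case True
    have \<pi>p: "\<pi> p \<in> orbit \<pi> p"
      by (rule orbit.base)
    then have "\<pi> p \<in> {1..n}" "r (\<pi> p) = r p"
      using sub[OF True] r_cong by auto
    then have "(\<pi> ^^ d (\<pi> p)) (r p) = (\<pi> ^^ Suc (d p)) (r p)"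
      using d[of "\<pi> p"] d[OF True] by simp
    then have "(g ^^ d (\<pi> p)) (r p) = (g ^^ Suc (d p)) (r p)"
      by (rule transfer[OF True])
    then show ?thesis
      using True \<open>\<pi> p \<in> {1..n}\<close> \<open>r (\<pi> p) = r p\<close> by (simp add: h_def)
  next
    case False
    then have "\<pi> p = p" "g p = p" "h p = p"
      using permutes_not_in[OF assms(1)] permutes_not_in[OF assms(2)] permutes_not_in[OF h] by blast+
    then show ?thesis
      by simp
  qed
  have "g p = (h \<circ> \<pi> \<circ> inv' h) p" for p
    using comm[of "inv' h p"] permutes_inverses(1)[OF h, of p] by simp
  then have "g = h \<circ> \<pi> \<circ> inv' h"
    by (rule ext)
  with h show thesis
    by (rule that)
qed

text \<open>
  Induction on the sizes of the orbits: a permutation fixing the word that labels the orbits of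
  \<open>\<pi>\<close> either has the same orbits as \<open>\<pi>\<close>, hence is conjugate to it, or has smaller ones.
\<close>

lemma class_function_eq_zero:
  assumes "class_function n f"
    and "\<And>m. mean n (\<lambda>\<pi>. f \<pi> * of_nat (card (fixed_words n m \<pi>))) = 0"
    and "\<pi> permutes {1..n}"
  shows "f \<pi> = 0"
  using assms(3)
\<comment> \<open>The measure is the sum of the squares of the cycle lengths, as each cycle is
  counted once for each of its points.\<close>
proof (induction "\<Sum>p\<in>{1..n}. card (orbit \<pi> p)" arbitrary: \<pi> rule: less_induct)
  case less
  have perm: "permutation \<pi>"
    using less.prems sym_group_carrier' sym_group_carrier by blast
  have sub: "orbit \<pi> p \<subseteq> {1..n}" if "p \<in> {1..n}" for p
    by (rule permutes_orbit_subset[OF less.prems that])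
  have fin: "finite (orbit \<pi> p)" if "p \<in> {1..n}" for p
    using finite_subset[OF sub[OF that]] by simp
  have self: "p \<in> orbit \<pi> p" for p
    by (rule permutation_self_in_orbit[OF perm])
  \<comment> \<open>Minima are faithful labels: they lie in their orbits, so orbits with the same
    minimum coincide.\<close>
  define x where "x = (\<lambda>p\<in>{1..n}. Min (orbit \<pi> p))"
  have x: "x \<in> words n (monomial_of {1..n} x)"
    by (simp add: words_def x_def)
  define Stab where "Stab = {\<pi>'. \<pi>' permutes {1..n} \<and> x \<circ> \<pi>' = x}"
  define same where "same = {\<pi>'. \<pi>' permutes {1..n} \<and> (\<forall>p\<in>{1..n}. orbit \<pi> p = orbit \<pi>' p)}"
  have orbit_le: "orbit \<pi>' p \<subseteq> orbit \<pi> p" if "\<pi>' \<in> Stab" "p \<in> {1..n}" for \<pi>' p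
  proof
    fix q assume "q \<in> orbit \<pi>' p"
    then have q: "q \<in> {1..n}"
      using permutes_orbit_subset[of \<pi>' "{1..n}" p] that by (auto simp: Stab_def)
    have "x \<circ> \<pi>' = x"
      using that(1) by (simp add: Stab_def)
    then have step: "x (\<pi>' c) = x c" for c
      by (metis comp_apply)
    have "x q = x p"
      using \<open>q \<in> orbit \<pi>' p\<close> by induction (simp_all only: step)
    then have "Min (orbit \<pi> q) = Min (orbit \<pi> p)"
      using q that(2) by (simp add: x_def)
    moreover have "Min (orbit \<pi> q) \<in> orbit \<pi> q" "Min (orbit \<pi> p) \<in> orbit \<pi> p"
      using fin[OF q] fin[OF that(2)] self by (auto intro!: Min_in)
    ultimately have "orbit \<pi> q = orbit \<pi> p"
      using orbit_eq_if_mem[OF perm] by metis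
    then show "q \<in> orbit \<pi> p"
      using self[of q] by simp
  qed
  have same_sub: "same \<subseteq> Stab"
  proof
    fix \<pi>' assume "\<pi>' \<in> same"
    then have \<pi>': "\<pi>' permutes {1..n}" "\<And>p. p \<in> {1..n} \<Longrightarrow> orbit \<pi> p = orbit \<pi>' p"
      by (auto simp: same_def)
    have "x (\<pi>' p) = x p" for p
    proof (cases "p \<in> {1..n}")
      case True
      have "\<pi>' p \<in> orbit \<pi> p"
        unfolding \<pi>'(2)[OF True] by (rule orbit.base)
      then have "orbit \<pi> (\<pi>' p) = orbit \<pi> p"
        by (rule orbit_eq_if_mem[OF perm])
      moreover have "\<pi>' p \<in> {1..n}"
        using \<open>\<pi>' p \<in> orbit \<pi> p\<close> sub[OF True] by blast
      ultimately show ?thesis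
        using True by (simp add: x_def)
    next
      case False
      then show ?thesis
        using permutes_not_in[OF \<pi>'(1)] by simp
    qed
    then show "\<pi>' \<in> Stab"
      using \<pi>'(1) by (simp add: Stab_def fun_eq_iff)
  qed
  have f_same: "f \<pi>' = f \<pi>" if "\<pi>' \<in> same" for \<pi>'
  proof -
    have \<pi>': "\<pi>' permutes {1..n}" "\<And>p. p \<in> {1..n} \<Longrightarrow> orbit \<pi> p = orbit \<pi>' p"
      using that by (auto simp: same_def)
    obtain h where "h permutes {1..n}" "\<pi>' = h \<circ> \<pi> \<circ> inv' h"
      using conjugate_if_same_orbits[OF less.prems \<pi>'] by blast
    then show ?thesis
      using assms(1) less.prems by (simp add: class_function_def)
  qed
  have f_other: "f \<pi>' = 0" if other: "\<pi>' \<in> Stab - same" for \<pi>'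
  proof -
    have \<pi>': "\<pi>' permutes {1..n}"
      using other by (simp add: Stab_def)
    have le: "card (orbit \<pi>' p) \<le> card (orbit \<pi> p)" if "p \<in> {1..n}" for p
      using orbit_le[of \<pi>' p] other that fin[OF that] by (intro card_mono) auto
    obtain p where p: "p \<in> {1..n}" "orbit \<pi> p \<noteq> orbit \<pi>' p"
      using other \<pi>' unfolding same_def by blast
    have "orbit \<pi>' p \<subset> orbit \<pi> p"
      using orbit_le[of \<pi>' p] other p by blast
    then have "card (orbit \<pi>' p) < card (orbit \<pi> p)"
      by (rule psubset_card_mono[OF fin[OF p(1)]])
    then have "(\<Sum>p\<in>{1..n}. card (orbit \<pi>' p)) < (\<Sum>p\<in>{1..n}. card (orbit \<pi> p))"
      using le p(1) by (intro sum_strict_mono_ex1) auto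
    then show ?thesis
      using less.hyps \<pi>' by blast
  qed
  have finS: "finite Stab"
    unfolding Stab_def by (rule finite_subset[OF _ finite_permutations[of "{1..n}"]]) auto
  \<comment> \<open>By induction only the members of \<open>same\<close> contribute, each with the
    value \<open>f \<pi>\<close>, and \<pi> itself is one of them; the stabilizer sum is a positive
    multiple of \<open>f \<pi>\<close>.\<close>
  have "(\<Sum>\<pi>'\<in>Stab. f \<pi>') = 0"
    unfolding Stab_def by (rule sum_over_stabilizer[OF assms(1) x assms(2)])
  also have "(\<Sum>\<pi>'\<in>Stab. f \<pi>') = (\<Sum>\<pi>'\<in>same. f \<pi>')"
    by (rule sum.mono_neutral_right[OF finS same_sub]) (use f_other in blast)
  also have "\<dots> = of_nat (card same) * f \<pi>"
    using f_same by simp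
  finally have "of_nat (card same) * f \<pi> = 0" .
  moreover have "\<pi> \<in> same"
    using less.prems by (simp add: same_def)
  then have "card same \<noteq> 0"
    using finite_subset[OF same_sub finS] by auto
  ultimately show "f \<pi> = 0"
    by simp
qed

section \<open>The character of a ribbon\<close>

text \<open>Burnside counting: the mean number of fixed words is the number of orbits on
  \<open>words n m\<close>, which is 1 if there are words at all. Since \<open>id\<close> has no
  descents, the other side counts sorted words, of which there is also exactly one.\<close>

lemma fine_char_trivial: "fine_char n (\<lambda>_. 1) {id}"
  unfolding fine_char_def
proof
  fix m
  let ?S = "{\<pi>. \<pi> permutes {1..n}}"
  have fin: "finite ?S"
    by (simp add: finite_permutations)
  have "Des n id = {}"
    by (auto simp: Des_def)
  then have compat: "compatible n (Des n id) x \<longleftrightarrow> (\<forall>j\<in>{1..n - 1}. x j \<le> x (j + 1))" for x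
    by (simp add: compatible_def)
  show "mean n (\<lambda>\<pi>. 1 * of_nat (card (fixed_words n m \<pi>))) =
      of_nat (\<Sum>b\<in>{id}. card {x \<in> words n m. compatible n (Des n b) x})"
  proof (cases "words n m = {}")
    case True
    then show ?thesis
      by (simp add: fixed_words_def mean_def)
  next
    case False
    then obtain x where x: "x \<in> words n m"
      by blast
    \<comment> \<open>Ranking by letters, with ties broken by position, gives the permutation that
      sorts \<open>x\<close>.\<close>
    define \<sigma> where "\<sigma> = standardize n id x"
    have \<sigma>: "\<sigma> permutes {1..n}"
      unfolding \<sigma>_def by (rule standardize_permutes[OF permutes_id])
    have y: "x \<circ> inv' \<sigma> \<in> words n m" "compatible n (Des n id) (x \<circ> inv' \<sigma>)"
    proof -
      show "x \<circ> inv' \<sigma> \<in> words n m"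
        using x permutes_inv[OF \<sigma>] by (rule words_comp_permutes)
      have "compatible n (Des n (id \<circ> inv' \<sigma>)) (x \<circ> inv' \<sigma>)"
        unfolding \<sigma>_def by (rule compatible_standardize[OF permutes_id])
      then show "compatible n (Des n id) (x \<circ> inv' \<sigma>)"
        unfolding compat by (simp add: compatible_def)
    qed
    then have "{x \<in> words n m. compatible n (Des n id) x} = {x \<circ> inv' \<sigma>}"
      using sorted_words_unique[of _ n m "x \<circ> inv' \<sigma>"] unfolding compat by blast
    then have rhs: "card {x \<in> words n m. compatible n (Des n id) x} = 1"
      by simp
    \<comment> \<open>Left multiplication by \<open>g\<close> carries the stabilizer of
      \<open>w\<close> to the set of permutations that take \<open>x\<close> to \<open>w\<close>; as
      \<open>w\<close> varies, these sets partition the group.\<close>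
    have stab: "card {\<pi> \<in> ?S. w \<circ> \<pi> = w} = card {\<pi> \<in> ?S. x \<circ> \<pi> = w}" if w: "w \<in> words n m" for w
    proof -
      obtain g where g: "g permutes {1..n}" "w = x \<circ> g"
        by (rule words_transitive[OF x w])
      have "bij_betw (\<lambda>\<pi>. g \<circ> \<pi>) {\<pi> \<in> ?S. w \<circ> \<pi> = w} {\<pi> \<in> ?S. x \<circ> \<pi> = w}"
      proof (rule bij_betw_byWitness[where f' = "\<lambda>\<pi>. inv' g \<circ> \<pi>"])
        have gg: "inv' g \<circ> (g \<circ> \<pi>) = \<pi>" "g \<circ> (inv' g \<circ> \<pi>) = \<pi>" for \<pi> :: "nat \<Rightarrow> nat"
          using permutes_inverses[OF g(1)] by (simp_all add: fun_eq_iff)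
        show "\<forall>\<pi>\<in>{\<pi> \<in> ?S. w \<circ> \<pi> = w}. inv' g \<circ> (g \<circ> \<pi>) = \<pi>"
          "\<forall>\<pi>\<in>{\<pi> \<in> ?S. x \<circ> \<pi> = w}. g \<circ> (inv' g \<circ> \<pi>) = \<pi>"
          by (simp_all only: gg simp_thms ball_simps)
        show "(\<circ>) g ` {\<pi> \<in> ?S. w \<circ> \<pi> = w} \<subseteq> {\<pi> \<in> ?S. x \<circ> \<pi> = w}"
          using g(1) by (auto simp: g(2) comp_assoc intro!: permutes_compose)
        show "(\<circ>) (inv' g) ` {\<pi> \<in> ?S. x \<circ> \<pi> = w} \<subseteq> {\<pi> \<in> ?S. w \<circ> \<pi> = w}"
        proof (rule image_subsetI)
          fix \<pi> assume \<pi>: "\<pi> \<in> {\<pi> \<in> ?S. x \<circ> \<pi> = w}"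
          have "w \<circ> (inv' g \<circ> \<pi>) = x \<circ> (g \<circ> (inv' g \<circ> \<pi>))"
            by (simp add: g(2) comp_assoc)
          also have "\<dots> = w"
            using \<pi> by (simp only: gg mem_Collect_eq)
          finally show "inv' g \<circ> \<pi> \<in> {\<pi> \<in> ?S. w \<circ> \<pi> = w}"
            using \<pi> permutes_compose[OF _ permutes_inv[OF g(1)]] by simp
        qed
      qed
      then show ?thesis
        by (rule bij_betw_same_card)
    qed
    have "(\<Sum>\<pi>\<in>?S. card (fixed_words n m \<pi>)) =
        (\<Sum>\<pi>\<in>?S. \<Sum>w\<in>words n m. if w \<circ> \<pi> = w then 1 else 0)"
      by (rule sum.cong[OF refl]) (simp add: fixed_words_def sum.If_cases Int_def)
    also have "\<dots> = (\<Sum>w\<in>words n m. \<Sum>\<pi>\<in>?S. if w \<circ> \<pi> = w then 1 else 0)"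
      by (rule sum.swap)
    also have "\<dots> = (\<Sum>w\<in>words n m. card {\<pi> \<in> ?S. w \<circ> \<pi> = w})"
      using fin by (simp add: sum.If_cases Int_def)
    also have "\<dots> = (\<Sum>w\<in>words n m. card {\<pi> \<in> ?S. x \<circ> \<pi> = w})"
      by (rule sum.cong[OF refl stab])
    also have "\<dots> = card ?S"
      unfolding card_eq_sum
      by (rule sum.group[OF fin finite_words]) (use x words_comp_permutes in blast)
    also have "\<dots> = fact n"
      by (subst card_permutations[of _ n]) simp_all
    finally have "(\<Sum>\<pi>\<in>?S. of_nat (card (fixed_words n m \<pi>)) :: complex) = fact n"
      by (metis of_nat_fact of_nat_sum)
    then have "mean n (\<lambda>\<pi>. 1 * of_nat (card (fixed_words n m \<pi>))) = 1"
      by (simp add: mean_def sym_group_def)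
    then show ?thesis
      using rhs by simp
  qed
qed

lemma class_function_fixed_words: "class_function n (\<lambda>\<pi>. of_nat (card (fixed_words n m \<pi>)))"
  unfolding class_function_def
proof (intro allI impI)
  fix \<pi> g assume \<pi>: "\<pi> permutes {1..n}" and g: "g permutes {1..n}"
  have "bij_betw (\<lambda>x. x \<circ> g) (fixed_words n m (g \<circ> \<pi> \<circ> inv' g)) (fixed_words n m \<pi>)"
  proof (rule bij_betw_byWitness[where f' = "\<lambda>x. x \<circ> inv' g"])
    have gg: "inv' g \<circ> g = id" "g \<circ> inv' g = id"
      using permutes_inv_o[OF g] by simp_all
    have cancel: "x \<circ> g \<circ> inv' g = x" "x \<circ> inv' g \<circ> g = x" for x :: "nat \<Rightarrow> nat"
      by (simp_all only: comp_assoc gg comp_id)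
    show "\<forall>x\<in>fixed_words n m (g \<circ> \<pi> \<circ> inv' g). x \<circ> g \<circ> inv' g = x"
      "\<forall>x\<in>fixed_words n m \<pi>. x \<circ> inv' g \<circ> g = x"
      using cancel by blast+
    show "(\<lambda>x. x \<circ> g) ` fixed_words n m (g \<circ> \<pi> \<circ> inv' g) \<subseteq> fixed_words n m \<pi>"
    proof (rule image_subsetI)
      fix x assume x: "x \<in> fixed_words n m (g \<circ> \<pi> \<circ> inv' g)"
      then have "x \<circ> g = x \<circ> (g \<circ> \<pi> \<circ> inv' g) \<circ> g"
        by (simp add: fixed_words_def)
      also have "\<dots> = x \<circ> g \<circ> \<pi>"
        by (simp only: comp_assoc gg comp_id)
      finally have "x \<circ> g \<circ> \<pi> = x \<circ> g"
        by (rule sym)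
      then show "x \<circ> g \<in> fixed_words n m \<pi>"
        using x words_comp_permutes[OF _ g] by (simp add: fixed_words_def)
    qed
    show "(\<lambda>x. x \<circ> inv' g) ` fixed_words n m \<pi> \<subseteq> fixed_words n m (g \<circ> \<pi> \<circ> inv' g)"
    proof (rule image_subsetI)
      fix x assume x: "x \<in> fixed_words n m \<pi>"
      have "x \<circ> inv' g \<circ> (g \<circ> \<pi> \<circ> inv' g) = x \<circ> inv' g \<circ> g \<circ> \<pi> \<circ> inv' g"
        by (simp only: comp_assoc)
      also have "\<dots> = x \<circ> \<pi> \<circ> inv' g"
        by (simp only: cancel)
      also have "\<dots> = x \<circ> inv' g"
        using x by (simp add: fixed_words_def)
      finally show "x \<circ> inv' g \<in> fixed_words n m (g \<circ> \<pi> \<circ> inv' g)"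
        using x words_comp_permutes[OF _ permutes_inv[OF g]] by (simp add: fixed_words_def)
    qed
  qed
  then have "card (fixed_words n m (g \<circ> \<pi> \<circ> inv' g)) = card (fixed_words n m \<pi>)"
    by (rule bij_betw_same_card)
  then show "of_nat (card (fixed_words n m (g \<circ> \<pi> \<circ> inv' g))) = (of_nat (card (fixed_words n m \<pi>)) :: complex)"
    by simp
qed

text \<open>
  The virtual character with the values \<open>\<Sum>\<^bsub>I \<subseteq> J\<^esub> (-1)\<^bsup>|J - I|\<^esup> 1\<up>\<close>, where the summand for
  \<open>I\<close> is induced from the Young subgroup of \<open>I\<close>; the alternating sum is left implicit in a
  recursion over \<open>J\<close>.
\<close>

lemma ribbon_class_function_exists:
  assumes "finite J"
  shows "\<exists>\<psi>. class_function n \<psi> \<and> (\<forall>\<chi> B m. fine_char n \<chi> B \<longrightarrow>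
    mean n (\<lambda>\<pi>. \<chi> \<pi> * \<psi> \<pi> * of_nat (card (fixed_words n m \<pi>))) =
    of_nat (\<Sum>b\<in>B. card {x \<in> words n m. pair_descents n b x = J}))"
  using assms
proof (induction J rule: finite_psubset_induct)
  case (psubset J)
  let ?\<Phi> = "\<lambda>I \<psi>. class_function n \<psi> \<and> (\<forall>\<chi> B m. fine_char n \<chi> B \<longrightarrow>
    mean n (\<lambda>\<pi>. \<chi> \<pi> * \<psi> \<pi> * of_nat (card (fixed_words n m \<pi>))) =
    of_nat (\<Sum>b\<in>B. card {x \<in> words n m. pair_descents n b x = I}))"
  let ?P = "Pow J - {J}"
  have "\<forall>I\<in>?P. \<exists>\<psi>. ?\<Phi> I \<psi>"
    using psubset.IH by blast
  then obtain \<Psi> where \<Psi>: "\<forall>I\<in>?P. ?\<Phi> I (\<Psi> I)"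
    by (rule bchoice[THEN exE])
  let ?\<phi> = "\<lambda>\<pi>. of_nat (card (fixed_words n (jump_content n J) \<pi>)) :: complex"
  define \<psi> where "\<psi> \<pi> = ?\<phi> \<pi> - (\<Sum>I\<in>?P. \<Psi> I \<pi>)" for \<pi>
  have "class_function n \<psi>"
    using \<Psi> class_function_fixed_words[of n "jump_content n J"]
    unfolding class_function_def \<psi>_def by simp
  moreover have "mean n (\<lambda>\<pi>. \<chi> \<pi> * \<psi> \<pi> * of_nat (card (fixed_words n m \<pi>))) =
      of_nat (\<Sum>b\<in>B. card {x \<in> words n m. pair_descents n b x = J})" if fine: "fine_char n \<chi> B" for \<chi> B m
  proof -
    let ?N = "\<lambda>I. \<Sum>b\<in>B. card {x \<in> words n m. pair_descents n b x = I}"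
    have split: "card {x \<in> words n m. pair_descents n b x \<subseteq> J} =
        card {x \<in> words n m. pair_descents n b x = J} +
        (\<Sum>I\<in>?P. card {x \<in> words n m. pair_descents n b x = I})" for b
    proof -
      have "card {x \<in> words n m. pair_descents n b x \<subseteq> J} =
          (\<Sum>I\<in>Pow J. card {x \<in> {x \<in> words n m. pair_descents n b x \<subseteq> J}. pair_descents n b x = I})"
        unfolding card_eq_sum using psubset.hyps by (intro sum.group[symmetric]) auto
      also have "\<dots> = (\<Sum>I\<in>Pow J. card {x \<in> words n m. pair_descents n b x = I})"
        by (rule sum.cong[OF refl]) (auto intro!: arg_cong[of _ _ card])
      also have "\<dots> = card {x \<in> words n m. pair_descents n b x = J} +
        (\<Sum>I\<in>?P. card {x \<in> words n m. pair_descents n b x = I})"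
        using psubset.hyps by (intro sum.remove) auto
      finally show ?thesis .
    qed
    have "mean n (\<lambda>\<pi>. \<chi> \<pi> * \<psi> \<pi> * of_nat (card (fixed_words n m \<pi>))) =
        mean n (\<lambda>\<pi>. \<chi> \<pi> * ?\<phi> \<pi> * of_nat (card (fixed_words n m \<pi>)) -
          (\<Sum>I\<in>?P. \<chi> \<pi> * \<Psi> I \<pi> * of_nat (card (fixed_words n m \<pi>))))"
      by (simp add: \<psi>_def algebra_simps sum_distrib_left sum_distrib_right)
    also have "\<dots> = of_nat (\<Sum>b\<in>B. card {x \<in> words n m. pair_descents n b x \<subseteq> J}) -
        (\<Sum>I\<in>?P. of_nat (?N I))"
      unfolding mean_diff mean_sum fine_char_times_fixed_words[OF fine]
      using \<Psi> fine by simp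
    also have "(\<Sum>b\<in>B. card {x \<in> words n m. pair_descents n b x \<subseteq> J}) = ?N J + (\<Sum>I\<in>?P. ?N I)"
      unfolding split sum.distrib by (simp only: sum.swap[of _ B])
    finally show ?thesis
      by simp
  qed
  ultimately show ?case
    by blast
qed

section \<open>Semistandard fillings of ribbons as words\<close>

text \<open>Every index of \<open>J\<close> up to \<open>i\<close> has moved the cell one row up,
  every other one a column to the right.\<close>

lemma ribbon_cell_eq:
  "ribbon_cell J i = (- int (card (J \<inter> {1..i})), int i - int (card (J \<inter> {1..i})))"
proof (induction i)
  case (Suc i)
  have "J \<inter> {1..Suc i} = (if Suc i \<in> J then insert (Suc i) (J \<inter> {1..i}) else J \<inter> {1..i})"
    by (auto simp: le_Suc_eq)
  then show ?case
    using Suc by simp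
qed simp

text \<open>Column minus row is a bijection from the cells of a ribbon to an interval.\<close>

lemma inj_ribbon_cell: "inj (ribbon_cell J)"
  by (rule injI) (simp add: ribbon_cell_eq)

text \<open>Two cells share a row iff no step between them is in \<open>J\<close>, and a column iff
  all of them are. Comparisons of neighbours therefore chain to comparisons within rows and
  columns.\<close>

lemma semistandard_ribbon_iff:
  "semistandard (ribbon n J) T \<longleftrightarrow>
    (\<forall>k. Suc k < n \<longrightarrow> (if Suc k \<in> J then T (ribbon_cell J (Suc k)) < T (ribbon_cell J k)
                      else T (ribbon_cell J k) \<le> T (ribbon_cell J (Suc k))))"
proof
  assume *: "semistandard (ribbon n J) T"
  have row: "T (r, c) \<le> T (r, c')" if "(r, c) \<in> ribbon n J" "(r, c') \<in> ribbon n J" "c < c'" for r c c'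
    using * that unfolding semistandard_def by blast
  have col: "T (r, c) < T (r', c)" if "(r, c) \<in> ribbon n J" "(r', c) \<in> ribbon n J" "r < r'" for r r' c
    using * that unfolding semistandard_def by blast
  show "\<forall>k. Suc k < n \<longrightarrow> (if Suc k \<in> J then T (ribbon_cell J (Suc k)) < T (ribbon_cell J k)
      else T (ribbon_cell J k) \<le> T (ribbon_cell J (Suc k)))"
  proof (intro allI impI)
    fix k assume k: "Suc k < n"
    obtain r c where rc: "ribbon_cell J k = (r, c)"
      by (cases "ribbon_cell J k")
    have mem: "ribbon_cell J k \<in> ribbon n J" "ribbon_cell J (Suc k) \<in> ribbon n J"
      using k by (auto simp: ribbon_def simp del: ribbon_cell.simps)
    show "if Suc k \<in> J then T (ribbon_cell J (Suc k)) < T (ribbon_cell J k)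
      else T (ribbon_cell J k) \<le> T (ribbon_cell J (Suc k))"
    proof (cases "Suc k \<in> J")
      case True
      then show ?thesis
        using mem rc col[of "r - 1" c r] by simp
    next
      case False
      then show ?thesis
        using mem rc row[of r c "c + 1"] by simp
    qed
  qed
next
  assume *: "\<forall>k. Suc k < n \<longrightarrow> (if Suc k \<in> J then T (ribbon_cell J (Suc k)) < T (ribbon_cell J k)
      else T (ribbon_cell J k) \<le> T (ribbon_cell J (Suc k)))"
  define t where "t k = T (ribbon_cell J k)" for k
  define a where "a k = card (J \<inter> {1..k})" for k
  have a_Suc: "a (Suc k) = a k + (if Suc k \<in> J then 1 else 0)" for k
  proof -
    have "J \<inter> {1..Suc k} = (if Suc k \<in> J then insert (Suc k) (J \<inter> {1..k}) else J \<inter> {1..k})"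
      by (auto simp: le_Suc_eq)
    then show ?thesis
      by (simp add: a_def)
  qed
  have t: "if Suc k \<in> J then t (Suc k) < t k else t k \<le> t (Suc k)" if "Suc k < n" for k
    using * that unfolding t_def by blast
  \<comment> \<open>The height \<open>a\<close> grows by 0 or 1 at each step. Extreme total growth
    between \<open>i\<close> and \<open>j\<close> thus forces the same kind of step
    throughout.\<close>
  have a_mono: "a i \<le> a j" if "i \<le> j" for i j
    using that by (induction j rule: dec_induct) (auto simp: a_Suc)
  have a_lip: "a j \<le> a i + (j - i)" if "i \<le> j" for i j
    using that by (induction j rule: dec_induct) (auto simp: a_Suc)
  have row: "t i \<le> t j" if "i \<le> j" "j < n" "a i = a j" for i j
    using that
  proof (induction j rule: dec_induct)
    case (step j)
    have "a i \<le> a j"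
      using step.hyps by (intro a_mono) simp
    then have "a i = a j" "Suc j \<notin> J"
      using step.prems a_Suc[of j] by (auto split: if_splits)
    then show ?case
      using step.IH step.prems t[of j] by simp
  qed simp
  have col: "t j < t i" if "i < j" "j < n" "a j = a i + (j - i)" for i j
  proof -
    \<comment> \<open>The induction starts at \<open>j = i\<close>, where the strict inequality
      fails; hence the case distinction.\<close>
    have chain: "j < n \<longrightarrow> a j = a i + (j - i) \<longrightarrow> (if j = i then t j = t i else t j < t i)" if "i \<le> j" for j
      using that
    proof (induction j rule: dec_induct)
      case (step j)
      show ?case
      proof (intro impI)
        assume **: "Suc j < n" "a (Suc j) = a i + (Suc j - i)"
        then have "a j = a i + (j - i)" "Suc j \<in> J"
          using step.hyps a_lip[of i j] a_Suc[of j] by (auto split: if_splits)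
        then show "if Suc j = i then t (Suc j) = t i else t (Suc j) < t i"
          using step.IH step.hyps ** t[of j] by (auto split: if_splits)
      qed
    qed simp
    show ?thesis
      using chain[OF less_imp_le[OF that(1)]] that by simp
  qed
  have cell: "ribbon_cell J i = (- int (a i), int i - int (a i))" for i
    by (simp add: ribbon_cell_eq a_def)
  have mem: "\<exists>i<n. r = - int (a i) \<and> c = int i - int (a i) \<and> T (r, c) = t i" if rc: "(r, c) \<in> ribbon n J" for r c
  proof -
    obtain i where i: "i < n" "(r, c) = ribbon_cell J i"
      using rc by (auto simp: ribbon_def)
    then have "T (r, c) = t i"
      by (simp add: t_def)
    then show ?thesis
      using i cell[of i] by (intro exI[of _ i]) simp
  qed
  show "semistandard (ribbon n J) T"
    unfolding semistandard_def
  proof (intro conjI allI impI; elim conjE)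
    fix r c c' :: int assume "(r, c) \<in> ribbon n J" "(r, c') \<in> ribbon n J" and less: "c < c'"
    then obtain i j where ij: "i < n" "r = - int (a i)" "c = int i - int (a i)" "T (r, c) = t i"
      "j < n" "r = - int (a j)" "c' = int j - int (a j)" "T (r, c') = t j"
      using mem[of r c] mem[of r c'] by blast
    then have "i \<le> j" "a i = a j"
      using less by auto
    then have "t i \<le> t j"
      using ij by (intro row)
    then show "T (r, c) \<le> T (r, c')"
      using ij by simp
  next
    fix r r' c :: int assume "(r, c) \<in> ribbon n J" "(r', c) \<in> ribbon n J" and less: "r < r'"
    then obtain j i where ij: "j < n" "r = - int (a j)" "c = int j - int (a j)" "T (r, c) = t j"
      "i < n" "r' = - int (a i)" "c = int i - int (a i)" "T (r', c) = t i"
      using mem[of r c] mem[of r' c] by blast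
    then have "i < j" "a j = a i + (j - i)"
      using less by auto
    then have "t j < t i"
      using ij by (intro col)
    then show "T (r, c) < T (r', c)"
      using ij by simp
  qed
qed

text \<open>Read along the labels, a filling must drop at each step up and must not drop at each
  step right, so \<open>J\<close> is exactly its descent set. With \<open>id\<close> as second
  component a tie is never a pair descent, and pair descents are ordinary descents.\<close>

lemma coeff_skew_schur_ribbon:
  assumes "J \<subseteq> {1..n - 1}"
  shows "mps_coeff (skew_schur (ribbon n J)) m = of_nat (card {x \<in> words n m. pair_descents n id x = J})"
proof -
  \<comment> \<open>Labels and positions of words start at 1, the indices of
    \<open>ribbon_cell\<close> at 0.\<close>
  define cell where "cell p = ribbon_cell J (p - 1)" for p
  define D where "D = ribbon n J"
  have img: "cell ` {1..n} = D"
  proof -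
    have "(\<lambda>p. p - 1) ` {1..n} = {..<n}"
      by (auto simp: image_iff intro!: bexI[of _ "Suc _"])
    then show ?thesis
      unfolding D_def ribbon_def cell_def by (metis image_image)
  qed
  have inj: "inj_on cell {1..n}"
    by (rule inj_onI) (use injD[OF inj_ribbon_cell[of J]] in \<open>fastforce simp: cell_def\<close>)
  define pos where "pos = inv_into {1..n} cell"
  have pos: "pos (cell p) = p" if "p \<in> {1..n}" for p
    unfolding pos_def using inj that by (rule inv_into_f_f)
  have pos_mem: "pos d \<in> {1..n}" "cell (pos d) = d" if "d \<in> D" for d
    using inv_into_into[of d cell "{1..n}"] f_inv_into_f[of d cell "{1..n}"] that img
    by (simp_all only: pos_def)
  have cell_mem: "cell p \<in> D" if "p \<in> {1..n}" for p
    using img that by blast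
  have content: "monomial_of D T = monomial_of {1..n} (\<lambda>p. T (cell p))" for T
    using sum.reindex[OF inj, of "\<lambda>d. Poly_Mapping.single (T d) (1 :: nat)"]
    by (simp only: img comp_def monomial_of_def)
  have semi: "semistandard D T \<longleftrightarrow> pair_descents n id x = J"
    if x: "\<And>p. p \<in> {1..n} \<Longrightarrow> x p = T (cell p)" for T x
  proof -
    have "semistandard D T \<longleftrightarrow> (\<forall>p\<in>{1..n - 1}. if p \<in> J then x (p + 1) < x p else x p \<le> x (p + 1))"
    proof -
      have "x (Suc k) = T (ribbon_cell J k)" if "k < n" for k
        using x[of "Suc k"] that by (simp add: cell_def)
      moreover have "{1..n - 1} = Suc ` {..<n - 1}"
        by (simp add: image_Suc_lessThan)
      ultimately show ?thesis
        unfolding D_def semistandard_ribbon_iff by (auto simp del: ribbon_cell.simps)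
    qed
    also have "\<dots> \<longleftrightarrow> (\<forall>p\<in>{1..n - 1}. p \<in> J \<longleftrightarrow> x (p + 1) < x p)"
      by (intro ball_cong refl) (simp add: not_less)
    also have "\<dots> \<longleftrightarrow> {p \<in> {1..n - 1}. x (p + 1) < x p} = J"
      using assms by blast
    also have "{p \<in> {1..n - 1}. x (p + 1) < x p} = pair_descents n id x"
      by (auto simp: pair_descents_def)
    finally show ?thesis .
  qed
  have "card {T \<in> D \<rightarrow>\<^sub>E UNIV. semistandard D T \<and> monomial_of D T = m} =
      card {x \<in> words n m. pair_descents n id x = J}"
  proof (rule bij_betw_same_card)
    let ?f = "\<lambda>T. \<lambda>p\<in>{1..n}. T (cell p)" and ?g = "\<lambda>x. \<lambda>d\<in>D. x (pos d)"
    show "bij_betw ?f {T \<in> D \<rightarrow>\<^sub>E UNIV. semistandard D T \<and> monomial_of D T = m}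
        {x \<in> words n m. pair_descents n id x = J}"
    proof (rule bij_betw_byWitness[where f' = ?g])
      show "\<forall>T\<in>{T \<in> D \<rightarrow>\<^sub>E UNIV. semistandard D T \<and> monomial_of D T = m}. ?g (?f T) = T"
      proof
        fix T assume T: "T \<in> {T \<in> D \<rightarrow>\<^sub>E UNIV. semistandard D T \<and> monomial_of D T = m}"
        then have "T \<in> D \<rightarrow>\<^sub>E UNIV"
          by blast
        then show "?g (?f T) = T"
          using pos_mem PiE_arb[of T D] by (auto simp: fun_eq_iff restrict_def)
      qed
      show "\<forall>x\<in>{x \<in> words n m. pair_descents n id x = J}. ?f (?g x) = x"
      proof
        fix x assume x: "x \<in> {x \<in> words n m. pair_descents n id x = J}"
        then have "x \<in> {1..n} \<rightarrow>\<^sub>E UNIV"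
          by (simp add: words_def)
        then show "?f (?g x) = x"
          using pos cell_mem PiE_arb[of x "{1..n}"] by (auto simp: fun_eq_iff restrict_def)
      qed
      show "?f ` {T \<in> D \<rightarrow>\<^sub>E UNIV. semistandard D T \<and> monomial_of D T = m} \<subseteq>
          {x \<in> words n m. pair_descents n id x = J}"
      proof (rule image_subsetI)
        fix T assume T: "T \<in> {T \<in> D \<rightarrow>\<^sub>E UNIV. semistandard D T \<and> monomial_of D T = m}"
        then show "?f T \<in> {x \<in> words n m. pair_descents n id x = J}"
          using semi[of "?f T" T] by (simp add: words_def content)
      qed
      show "?g ` {x \<in> words n m. pair_descents n id x = J} \<subseteq>
          {T \<in> D \<rightarrow>\<^sub>E UNIV. semistandard D T \<and> monomial_of D T = m}"
      proof (rule image_subsetI)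
        fix x assume x: "x \<in> {x \<in> words n m. pair_descents n id x = J}"
        have eq: "x p = ?g x (cell p)" if "p \<in> {1..n}" for p
          using pos[OF that] cell_mem[OF that] by simp
        have "semistandard D (?g x)"
          using semi[of x "?g x"] eq x by blast
        moreover have "monomial_of D (?g x) = m"
          using monomial_of_cong[of "{1..n}" x "\<lambda>p. ?g x (cell p)"] eq x
          unfolding content words_def by simp
        ultimately show "?g x \<in> {T \<in> D \<rightarrow>\<^sub>E UNIV. semistandard D T \<and> monomial_of D T = m}"
          by simp
      qed
    qed
  qed
  then show ?thesis
    by (simp add: skew_schur_def generating_series_def D_def)
qed

section \<open>Characters of tensor products and induced representations\<close>

text \<open>The degree hidden behind the existential quantifier of \<open>representation\<close> is
  read off from the identity matrix, as in \<open>induced_rep\<close>.\<close>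

lemma
  assumes "representation G \<rho>"
  defines "d \<equiv> dim_row (\<rho> \<one>\<^bsub>G\<^esub>)"
  shows representation_carrier_mat: "g \<in> carrier G \<Longrightarrow> \<rho> g \<in> carrier_mat d d"
    and representation_one: "\<rho> \<one>\<^bsub>G\<^esub> = 1\<^sub>m d"
    and representation_mult: "g \<in> carrier G \<Longrightarrow> h \<in> carrier G \<Longrightarrow> \<rho> (g \<otimes>\<^bsub>G\<^esub> h) = \<rho> g * \<rho> h"
proof -
  obtain e where e: "\<forall>g\<in>carrier G. \<rho> g \<in> carrier_mat e e" "\<rho> \<one>\<^bsub>G\<^esub> = 1\<^sub>m e"
    "\<forall>g\<in>carrier G. \<forall>h\<in>carrier G. \<rho> (g \<otimes>\<^bsub>G\<^esub> h) = \<rho> g * \<rho> h"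
    using assms(1) unfolding representation_def by blast
  have "d = e"
    by (simp add: d_def e(2))
  with e show "g \<in> carrier G \<Longrightarrow> \<rho> g \<in> carrier_mat d d" "\<rho> \<one>\<^bsub>G\<^esub> = 1\<^sub>m d"
    "g \<in> carrier G \<Longrightarrow> h \<in> carrier G \<Longrightarrow> \<rho> (g \<otimes>\<^bsub>G\<^esub> h) = \<rho> g * \<rho> h"
    by blast+
qed

lemma mat_mult_entry:
  assumes "A \<in> carrier_mat a b" "B \<in> carrier_mat b c" "i < a" "j < c"
  shows "(A * B) $$ (i, j) = (\<Sum>k<b. A $$ (i, k) * B $$ (k, j))"
  using assms by (simp add: scalar_prod_def lessThan_atLeast0)

text \<open>Tensor and induced matrices encode a pair of indices by quotient and remainder; this
  decodes sums over such indices.\<close>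

lemma sum_div_mod:
  fixes f :: "nat \<Rightarrow> nat \<Rightarrow> 'a::comm_monoid_add"
  shows "(\<Sum>k<a * b. f (k div b) (k mod b)) = (\<Sum>i<a. \<Sum>j<b. f i j)"
proof -
  have "(\<Sum>k<a * b. f (k div b) (k mod b)) = (\<Sum>(i, j)\<in>{..<a} \<times> {..<b}. f i j)"
  proof (rule sum.reindex_bij_witness[of _ "\<lambda>(i, j). i * b + j" "\<lambda>k. (k div b, k mod b)"])
    fix k assume "k \<in> {..<a * b}"
    then have k: "k < a * b"
      by simp
    then have "b > 0"
      by (cases b) auto
    then show "(k div b, k mod b) \<in> {..<a} \<times> {..<b}"
      using less_mult_imp_div_less[OF k] by simp
  next
    fix p assume "p \<in> {..<a} \<times> {..<b}"
    then obtain i j where ij: "p = (i, j)" "i < a" "j < b"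
      by auto
    have "i * b + j < Suc i * b"
      using ij by simp
    also have "\<dots> \<le> a * b"
      using ij by (intro mult_le_mono1) simp
    finally show "(case p of (i, j) \<Rightarrow> i * b + j) \<in> {..<a * b}"
      using ij by simp
    show "((case p of (i, j) \<Rightarrow> i * b + j) div b, (case p of (i, j) \<Rightarrow> i * b + j) mod b) = p"
      using ij by simp
  qed auto
  then show ?thesis
    by (simp add: sum.cartesian_product)
qed

lemma div_mod_less:
  fixes i :: nat
  assumes "i < a * b"
  shows "i div b < a" "i mod b < b"
  using less_mult_imp_div_less[OF assms] assms by (cases b; simp)+

text \<open>Symmetry of the trace, from which characters inherit invariance under
  conjugation.\<close>

lemma sum_diagonal_mult_commute:
  fixes A B :: "'a::comm_ring_1 mat"
  assumes "A \<in> carrier_mat d d" "B \<in> carrier_mat d d"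
  shows "(\<Sum>i<d. (A * B) $$ (i, i)) = (\<Sum>i<d. (B * A) $$ (i, i))"
proof -
  have "(\<Sum>i<d. (A * B) $$ (i, i)) = (\<Sum>i<d. \<Sum>k<d. A $$ (i, k) * B $$ (k, i))"
    using assms by (intro sum.cong refl mat_mult_entry) auto
  also have "\<dots> = (\<Sum>k<d. \<Sum>i<d. B $$ (k, i) * A $$ (i, k))"
    by (subst sum.swap) (intro sum.cong refl mult.commute)
  also have "\<dots> = (\<Sum>k<d. (B * A) $$ (k, k))"
    using assms by (intro sum.cong refl mat_mult_entry[symmetric]) auto
  finally show ?thesis .
qed

lemma character_conjugate:
  assumes "group G" "representation G \<rho>" "x \<in> carrier G" "g \<in> carrier G"
  shows "character \<rho> (g \<otimes>\<^bsub>G\<^esub> x \<otimes>\<^bsub>G\<^esub> inv\<^bsub>G\<^esub> g) = character \<rho> x"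
proof -
  interpret group G
    by (rule assms(1))
  define d where "d = dim_row (\<rho> \<one>\<^bsub>G\<^esub>)"
  note d = representation_carrier_mat[OF assms(2), folded d_def] representation_one[OF assms(2), folded d_def]
    representation_mult[OF assms(2)]
  have char: "character \<rho> y = (\<Sum>i<d. \<rho> y $$ (i, i))" if "y \<in> carrier G" for y
    using d(1)[OF that] by (simp add: character_def)
  have "character \<rho> (g \<otimes>\<^bsub>G\<^esub> x \<otimes>\<^bsub>G\<^esub> inv\<^bsub>G\<^esub> g) = (\<Sum>i<d. (\<rho> (g \<otimes>\<^bsub>G\<^esub> x) * \<rho> (inv\<^bsub>G\<^esub> g)) $$ (i, i))"
    using assms(3,4) by (simp add: char d(3))
  also have "\<dots> = (\<Sum>i<d. (\<rho> (inv\<^bsub>G\<^esub> g) * \<rho> (g \<otimes>\<^bsub>G\<^esub> x)) $$ (i, i))"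
    using assms(3,4) by (intro sum_diagonal_mult_commute d(1)) auto
  also have "\<dots> = (\<Sum>i<d. \<rho> (inv\<^bsub>G\<^esub> g \<otimes>\<^bsub>G\<^esub> (g \<otimes>\<^bsub>G\<^esub> x)) $$ (i, i))"
    using assms(3,4) by (simp add: d(3))
  also have "inv\<^bsub>G\<^esub> g \<otimes>\<^bsub>G\<^esub> (g \<otimes>\<^bsub>G\<^esub> x) = x"
    using assms(3,4) by (simp add: m_assoc[symmetric])
  finally show ?thesis
    using assms(3) by (simp add: char)
qed

lemma class_function_character:
  assumes "representation (sym_group n) \<rho>"
  shows "class_function n (character \<rho>)"
  unfolding class_function_def
proof (intro allI impI)
  fix \<pi> g assume "\<pi> permutes {1..n}" "g permutes {1..n}"
  then have mem: "\<pi> \<in> carrier (sym_group n)" "g \<in> carrier (sym_group n)"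
    by (simp_all only: sym_group_carrier)
  show "character \<rho> (g \<circ> \<pi> \<circ> inv' g) = character \<rho> \<pi>"
    using character_conjugate[OF sym_group_is_group assms mem]
    by (simp only: sym_group_mult sym_group_inv_equality[OF mem(2)])
qed

text \<open>The mixed product rule for Kronecker products: once the summation index is split, the
  sum factors into one entry of each matrix product.\<close>

lemma tensor_rep_representation:
  assumes "group G" "representation G \<rho>" "representation G \<sigma>"
  shows "representation G (tensor_rep \<rho> \<sigma>)"
proof -
  interpret group G
    by (rule assms(1))
  define d where "d = dim_row (\<rho> \<one>\<^bsub>G\<^esub>)"
  note d = representation_carrier_mat[OF assms(2), folded d_def] representation_one[OF assms(2), folded d_def]
    representation_mult[OF assms(2)]
  define e where "e = dim_row (\<sigma> \<one>\<^bsub>G\<^esub>)"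
  note e = representation_carrier_mat[OF assms(3), folded e_def] representation_one[OF assms(3), folded e_def]
    representation_mult[OF assms(3)]
  have T: "tensor_rep \<rho> \<sigma> g = mat (d * e) (d * e)
      (\<lambda>(i, j). \<rho> g $$ (i div e, j div e) * \<sigma> g $$ (i mod e, j mod e))" if "g \<in> carrier G" for g
    using d(1)[OF that] e(1)[OF that] by (simp add: tensor_rep_def Let_def)
  have carrier: "tensor_rep \<rho> \<sigma> g \<in> carrier_mat (d * e) (d * e)" if "g \<in> carrier G" for g
    by (simp add: T[OF that])
  have one: "tensor_rep \<rho> \<sigma> \<one>\<^bsub>G\<^esub> = 1\<^sub>m (d * e)"
  proof (rule eq_matI)
    fix i j assume "i < dim_row (1\<^sub>m (d * e) :: complex mat)" "j < dim_col (1\<^sub>m (d * e) :: complex mat)"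
    then have ij: "i < d * e" "j < d * e"
      by simp_all
    have "i = j \<longleftrightarrow> i div e = j div e \<and> i mod e = j mod e"
      by (metis div_mult_mod_eq)
    then show "tensor_rep \<rho> \<sigma> \<one>\<^bsub>G\<^esub> $$ (i, j) = 1\<^sub>m (d * e) $$ (i, j)"
      using ij div_mod_less[OF ij(1)] div_mod_less[OF ij(2)] by (simp add: T d(2) e(2))
  qed (simp_all add: T)
  have mult: "tensor_rep \<rho> \<sigma> (g \<otimes>\<^bsub>G\<^esub> h) = tensor_rep \<rho> \<sigma> g * tensor_rep \<rho> \<sigma> h"
    if gh: "g \<in> carrier G" "h \<in> carrier G" for g h
  proof (rule eq_matI)
    fix i j assume "i < dim_row (tensor_rep \<rho> \<sigma> g * tensor_rep \<rho> \<sigma> h)"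
      "j < dim_col (tensor_rep \<rho> \<sigma> g * tensor_rep \<rho> \<sigma> h)"
    then have ij: "i < d * e" "j < d * e"
      using carrier[OF gh(1)] carrier[OF gh(2)] by simp_all
    note less = div_mod_less[OF ij(1)] div_mod_less[OF ij(2)]
    let ?f = "\<lambda>a b. \<rho> g $$ (i div e, a) * \<sigma> g $$ (i mod e, b) * (\<rho> h $$ (a, j div e) * \<sigma> h $$ (b, j mod e))"
    have "(tensor_rep \<rho> \<sigma> g * tensor_rep \<rho> \<sigma> h) $$ (i, j) =
        (\<Sum>k<d * e. tensor_rep \<rho> \<sigma> g $$ (i, k) * tensor_rep \<rho> \<sigma> h $$ (k, j))"
      by (rule mat_mult_entry[OF carrier[OF gh(1)] carrier[OF gh(2)] ij])
    also have "\<dots> = (\<Sum>k<d * e. ?f (k div e) (k mod e))"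
      using ij by (intro sum.cong refl) (simp add: T gh)
    also have "\<dots> = (\<Sum>a<d. \<Sum>b<e. ?f a b)"
      by (rule sum_div_mod)
    also have "\<dots> = (\<Sum>a<d. \<rho> g $$ (i div e, a) * \<rho> h $$ (a, j div e)) *
        (\<Sum>b<e. \<sigma> g $$ (i mod e, b) * \<sigma> h $$ (b, j mod e))"
      unfolding sum_product by (intro sum.cong refl) (simp only: mult_ac)
    also have "\<dots> = (\<rho> g * \<rho> h) $$ (i div e, j div e) * (\<sigma> g * \<sigma> h) $$ (i mod e, j mod e)"
      unfolding mat_mult_entry[OF d(1)[OF gh(1)] d(1)[OF gh(2)] less(1,3)]
        mat_mult_entry[OF e(1)[OF gh(1)] e(1)[OF gh(2)] less(2,4)] ..
    also have "\<dots> = tensor_rep \<rho> \<sigma> (g \<otimes>\<^bsub>G\<^esub> h) $$ (i, j)"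
      using ij by (simp add: T gh d(3) e(3))
    finally show "tensor_rep \<rho> \<sigma> (g \<otimes>\<^bsub>G\<^esub> h) $$ (i, j) = (tensor_rep \<rho> \<sigma> g * tensor_rep \<rho> \<sigma> h) $$ (i, j)"
      by (rule sym)
  qed (simp_all add: T gh)
  show ?thesis
    unfolding representation_def using carrier one mult by blast
qed

lemma character_tensor_rep:
  assumes "representation G \<rho>" "representation G \<sigma>" "g \<in> carrier G"
  shows "character (tensor_rep \<rho> \<sigma>) g = character \<rho> g * character \<sigma> g"
proof -
  obtain d where d: "\<rho> g \<in> carrier_mat d d"
    using representation_carrier_mat[OF assms(1,3)] by blast
  obtain e where e: "\<sigma> g \<in> carrier_mat e e"
    using representation_carrier_mat[OF assms(2,3)] by blast
  have "character (tensor_rep \<rho> \<sigma>) g =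
      (\<Sum>i<d * e. \<rho> g $$ (i div e, i div e) * \<sigma> g $$ (i mod e, i mod e))"
    using d e by (simp add: character_def tensor_rep_def Let_def)
  also have "\<dots> = (\<Sum>i<d. \<Sum>j<e. \<rho> g $$ (i, i) * \<sigma> g $$ (j, j))"
    by (rule sum_div_mod)
  also have "\<dots> = character \<rho> g * character \<sigma> g"
    using d e by (simp add: character_def sum_product)
  finally show ?thesis .
qed

section \<open>Induced representations\<close>

lemma mem_l_coset_iff:
  assumes "group G" "H \<subseteq> carrier G" "t \<in> carrier G" "x \<in> carrier G"
  shows "x \<in> t <#\<^bsub>G\<^esub> H \<longleftrightarrow> inv\<^bsub>G\<^esub> t \<otimes>\<^bsub>G\<^esub> x \<in> H"
proof -
  interpret group G
    by (rule assms(1))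
  show ?thesis
  proof
    assume "x \<in> t <#\<^bsub>G\<^esub> H"
    then obtain h where h: "h \<in> H" "x = t \<otimes>\<^bsub>G\<^esub> h"
      by (auto simp: l_coset_def)
    then have "inv\<^bsub>G\<^esub> t \<otimes>\<^bsub>G\<^esub> x = h"
      using assms(2,3) by (auto simp: m_assoc[symmetric])
    then show "inv\<^bsub>G\<^esub> t \<otimes>\<^bsub>G\<^esub> x \<in> H"
      using h by simp
  next
    assume "inv\<^bsub>G\<^esub> t \<otimes>\<^bsub>G\<^esub> x \<in> H"
    moreover have "x = t \<otimes>\<^bsub>G\<^esub> (inv\<^bsub>G\<^esub> t \<otimes>\<^bsub>G\<^esub> x)"
      using assms(3,4) by (simp add: m_assoc[symmetric])
    ultimately show "x \<in> t <#\<^bsub>G\<^esub> H"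
      unfolding l_coset_def by blast
  qed
qed

text \<open>For \<open>x\<close> the product of \<open>g\<close> and \<open>ts ! l\<close>, the
  index is the row of the only block in block column \<open>l\<close> of the induced matrix whose
  argument lies in \<open>H\<close>.\<close>

lemma left_transversal_unique_index:
  assumes "group G" "H \<subseteq> carrier G" "left_transversal G H ts" "x \<in> carrier G"
  obtains m where "m < length ts" "inv\<^bsub>G\<^esub> (ts ! m) \<otimes>\<^bsub>G\<^esub> x \<in> H"
    "\<And>k. k < length ts \<Longrightarrow> inv\<^bsub>G\<^esub> (ts ! k) \<otimes>\<^bsub>G\<^esub> x \<in> H \<Longrightarrow> k = m"
proof -
  have ts: "distinct ts" "set ts \<subseteq> carrier G" "\<exists>!t. t \<in> set ts \<and> x \<in> t <#\<^bsub>G\<^esub> H"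
    using assms(3,4) unfolding left_transversal_def by blast+
  have iff: "x \<in> t <#\<^bsub>G\<^esub> H \<longleftrightarrow> inv\<^bsub>G\<^esub> t \<otimes>\<^bsub>G\<^esub> x \<in> H" if "t \<in> set ts" for t
    using that ts(2) assms(4) by (intro mem_l_coset_iff[OF assms(1,2)]) auto
  obtain t where t: "t \<in> set ts" "inv\<^bsub>G\<^esub> t \<otimes>\<^bsub>G\<^esub> x \<in> H"
    "\<And>s. s \<in> set ts \<Longrightarrow> inv\<^bsub>G\<^esub> s \<otimes>\<^bsub>G\<^esub> x \<in> H \<Longrightarrow> s = t"
    using ts(3) iff by metis
  obtain m where m: "m < length ts" "ts ! m = t"
    using t(1) by (auto simp: in_set_conv_nth)
  show thesis
  proof (rule that)
    show "m < length ts" "inv\<^bsub>G\<^esub> (ts ! m) \<otimes>\<^bsub>G\<^esub> x \<in> H"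
      using m t(2) by simp_all
    show "k = m" if "k < length ts" "inv\<^bsub>G\<^esub> (ts ! k) \<otimes>\<^bsub>G\<^esub> x \<in> H" for k
      using t(3)[of "ts ! k"] that m ts(1) by (simp add: nth_eq_iff_index_eq[symmetric])
  qed
qed

text \<open>In block column \<open>l\<close> of the matrix of \<open>h\<close> only one block, in
  row \<open>m\<close>, has its argument in \<open>H\<close>, so the sum over blocks collapses to
  \<open>m\<close>. There the arguments multiply to that of the product; since the second one is in
  \<open>H\<close>, the first is in \<open>H\<close> iff their product is, and the zero blocks agree
  too.\<close>

lemma induced_rep_representation:
  assumes "group G" "subgroup H G" "left_transversal G H ts" "representation (G\<lparr>carrier := H\<rparr>) \<rho>"
  shows "representation G (induced_rep G H ts \<rho>)"
proof -
  interpret group G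
    by (rule assms(1))
  have H: "H \<subseteq> carrier G"
    using assms(2) by (rule subgroup.subset)
  define d where "d = dim_row (\<rho> \<one>\<^bsub>G\<^esub>)"
  have eqs: "carrier (G\<lparr>carrier := H\<rparr>) = H" "\<one>\<^bsub>G\<lparr>carrier := H\<rparr>\<^esub> = \<one>\<^bsub>G\<^esub>"
    "mult (G\<lparr>carrier := H\<rparr>) = mult G"
    by simp_all
  note d = representation_carrier_mat[OF assms(4), unfolded eqs, folded d_def]
    representation_one[OF assms(4), unfolded eqs, folded d_def]
    representation_mult[OF assms(4), unfolded eqs]
  define N where "N = length ts * d"
  define c where "c k g l = inv\<^bsub>G\<^esub> (ts ! k) \<otimes>\<^bsub>G\<^esub> g \<otimes>\<^bsub>G\<^esub> ts ! l" for k g l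
  have ts: "ts ! k \<in> carrier G" if "k < length ts" for k
    using that assms(3) nth_mem unfolding left_transversal_def by blast
  have c: "c k g l \<in> carrier G" if "k < length ts" "g \<in> carrier G" "l < length ts" for k g l
    using ts that by (simp add: c_def)
  have I: "induced_rep G H ts \<rho> g = mat N N
      (\<lambda>(i, j). if c (i div d) g (j div d) \<in> H then \<rho> (c (i div d) g (j div d)) $$ (i mod d, j mod d) else 0)" for g
    by (simp add: induced_rep_def Let_def d(2) N_def c_def cong: if_cong)
  have carrier: "induced_rep G H ts \<rho> g \<in> carrier_mat N N" for g
    by (simp add: I)
  have one: "induced_rep G H ts \<rho> \<one>\<^bsub>G\<^esub> = 1\<^sub>m N"
  proof (rule eq_matI)
    fix i j assume "i < dim_row (1\<^sub>m N :: complex mat)" "j < dim_col (1\<^sub>m N :: complex mat)"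
    then have ij: "i < length ts * d" "j < length ts * d"
      by (simp_all add: N_def)
    note less = div_mod_less[OF ij(1)] div_mod_less[OF ij(2)]
    have c_one: "c k \<one>\<^bsub>G\<^esub> l = inv\<^bsub>G\<^esub> (ts ! k) \<otimes>\<^bsub>G\<^esub> ts ! l" if "k < length ts" "l < length ts" for k l
      using ts that by (simp add: c_def)
    have diag: "c l \<one>\<^bsub>G\<^esub> l = \<one>\<^bsub>G\<^esub>" if "l < length ts" for l
      using ts that by (simp add: c_def)
    obtain m where m: "m < length ts" "inv\<^bsub>G\<^esub> (ts ! m) \<otimes>\<^bsub>G\<^esub> ts ! (j div d) \<in> H"
      "\<And>k. k < length ts \<Longrightarrow> inv\<^bsub>G\<^esub> (ts ! k) \<otimes>\<^bsub>G\<^esub> ts ! (j div d) \<in> H \<Longrightarrow> k = m"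
      by (rule left_transversal_unique_index[OF assms(1) H assms(3) ts[OF less(3)]]) blast
    \<comment> \<open>The identity lies in \<open>H\<close>, so an element of the transversal
      represents its own coset.\<close>
    have "j div d = m"
      using m(3)[OF less(3)] ts[OF less(3)] subgroup.one_closed[OF assms(2)] by simp
    then have mem: "c (i div d) \<one>\<^bsub>G\<^esub> (j div d) \<in> H \<longleftrightarrow> i div d = j div d"
      using m(2,3) less c_one by metis
    have "i = j \<longleftrightarrow> i div d = j div d \<and> i mod d = j mod d"
      by (metis div_mult_mod_eq)
    then show "induced_rep G H ts \<rho> \<one>\<^bsub>G\<^esub> $$ (i, j) = 1\<^sub>m N $$ (i, j)"
      using ij less mem diag[OF less(3)] by (simp add: I N_def d(2))
  qed (simp_all add: I)
  have mult: "induced_rep G H ts \<rho> (g \<otimes>\<^bsub>G\<^esub> h) = induced_rep G H ts \<rho> g * induced_rep G H ts \<rho> h"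
    if gh: "g \<in> carrier G" "h \<in> carrier G" for g h
  proof (rule eq_matI)
    fix i j assume "i < dim_row (induced_rep G H ts \<rho> g * induced_rep G H ts \<rho> h)"
      "j < dim_col (induced_rep G H ts \<rho> g * induced_rep G H ts \<rho> h)"
    then have ijN: "i < N" "j < N"
      by (simp_all add: I)
    then have ij: "i < length ts * d" "j < length ts * d"
      by (simp_all add: N_def)
    note less = div_mod_less[OF ij(1)] div_mod_less[OF ij(2)]
    define k l where "k = i div d" and "l = j div d"
    have kl: "k < length ts" "l < length ts"
      using less by (simp_all add: k_def l_def)
    let ?f = "\<lambda>m a. (if c k g m \<in> H then \<rho> (c k g m) $$ (i mod d, a) else 0) *
      (if c m h l \<in> H then \<rho> (c m h l) $$ (a, j mod d) else 0)"
    have c_assoc: "c m h l = inv\<^bsub>G\<^esub> (ts ! m) \<otimes>\<^bsub>G\<^esub> (h \<otimes>\<^bsub>G\<^esub> ts ! l)" if "m < length ts" for m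
      using ts that kl gh by (simp add: c_def m_assoc)
    have "h \<otimes>\<^bsub>G\<^esub> ts ! l \<in> carrier G"
      using ts kl gh by simp
    then obtain m where m: "m < length ts" "inv\<^bsub>G\<^esub> (ts ! m) \<otimes>\<^bsub>G\<^esub> (h \<otimes>\<^bsub>G\<^esub> ts ! l) \<in> H"
      "\<And>k. k < length ts \<Longrightarrow> inv\<^bsub>G\<^esub> (ts ! k) \<otimes>\<^bsub>G\<^esub> (h \<otimes>\<^bsub>G\<^esub> ts ! l) \<in> H \<Longrightarrow> k = m"
      by (rule left_transversal_unique_index[OF assms(1) H assms(3)]) blast
    have mH: "c m h l \<in> H"
      using m(2) unfolding c_assoc[OF m(1)] .
    have m_unique: "m' = m" if "m' < length ts" "c m' h l \<in> H" for m'
      using m(3)[OF that(1)] that(2) unfolding c_assoc[OF that(1)] .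
    have c_mult: "c k (g \<otimes>\<^bsub>G\<^esub> h) l = c k g m \<otimes>\<^bsub>G\<^esub> c m h l"
    proof -
      have "ts ! m \<otimes>\<^bsub>G\<^esub> (inv\<^bsub>G\<^esub> (ts ! m) \<otimes>\<^bsub>G\<^esub> z) = z" if "z \<in> carrier G" for z
        using ts[OF m(1)] that by (simp add: m_assoc[symmetric])
      then show ?thesis
        using ts kl m(1) gh by (simp add: c_def m_assoc)
    qed
    have mem: "c k g m \<in> H \<longleftrightarrow> c k (g \<otimes>\<^bsub>G\<^esub> h) l \<in> H"
    proof
      assume "c k g m \<in> H"
      then show "c k (g \<otimes>\<^bsub>G\<^esub> h) l \<in> H"
        unfolding c_mult using mH by (rule subgroup.m_closed[OF assms(2)])
    next
      assume "c k (g \<otimes>\<^bsub>G\<^esub> h) l \<in> H"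
      then have "c k (g \<otimes>\<^bsub>G\<^esub> h) l \<otimes>\<^bsub>G\<^esub> inv\<^bsub>G\<^esub> (c m h l) \<in> H"
        using subgroup.m_inv_closed[OF assms(2) mH] by (rule subgroup.m_closed[OF assms(2)])
      then show "c k g m \<in> H"
        using c[OF kl(1) gh(1) m(1)] c[OF m(1) gh(2) kl(2)] by (simp add: c_mult m_assoc)
    qed
    have "(induced_rep G H ts \<rho> g * induced_rep G H ts \<rho> h) $$ (i, j) =
        (\<Sum>k<N. induced_rep G H ts \<rho> g $$ (i, k) * induced_rep G H ts \<rho> h $$ (k, j))"
      by (rule mat_mult_entry[OF carrier carrier ijN])
    also have "\<dots> = (\<Sum>r<length ts * d. ?f (r div d) (r mod d))"
      using ijN by (intro sum.cong) (simp_all add: I N_def k_def l_def)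
    also have "\<dots> = (\<Sum>m'<length ts. \<Sum>a<d. ?f m' a)"
      by (rule sum_div_mod)
    also have "\<dots> = (\<Sum>m'\<in>{m}. \<Sum>a<d. ?f m' a)"
    proof (rule sum.mono_neutral_right)
      show "\<forall>m'\<in>{..<length ts} - {m}. (\<Sum>a<d. ?f m' a) = 0"
      proof
        fix m' assume "m' \<in> {..<length ts} - {m}"
        then have "c m' h l \<notin> H"
          using m_unique by blast
        then show "(\<Sum>a<d. ?f m' a) = 0"
          by simp
      qed
    qed (use m(1) in auto)
    also have "\<dots> = (if c k (g \<otimes>\<^bsub>G\<^esub> h) l \<in> H then \<rho> (c k (g \<otimes>\<^bsub>G\<^esub> h) l) $$ (i mod d, j mod d) else 0)"
    proof (cases "c k g m \<in> H")
      case True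
      have "(\<Sum>a<d. ?f m a) = (\<rho> (c k g m) * \<rho> (c m h l)) $$ (i mod d, j mod d)"
        unfolding mat_mult_entry[OF d(1)[OF True] d(1)[OF mH] less(2,4)] using True mH by simp
      then show ?thesis
        using True mem d(3)[OF True mH] by (simp add: c_mult)
    next
      case False
      then show ?thesis
        using mem by simp
    qed
    also have "\<dots> = induced_rep G H ts \<rho> (g \<otimes>\<^bsub>G\<^esub> h) $$ (i, j)"
      using ijN by (simp add: I k_def l_def)
    finally show "induced_rep G H ts \<rho> (g \<otimes>\<^bsub>G\<^esub> h) $$ (i, j) =
      (induced_rep G H ts \<rho> g * induced_rep G H ts \<rho> h) $$ (i, j)"
      by (rule sym)
  qed (simp_all add: I)
  show ?thesis
    unfolding representation_def using carrier one mult by blast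
qed

lemma restrict_rep_representation:
  assumes "subgroup H G" "representation G \<rho>"
  shows "representation (G\<lparr>carrier := H\<rparr>) (restrict_rep H \<rho>)"
proof -
  define d where "d = dim_row (\<rho> \<one>\<^bsub>G\<^esub>)"
  note d = representation_carrier_mat[OF assms(2), folded d_def] representation_one[OF assms(2), folded d_def]
    representation_mult[OF assms(2)]
  then show ?thesis
    unfolding representation_def restrict_rep_def
    using subgroup.mem_carrier[OF assms(1)] subgroup.one_closed[OF assms(1)]
      subgroup.m_closed[OF assms(1)]
    by (intro exI[of _ d]) simp
qed

text \<open>The projection formula on characters. The argument of the \<open>k\<close>-th diagonal
  block is a conjugate of \<open>g\<close>, and \<rho> is a representation of all of
  \<open>G\<close>, so every such block with argument in \<open>H\<close> has the trace of
  \<open>\<rho> g\<close>.\<close>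

lemma character_induced_restrict_rep:
  assumes "group G" "subgroup H G" "left_transversal G H ts" "representation G \<rho>" "g \<in> carrier G"
  shows "character (induced_rep G H ts (restrict_rep H \<rho>)) g =
    character \<rho> g * of_nat (card {k. k < length ts \<and> inv\<^bsub>G\<^esub> (ts ! k) \<otimes>\<^bsub>G\<^esub> g \<otimes>\<^bsub>G\<^esub> ts ! k \<in> H})"
proof -
  interpret group G
    by (rule assms(1))
  define d where "d = dim_row (\<rho> \<one>\<^bsub>G\<^esub>)"
  note d = representation_carrier_mat[OF assms(4), folded d_def] representation_one[OF assms(4), folded d_def]
    representation_mult[OF assms(4)]
  define c where "c k = inv\<^bsub>G\<^esub> (ts ! k) \<otimes>\<^bsub>G\<^esub> g \<otimes>\<^bsub>G\<^esub> ts ! k" for k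
  have ts: "ts ! k \<in> carrier G" if "k < length ts" for k
    using that assms(3) nth_mem unfolding left_transversal_def by blast
  have char: "(\<Sum>i<d. \<rho> (c k) $$ (i, i)) = character \<rho> g" if k: "k < length ts" for k
  proof -
    have "c k \<in> carrier G"
      using ts[OF k] assms(5) by (simp add: c_def)
    then have "(\<Sum>i<d. \<rho> (c k) $$ (i, i)) = character \<rho> (c k)"
      using carrier_matD(1)[OF d(1)] by (simp add: character_def)
    also have "\<dots> = character \<rho> g"
      using character_conjugate[OF assms(1,4,5) inv_closed[OF ts[OF k]]] ts[OF k] by (simp add: c_def)
    finally show ?thesis .
  qed
  let ?f = "\<lambda>k i. if c k \<in> H then \<rho> (c k) $$ (i, i) else 0"
  have "\<one>\<^bsub>G\<^esub> \<in> H"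
    using assms(2) by (rule subgroup.one_closed)
  then have "character (induced_rep G H ts (restrict_rep H \<rho>)) g =
      (\<Sum>i<length ts * d. ?f (i div d) (i mod d))"
    by (simp add: character_def induced_rep_def Let_def restrict_rep_def d(2) c_def cong: if_cong)
  also have "\<dots> = (\<Sum>k<length ts. \<Sum>i<d. ?f k i)"
    by (rule sum_div_mod)
  also have "\<dots> = (\<Sum>k<length ts. if c k \<in> H then character \<rho> g else 0)"
    by (rule sum.cong) (simp_all add: char)
  also have "\<dots> = character \<rho> g * of_nat (card {k. k < length ts \<and> c k \<in> H})"
    by (simp add: sum.If_cases Int_def)
  finally show ?thesis
    by (simp only: c_def)
qed

section \<open>Young subgroups\<close>

text \<open>No element of \<open>J\<close> lies strictly inside a block, so the number of smaller
  elements is constant on it. To the left of the block \<open>a\<close> is no longer counted, to its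
  right \<open>b\<close> is counted in addition.\<close>

lemma jump_word_eq_on_block:
  assumes "J \<subseteq> {1..n - 1}" "X \<in> young_blocks n J"
  obtains c where "X = {p \<in> {1..n}. jump_word n J p = c}"
proof -
  let ?S = "insert 0 (insert n J)"
  obtain a b where ab: "X = {a<..b}" "a \<in> ?S" "b \<in> ?S" "a < b" "{a<..<b} \<inter> ?S = {}"
    using assms(2) unfolding young_blocks_def by blast
  have J: "j \<le> n" if "j \<in> J" for j
    using assms(1) that by fastforce
  have b: "b \<le> n"
    using ab(3) J by auto
  have fin: "finite {j \<in> J. j < p}" for p
    by (rule finite_subset[of _ "{..<p}"]) auto
  have word: "jump_word n J p = card {j \<in> J. j < p}" if "p \<in> {1..n}" for p
    unfolding jump_word_def using that by (rule restrict_apply')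
  have inside: "{j \<in> J. j < p} = {j \<in> J. j < b}" if "a < p" "p \<le> b" for p
  proof -
    have "j < p" if "j \<in> J" "j < b" for j
    proof (rule ccontr)
      assume "\<not> j < p"
      then have "j \<in> {a<..<b} \<inter> ?S"
        using that \<open>a < p\<close> by simp
      then show False
        using ab(5) by blast
    qed
    then show ?thesis
      using \<open>p \<le> b\<close> by auto
  qed
  have below: "card {j \<in> J. j < p} < card {j \<in> J. j < b}" if "1 \<le> p" "p \<le> a" for p
  proof (rule psubset_card_mono[OF fin])
    \<comment> \<open>A position \<open>p\<close> with \<open>1 \<le> p\<close> and
      \<open>p \<le> a\<close> exists and \<open>a < b\<close>, so \<open>a\<close> is neither of
      the artificial end points 0 and \<open>n\<close>.\<close>
    have "a \<in> J"
      using ab(2,4) b that by auto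
    then have "a \<in> {j \<in> J. j < b} - {j \<in> J. j < p}"
      using that ab(4) by simp
    moreover have "{j \<in> J. j < p} \<subseteq> {j \<in> J. j < b}"
      using that ab(4) by auto
    ultimately show "{j \<in> J. j < p} \<subset> {j \<in> J. j < b}"
      by blast
  qed
  have above: "card {j \<in> J. j < b} < card {j \<in> J. j < p}" if "b < p" "p \<le> n" for p
  proof (rule psubset_card_mono[OF fin])
    have "b \<in> J"
      using ab(3,4) that by auto
    then have "b \<in> {j \<in> J. j < p} - {j \<in> J. j < b}"
      using that by simp
    moreover have "{j \<in> J. j < b} \<subseteq> {j \<in> J. j < p}"
      using that by auto
    ultimately show "{j \<in> J. j < b} \<subset> {j \<in> J. j < p}"
      by blast
  qed
  have "p \<in> X \<longleftrightarrow> p \<in> {1..n} \<and> jump_word n J p = card {j \<in> J. j < b}" for p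
  proof (cases "p \<in> {1..n}")
    case True
    consider "p \<le> a" | "a < p" "p \<le> b" | "b < p"
      by linarith
    then show ?thesis
    proof cases
      case 1
      then show ?thesis
        using True word[OF True] below[of p] ab(1) by auto
    next
      case 2
      then show ?thesis
        using True word[OF True] inside[of p] ab(1) by auto
    next
      case 3
      then show ?thesis
        using True word[OF True] above[of p] ab(1) by auto
    qed
  next
    case False
    then show ?thesis
      using ab(1) b by auto
  qed
  then have "X = {p \<in> {1..n}. jump_word n J p = card {j \<in> J. j < b}}"
    by blast
  then show thesis
    by (rule that)
qed

lemma young_blocks_cover:
  assumes "J \<subseteq> {1..n - 1}" "p \<in> {1..n}"
  obtains X where "X \<in> young_blocks n J" "p \<in> X"
proof -
  let ?S = "insert 0 (insert n J)"
  have fin: "finite ?S"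
    using finite_subset[OF assms(1)] by simp
  \<comment> \<open>The block of \<open>p\<close> runs from the last cut before \<open>p\<close> to
    the first cut from \<open>p\<close> on; 0 and \<open>n\<close> ensure that both exist.\<close>
  define a where "a = Max {s \<in> ?S. s < p}"
  define b where "b = Min {s \<in> ?S. p \<le> s}"
  have A: "finite {s \<in> ?S. s < p}" "{s \<in> ?S. s < p} \<noteq> {}"
    using fin assms(2) by auto
  have B: "finite {s \<in> ?S. p \<le> s}" "{s \<in> ?S. p \<le> s} \<noteq> {}"
    using fin assms(2) by auto
  have a: "a \<in> ?S" "a < p"
    using Max_in[OF A] by (simp_all add: a_def)
  have b: "b \<in> ?S" "p \<le> b"
    using Min_in[OF B] by (simp_all add: b_def)
  have "{a<..<b} \<inter> ?S = {}"
  proof (rule ccontr)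
    assume "{a<..<b} \<inter> ?S \<noteq> {}"
    then obtain s where s: "a < s" "s < b" "s \<in> ?S"
      by (metis IntE all_not_in_conv greaterThanLessThan_iff)
    show False
    proof (cases "s < p")
      case True
      then have "s \<le> a"
        unfolding a_def using s(3) A(1) by (intro Max_ge) simp_all
      then show ?thesis
        using s(1) by simp
    next
      case False
      then have "b \<le> s"
        unfolding b_def using s(3) B(1) by (intro Min_le) simp_all
      then show ?thesis
        using s(2) by simp
    qed
  qed
  then have "{a<..b} \<in> young_blocks n J"
    unfolding young_blocks_def using a b by (intro CollectI exI[of _ a] exI[of _ b]) simp
  moreover have "p \<in> {a<..b}"
    using a b by simp
  ultimately show thesis
    by (rule that)
qed

text \<open>The blocks are level sets of the jump word and cover all positions, so preserving every
  block is the same as preserving the word.\<close>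

lemma young_subgroup_eq_stabilizer:
  assumes "J \<subseteq> {1..n - 1}"
  shows "young_subgroup n J = {\<pi>. \<pi> permutes {1..n} \<and> jump_word n J \<circ> \<pi> = jump_word n J}"
proof (intro equalityI subsetI)
  fix \<pi> assume \<pi>: "\<pi> \<in> young_subgroup n J"
  then have perm: "\<pi> permutes {1..n}"
    by (simp only: young_subgroup_def mem_Collect_eq sym_group_carrier)
  have "jump_word n J (\<pi> p) = jump_word n J p" for p
  proof (cases "p \<in> {1..n}")
    case True
    obtain X where X: "X \<in> young_blocks n J" "p \<in> X"
      by (rule young_blocks_cover[OF assms True])
    obtain c where c: "X = {p \<in> {1..n}. jump_word n J p = c}"
      by (rule jump_word_eq_on_block[OF assms X(1)])
    have "\<pi> p \<in> X"
      using \<pi> X unfolding young_subgroup_def by blast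
    then show ?thesis
      using X(2) unfolding c by simp
  next
    case False
    then show ?thesis
      using permutes_not_in[OF perm] by simp
  qed
  then show "\<pi> \<in> {\<pi>. \<pi> permutes {1..n} \<and> jump_word n J \<circ> \<pi> = jump_word n J}"
    using perm by (simp add: fun_eq_iff)
next
  fix \<pi> assume "\<pi> \<in> {\<pi>. \<pi> permutes {1..n} \<and> jump_word n J \<circ> \<pi> = jump_word n J}"
  then have perm: "\<pi> permutes {1..n}" and "jump_word n J \<circ> \<pi> = jump_word n J"
    by blast+
  then have fixed: "jump_word n J (\<pi> p) = jump_word n J p" for p
    by (metis comp_apply)
  have "\<pi> ` X = X" if X: "X \<in> young_blocks n J" for X
  proof -
    obtain c where c: "X = {p \<in> {1..n}. jump_word n J p = c}"
      by (rule jump_word_eq_on_block[OF assms X])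
    have "\<pi> ` X \<subseteq> X"
    proof (rule image_subsetI)
      fix p assume "p \<in> X"
      then show "\<pi> p \<in> X"
        unfolding c mem_Collect_eq fixed permutes_in_image[OF perm] .
    qed
    moreover have "finite X" "inj_on \<pi> X"
      using permutes_inj_on[OF perm] by (simp_all add: c)
    ultimately show ?thesis
      by (intro endo_inj_surj)
  qed
  then show "\<pi> \<in> young_subgroup n J"
    unfolding young_subgroup_def mem_Collect_eq sym_group_carrier using perm by blast
qed

lemma subgroup_young_subgroup:
  assumes "J \<subseteq> {1..n - 1}"
  shows "subgroup (young_subgroup n J) (sym_group n)"
proof (rule group.subgroupI[OF sym_group_is_group])
  let ?u = "jump_word n J"
  note H = young_subgroup_eq_stabilizer[OF assms]
  show "young_subgroup n J \<subseteq> carrier (sym_group n)"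
    unfolding young_subgroup_def by blast
  have "id \<in> young_subgroup n J"
    unfolding H using permutes_id by simp
  then show "young_subgroup n J \<noteq> {}"
    by blast
  show "inv\<^bsub>sym_group n\<^esub> \<pi> \<in> young_subgroup n J" if \<pi>: "\<pi> \<in> young_subgroup n J" for \<pi>
  proof -
    have perm: "\<pi> permutes {1..n}" and fixed: "?u \<circ> \<pi> = ?u"
      using \<pi> unfolding H by blast+
    have "?u \<circ> inv' \<pi> = ?u \<circ> \<pi> \<circ> inv' \<pi>"
      by (simp only: fixed)
    also have "\<dots> = ?u"
      by (simp only: comp_assoc permutes_inv_o(1)[OF perm] comp_id)
    finally have "inv' \<pi> \<in> young_subgroup n J"
      unfolding H using permutes_inv[OF perm] by blast
    moreover have "\<pi> \<in> carrier (sym_group n)"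
      using perm by (simp only: sym_group_carrier)
    ultimately show ?thesis
      by (simp only: sym_group_inv_equality)
  qed
  show "\<pi> \<otimes>\<^bsub>sym_group n\<^esub> \<tau> \<in> young_subgroup n J"
    if "\<pi> \<in> young_subgroup n J" "\<tau> \<in> young_subgroup n J" for \<pi> \<tau>
  proof -
    have perm: "\<pi> permutes {1..n}" "\<tau> permutes {1..n}" and fixed: "?u \<circ> \<pi> = ?u" "?u \<circ> \<tau> = ?u"
      using that unfolding H by blast+
    have "?u \<circ> (\<pi> \<circ> \<tau>) = ?u"
      by (simp only: comp_assoc[symmetric] fixed)
    then show ?thesis
      unfolding H sym_group_mult using permutes_compose[OF perm(2,1)] by blast
  qed
qed

text \<open>
  The cosets \<open>t H\<close> of the Young subgroup \<open>H\<close> correspond to the rearrangements \<open>u \<circ> t\<^sup>-\<^sup>1\<close> of the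
  word \<open>u\<close> whose stabilizer is \<open>H\<close>.
\<close>

lemma card_fixed_cosets:
  assumes "J \<subseteq> {1..n - 1}" "left_transversal (sym_group n) (young_subgroup n J) ts"
    and g: "g permutes {1..n}"
  shows "card {k. k < length ts \<and>
      inv\<^bsub>sym_group n\<^esub> (ts ! k) \<otimes>\<^bsub>sym_group n\<^esub> g \<otimes>\<^bsub>sym_group n\<^esub> ts ! k \<in> young_subgroup n J} =
    card (fixed_words n (jump_content n J) g)"
proof (rule bij_betw_same_card)
  let ?G = "sym_group n" and ?H = "young_subgroup n J" and ?u = "jump_word n J"
  note H = young_subgroup_eq_stabilizer[OF assms(1)]
  let ?K = "{k. k < length ts \<and> inv\<^bsub>?G\<^esub> (ts ! k) \<otimes>\<^bsub>?G\<^esub> g \<otimes>\<^bsub>?G\<^esub> ts ! k \<in> ?H}"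
  have tsG: "ts ! k \<in> carrier ?G" if "k < length ts" for k
    using that assms(2) nth_mem unfolding left_transversal_def by blast
  have ts: "ts ! k permutes {1..n}" if "k < length ts" for k
    using tsG[OF that] by (simp only: sym_group_carrier)
  have HG: "?H \<subseteq> carrier ?G"
    by (rule subgroup.subset[OF subgroup_young_subgroup[OF assms(1)]])
  have stab: "inv' t \<circ> s \<in> ?H \<longleftrightarrow> ?u \<circ> inv' t \<circ> s = ?u" if "t permutes {1..n}" "s permutes {1..n}" for s t
    unfolding H using permutes_compose[OF that(2) permutes_inv[OF that(1)]] by (simp add: comp_assoc)
  have mult: "inv\<^bsub>?G\<^esub> (ts ! k) \<otimes>\<^bsub>?G\<^esub> s = inv' (ts ! k) \<circ> s" if "k < length ts" for k s
    by (simp only: sym_group_mult sym_group_inv_equality[OF tsG[OF that]])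
  have cancel: "x \<circ> t \<circ> inv' t = x" "x \<circ> inv' t \<circ> t = x" if "t permutes {1..n}" for x :: "nat \<Rightarrow> nat" and t
    using permutes_inv_o[OF that] by (simp_all only: comp_assoc comp_id)
  \<comment> \<open>An index is counted iff \<open>g\<close> fixes the rearrangement that belongs to
    its coset.\<close>
  have K: "k \<in> ?K \<longleftrightarrow> ?u \<circ> inv' (ts ! k) \<circ> g = ?u \<circ> inv' (ts ! k)" if k: "k < length ts" for k
  proof -
    have "k \<in> ?K \<longleftrightarrow> inv' (ts ! k) \<circ> (g \<circ> ts ! k) \<in> ?H"
      using k by (simp only: mem_Collect_eq mult[OF k] simp_thms) (simp only: sym_group_mult comp_assoc)
    also have "\<dots> \<longleftrightarrow> ?u \<circ> inv' (ts ! k) \<circ> (g \<circ> ts ! k) = ?u"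
      by (rule stab[OF ts[OF k] permutes_compose[OF ts[OF k] g]])
    also have "\<dots> \<longleftrightarrow> ?u \<circ> inv' (ts ! k) \<circ> g = ?u \<circ> inv' (ts ! k)"
    proof
      assume eq: "?u \<circ> inv' (ts ! k) \<circ> (g \<circ> ts ! k) = ?u"
      have "?u \<circ> inv' (ts ! k) \<circ> g = ?u \<circ> inv' (ts ! k) \<circ> g \<circ> ts ! k \<circ> inv' (ts ! k)"
        by (simp only: cancel(1)[OF ts[OF k]])
      also have "\<dots> = ?u \<circ> inv' (ts ! k)"
        using eq by (simp only: comp_assoc[symmetric])
      finally show "?u \<circ> inv' (ts ! k) \<circ> g = ?u \<circ> inv' (ts ! k)" .
    next
      assume eq: "?u \<circ> inv' (ts ! k) \<circ> g = ?u \<circ> inv' (ts ! k)"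
      show "?u \<circ> inv' (ts ! k) \<circ> (g \<circ> ts ! k) = ?u"
        unfolding comp_assoc[symmetric] eq by (rule cancel(2)[OF ts[OF k]])
    qed
    finally show ?thesis .
  qed
  show "bij_betw (\<lambda>k. ?u \<circ> inv' (ts ! k)) ?K (fixed_words n (jump_content n J) g)"
  proof (rule bij_betw_imageI)
    show "inj_on (\<lambda>k. ?u \<circ> inv' (ts ! k)) ?K"
    proof (rule inj_onI)
      fix k l assume "k \<in> ?K" "l \<in> ?K" and eq: "?u \<circ> inv' (ts ! k) = ?u \<circ> inv' (ts ! l)"
      then have kl: "k < length ts" "l < length ts"
        by blast+
      obtain m where m: "m < length ts" "inv\<^bsub>?G\<^esub> (ts ! m) \<otimes>\<^bsub>?G\<^esub> ts ! l \<in> ?H"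
        and unique: "\<And>k. k < length ts \<Longrightarrow> inv\<^bsub>?G\<^esub> (ts ! k) \<otimes>\<^bsub>?G\<^esub> ts ! l \<in> ?H \<Longrightarrow> k = m"
        by (rule left_transversal_unique_index[OF sym_group_is_group HG assms(2) tsG[OF kl(2)]]) blast
      have "?u \<circ> inv' (ts ! k) \<circ> ts ! l = ?u" "?u \<circ> inv' (ts ! l) \<circ> ts ! l = ?u"
        by (simp_all only: eq cancel[OF ts[OF kl(2)]])
      then have "k = m" "l = m"
        using unique[OF kl(1)] unique[OF kl(2)] kl
        by (simp_all only: mult stab[OF ts[OF kl(1)] ts[OF kl(2)]] stab[OF ts[OF kl(2)] ts[OF kl(2)]])
      then show "k = l"
        by simp
    qed
    show "(\<lambda>k. ?u \<circ> inv' (ts ! k)) ` ?K = fixed_words n (jump_content n J) g"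
    proof (intro equalityI subsetI)
      fix y assume "y \<in> (\<lambda>k. ?u \<circ> inv' (ts ! k)) ` ?K"
      then obtain k where k: "k \<in> ?K" "y = ?u \<circ> inv' (ts ! k)"
        by blast
      then have "k < length ts"
        by blast
      then show "y \<in> fixed_words n (jump_content n J) g"
        unfolding fixed_words_def k(2) using K k(1) ts
        by (simp only: mem_Collect_eq words_comp_permutes[OF jump_word_in_words permutes_inv] simp_thms)
    next
      fix y assume y: "y \<in> fixed_words n (jump_content n J) g"
      then have y': "y \<in> words n (jump_content n J)" and yg: "y \<circ> g = y"
        by (simp_all add: fixed_words_def)
      obtain p where p: "p permutes {1..n}" "y = ?u \<circ> p"
        by (rule words_transitive[OF jump_word_in_words y'])
      \<comment> \<open>The word \<open>?u \<circ> p\<close> belongs to the coset of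
        \<open>inv' p\<close>, whose representative is looked up in the transversal.\<close>
      have "inv' p \<in> carrier ?G"
        using permutes_inv[OF p(1)] by (simp only: sym_group_carrier)
      then obtain m where m: "m < length ts" "inv\<^bsub>?G\<^esub> (ts ! m) \<otimes>\<^bsub>?G\<^esub> inv' p \<in> ?H"
        by (rule left_transversal_unique_index[OF sym_group_is_group HG assms(2)])
      then have "?u \<circ> inv' (ts ! m) \<circ> inv' p = ?u"
        by (simp only: mult stab[OF ts[OF m(1)] permutes_inv[OF p(1)]])
      then have "?u \<circ> inv' (ts ! m) \<circ> inv' p \<circ> p = y"
        by (simp only: p(2))
      then have ym: "?u \<circ> inv' (ts ! m) = y"
        by (simp only: cancel(2)[OF p(1)])
      then have "m \<in> ?K"
        unfolding K[OF m(1)] using yg by simp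
      then show "y \<in> (\<lambda>k. ?u \<circ> inv' (ts ! k)) ` ?K"
        using ym by blast
    qed
  qed
qed

section \<open>Products of fine sets with inverse descent classes\<close>

lemma product_mset_subset_carrier:
  assumes "B \<subseteq> carrier (sym_group n)" "R \<subseteq> carrier (sym_group n)"
  shows "set_mset (product_mset B (inverses n R)) \<subseteq> carrier (sym_group n)"
proof
  have fin: "finite B" "finite R"
    using assms finite_carrier_sym_group finite_subset by blast+
  fix \<pi> assume "\<pi> \<in> set_mset (product_mset B (inverses n R))"
  then obtain b \<sigma> where *: "b \<in> B" "\<sigma> \<in> R" "\<pi> = b \<circ> inv\<^bsub>sym_group n\<^esub> \<sigma>"
    using fin by (auto simp: product_mset_def inverses_def)
  have "b \<otimes>\<^bsub>sym_group n\<^esub> inv\<^bsub>sym_group n\<^esub> \<sigma> \<in> carrier (sym_group n)"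
    using * assms
    by (intro monoid.m_closed[OF group.is_monoid[OF sym_group_is_group]]
        group.inv_closed[OF sym_group_is_group]) blast+
  then show "\<pi> \<in> carrier (sym_group n)"
    unfolding * sym_group_mult .
qed

lemma fine_for_iff:
  assumes "B \<subseteq> carrier (sym_group n)"
  shows "fine_for n (mset_set B) \<rho> \<longleftrightarrow> representation (sym_group n) \<rho> \<and> fine_char n (character \<rho>) B"
proof -
  have "finite B"
    using assms finite_carrier_sym_group finite_subset by blast
  moreover have "frobenius_ch n (character \<rho>) = quasi n (mset_set B) \<longleftrightarrow>
      (\<forall>m. mps_coeff (frobenius_ch n (character \<rho>)) m = mps_coeff (quasi n (mset_set B)) m)"
    by (auto intro: mps_eqI)
  then have "frobenius_ch n (character \<rho>) = quasi n (mset_set B) \<longleftrightarrow> fine_char n (character \<rho>) B"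
    by (simp only: fine_char_def mean_def coeff_frobenius_ch coeff_quasi sum_unfold_sum_mset)
  ultimately show ?thesis
    using assms unfolding fine_for_def by simp
qed

lemma fine_for_induced:
  assumes "B \<subseteq> carrier (sym_group n)" "fine_for n (mset_set B) \<rho>" "J \<subseteq> {1..n - 1}"
    and "left_transversal (sym_group n) (young_subgroup n J) ts"
  shows "fine_for n (product_mset B (inverses n (R_class n J)))
    (induced_rep (sym_group n) (young_subgroup n J) ts (restrict_rep (young_subgroup n J) \<rho>))"
proof -
  let ?I = "induced_rep (sym_group n) (young_subgroup n J) ts (restrict_rep (young_subgroup n J) \<rho>)"
  have rep: "representation (sym_group n) \<rho>" and fine: "fine_char n (character \<rho>) B"
    using assms(2) fine_for_iff[OF assms(1)] by blast+
  note H = subgroup_young_subgroup[OF assms(3)]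
  have char: "character ?I g = character \<rho> g * of_nat (card (fixed_words n (jump_content n J) g))"
    if "g permutes {1..n}" for g
  proof -
    have "g \<in> carrier (sym_group n)"
      using that by (simp only: sym_group_carrier)
    then show ?thesis
      using character_induced_restrict_rep[OF sym_group_is_group H assms(4) rep]
      by (simp only: card_fixed_cosets[OF assms(3,4) that])
  qed
  have "mps_coeff (frobenius_ch n (character ?I)) m =
      mps_coeff (quasi n (product_mset B (inverses n (R_class n J)))) m" for m
  proof -
    have "mps_coeff (frobenius_ch n (character ?I)) m =
        mean n (\<lambda>\<pi>. character ?I \<pi> * of_nat (card (fixed_words n m \<pi>)))"
      by (simp only: coeff_frobenius_ch mean_def)
    also have "\<dots> = mean n (\<lambda>\<pi>. character \<rho> \<pi> * of_nat (card (fixed_words n (jump_content n J) \<pi>)) *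
        of_nat (card (fixed_words n m \<pi>)))"
      by (rule mean_cong) (simp only: char)
    also have "\<dots> = mps_coeff (quasi n (product_mset B (inverses n (R_class n J)))) m"
      by (simp only: fine_char_times_fixed_words[OF fine] coeff_quasi_R_class[OF assms(1)])
    finally show ?thesis .
  qed
  then have "frobenius_ch n (character ?I) = quasi n (product_mset B (inverses n (R_class n J)))"
    by (rule mps_eqI)
  moreover have "representation (sym_group n) ?I"
    by (rule induced_rep_representation[OF sym_group_is_group H assms(4)
          restrict_rep_representation[OF H rep]])
  moreover have "set_mset (product_mset B (inverses n (R_class n J))) \<subseteq> carrier (sym_group n)"
    by (rule product_mset_subset_carrier[OF assms(1)]) (auto simp: R_class_def)
  ultimately show ?thesis
    unfolding fine_for_def by blast
qed

lemma fine_for_tensor: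
  assumes "B \<subseteq> carrier (sym_group n)" "fine_for n (mset_set B) \<rho>" "J \<subseteq> {1..n - 1}"
    and "skew_specht n (ribbon n J) \<sigma>"
  shows "fine_for n (product_mset B (inverses n (D_class n J))) (tensor_rep \<rho> \<sigma>)"
proof -
  have rep: "representation (sym_group n) \<rho>" and fine: "fine_char n (character \<rho>) B"
    using assms(2) fine_for_iff[OF assms(1)] by blast+
  have rep': "representation (sym_group n) \<sigma>"
    and ch: "frobenius_ch n (character \<sigma>) = skew_schur (ribbon n J)"
    using assms(4) unfolding skew_specht_def by blast+
  have "finite J"
    using assms(3) finite_subset by blast
  \<comment> \<open>The same \<psi> works for every fine pair: the trivial character and
    \<open>{id}\<close> identify it with the character of \<sigma>, and then the character of \<rho>
    and \<open>B\<close> give the tensor product.\<close>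
  then obtain \<psi> where \<psi>: "class_function n \<psi>" "\<forall>\<chi> B m. fine_char n \<chi> B \<longrightarrow>
      mean n (\<lambda>\<pi>. \<chi> \<pi> * \<psi> \<pi> * of_nat (card (fixed_words n m \<pi>))) =
      of_nat (\<Sum>b\<in>B. card {x \<in> words n m. pair_descents n b x = J})"
    using ribbon_class_function_exists[of J n] by blast
  have eq: "character \<sigma> \<pi> = \<psi> \<pi>" if "\<pi> permutes {1..n}" for \<pi>
  proof -
    let ?f = "\<lambda>\<pi>. character \<sigma> \<pi> - \<psi> \<pi>"
    have mean_zero: "mean n (\<lambda>\<pi>. ?f \<pi> * of_nat (card (fixed_words n m \<pi>))) = 0" for m
    proof -
      have "mean n (\<lambda>\<pi>. 1 * \<psi> \<pi> * of_nat (card (fixed_words n m \<pi>))) =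
          of_nat (\<Sum>b\<in>{id}. card {x \<in> words n m. pair_descents n b x = J})"
        using \<psi>(2) fine_char_trivial by blast
      moreover have "mean n (\<lambda>\<pi>. character \<sigma> \<pi> * of_nat (card (fixed_words n m \<pi>))) =
          mps_coeff (skew_schur (ribbon n J)) m"
        by (simp only: ch[symmetric] coeff_frobenius_ch mean_def)
      ultimately show ?thesis
        by (simp add: left_diff_distrib mean_diff coeff_skew_schur_ribbon[OF assms(3)])
    qed
    have "class_function n ?f"
      using class_function_character[OF rep'] \<psi>(1) by (simp add: class_function_def)
    then have "?f \<pi> = 0"
      using mean_zero that by (rule class_function_eq_zero[of n ?f])
    then show ?thesis
      by simp
  qed
  have char: "character (tensor_rep \<rho> \<sigma>) \<pi> = character \<rho> \<pi> * \<psi> \<pi>" if "\<pi> permutes {1..n}" for \<pi>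
  proof -
    have "\<pi> \<in> carrier (sym_group n)"
      using that by (simp only: sym_group_carrier)
    then show ?thesis
      by (simp only: character_tensor_rep[OF rep rep'] eq[OF that])
  qed
  have "mps_coeff (frobenius_ch n (character (tensor_rep \<rho> \<sigma>))) m =
      mps_coeff (quasi n (product_mset B (inverses n (D_class n J)))) m" for m
  proof -
    have "mps_coeff (frobenius_ch n (character (tensor_rep \<rho> \<sigma>))) m =
        mean n (\<lambda>\<pi>. character (tensor_rep \<rho> \<sigma>) \<pi> * of_nat (card (fixed_words n m \<pi>)))"
      by (simp only: coeff_frobenius_ch mean_def)
    also have "\<dots> = mean n (\<lambda>\<pi>. character \<rho> \<pi> * \<psi> \<pi> * of_nat (card (fixed_words n m \<pi>)))"
      by (rule mean_cong) (simp only: char)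
    also have "\<dots> = of_nat (\<Sum>b\<in>B. card {x \<in> words n m. pair_descents n b x = J})"
      using \<psi>(2) fine by blast
    also have "\<dots> = mps_coeff (quasi n (product_mset B (inverses n (D_class n J)))) m"
      by (simp only: coeff_quasi_D_class[OF assms(1)])
    finally show ?thesis .
  qed
  then have "frobenius_ch n (character (tensor_rep \<rho> \<sigma>)) =
      quasi n (product_mset B (inverses n (D_class n J)))"
    by (rule mps_eqI)
  moreover have "representation (sym_group n) (tensor_rep \<rho> \<sigma>)"
    by (rule tensor_rep_representation[OF sym_group_is_group rep rep'])
  moreover have "set_mset (product_mset B (inverses n (D_class n J))) \<subseteq> carrier (sym_group n)"
    by (rule product_mset_subset_carrier[OF assms(1)]) (auto simp: D_class_def)
  ultimately show ?thesis
    unfolding fine_for_def by blast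
qed

theorem theorem5p12:
  fixes n :: nat and B :: "(nat \<Rightarrow> nat) set" and \<rho> :: "(nat \<Rightarrow> nat) \<Rightarrow> complex mat"
    and J :: "nat set"
  assumes "n \<ge> 1"
    and "B \<subseteq> carrier (sym_group n)"
    and "fine_for n (mset_set B) \<rho>"
    and "J \<subseteq> {1..n - 1}"
  shows "(\<forall>ts. left_transversal (sym_group n) (young_subgroup n J) ts \<longrightarrow>
            fine_for n (product_mset B (inverses n (R_class n J)))
              (induced_rep (sym_group n) (young_subgroup n J) ts
                (restrict_rep (young_subgroup n J) \<rho>))) \<and>
         (\<forall>\<sigma>. skew_specht n (ribbon n J) \<sigma> \<longrightarrow>
            fine_for n (product_mset B (inverses n (D_class n J))) (tensor_rep \<rho> \<sigma>))"
  using fine_for_induced[OF assms(2-4)] fine_for_tensor[OF assms(2-4)] by blast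

end
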